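(* Let $\mathfrak{A}$ be a combinatorial problem with ground set $\mathbb{B}=\{b_1,\dots,b_n\}$ and feasible family $\mathcal{F}\subseteq 2^{\mathbb{B}}$, and assume there is a multidimensional PTAS for $\mathsf{Multi}$-$\mathfrak{A}$. Then for any $\epsilon>0$ there is a polynomial time algorithm for $\mathsf{EUM\text{-}Mono}$-$\mathfrak{A}$ that finds a feasible solution $S\in\mathcal{F}$ such that $$\mathbb{E}[\mu(X(S))]\ \ge\ \mathsf{OPT}-\epsilon,$$ where $\mathsf{OPT}=\max_{S'\in\mathcal{F}}\mathbb{E}[\mu(X(S'))]$.
   Context: Deterministic problem $\mathfrak{A}$: given nonnegative weights on the elements, find $S\in\mathcal{F}$ of minimum total weight. $\mathsf{Multi}$-$\mathfrak{A}$: each element $b$ has a weight vector $(w_{b,1},w_{b,2},\dots)$ and a budget vector $(B_1,B_2,\dots)$ is given; the goal is to find $S\in\mathcal{F}$ with $\sum_{b\in S}w_{b,i}\le B_i$ for all $i$. A multidimensional PTAS for $\mathsf{Multi}$-$\mathfrak{A}$ is an algorithm which, for any fixed $\epsilon>0$, runs in polynomial time and either returns $S\in\mathcal{F}$ with $\sum_{b\in S}w_{b,i}\le(1+\epsilon)B_i$ for all $i$, or asserts that there is no $S'\in\mathcal{F}$ with $\sum_{b\in S'}w_{b,i}\le B_i$ for all $i$. $\mathsf{EUM\text{-}Mono}$-$\mathfrak{A}$: each element $b$ has a random weight $X_b$, a nonnegative discrete random variable with an explicitly given distribution; the $X_b$ are mutually independent; $X(S)=\sum_{b\in S}X_b$.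 A utility function $\mu:\mathbb{R}\to\mathbb{R}^{+}$ is given which is monotone nonincreasing, satisfies $\lim_{x\to\infty}\mu(x)=0$, and is $\alpha$-Lipschitz on $[0,\infty)$ for a positive constant $\alpha$. The goal is to find $S\in\mathcal{F}$ maximizing $\mathbb{E}[\mu(X(S))]$. *)

theory Defs
  imports
    "HOL-Probability.Probability"
    "HOL-Computational_Algebra.Polynomial"
    "HOL-Library.Log_Nat"
begin

section \<open>A machine model with polynomial-time cost accounting\<close>

text \<open>
  Programs act on binary trees with integer leaves.  Integers have unbounded precision but
  are charged by bit length (logarithmic cost criterion), and every instruction is charged at
  least the size of the data it touches.  Hence a computation of cost \<open>t\<close> only ever holds data
  of size at most (input size + \<open>t\<close>) (lemma \<open>exec_size\<close>), and each instruction is polynomial-time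
  on a Turing machine.  Conversely a tape is a pair of nested lists, and one Turing machine
  step costs linear time.  The model therefore defines the usual class of polynomial-time functions.
\<close>

datatype data = Num int | Cell data data

text \<open>Number of bits (plus one per constructor).\<close>

primrec dsize :: "data \<Rightarrow> nat" where
  "dsize (Num k) = Suc (floorlog 2 (nat \<bar>k\<bar>))"
| "dsize (Cell a b) = Suc (dsize a + dsize b)"

datatype arith_op = Plus | Minus | Times | Quot | Less

primrec arith :: "arith_op \<Rightarrow> int \<Rightarrow> int \<Rightarrow> int" where
  "arith Plus a b = a + b"
| "arith Minus a b = a - b"
| "arith Times a b = a * b"
| "arith Quot a b = a div b"
| "arith Less a b = (if a < b then 1 else 0)"

datatype prog =
    Ident
  | Const data
  | First
  | Second
  | IsNum
  | Arith arith_op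
  | Fork prog prog
  | Seq prog prog
  | Cond prog prog prog
  | While prog prog

text \<open>
  \<open>exec P v w t\<close>: on input \<open>v\<close> program \<open>P\<close> halts with output \<open>w\<close> at total cost \<open>t\<close>.
  A test succeeds iff its result differs from \<open>Num 0\<close>; ill-typed instructions get stuck.
\<close>

inductive exec :: "prog \<Rightarrow> data \<Rightarrow> data \<Rightarrow> nat \<Rightarrow> bool" where
  exec_Ident: "exec Ident v v (dsize v)"
| exec_Const: "exec (Const c) v c (dsize c + dsize v)"
| exec_First: "exec First (Cell a b) a (dsize (Cell a b))"
| exec_Second: "exec Second (Cell a b) b (dsize (Cell a b))"
| exec_IsNum_Num: "exec IsNum (Num k) (Num 1) (Suc (dsize (Num k)))"
| exec_IsNum_Node: "exec IsNum (Cell a b) (Num 0) (Suc (dsize (Cell a b)))"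
| exec_Arith:
    "exec (Arith f) (Cell (Num a) (Num b)) (Num (arith f a b)) (dsize (Cell (Num a) (Num b)))"
| exec_Fork:
    "exec P v a s \<Longrightarrow> exec Q v b t \<Longrightarrow> exec (Fork P Q) v (Cell a b) (Suc (s + t + dsize v))"
| exec_Seq:
    "exec P u v s \<Longrightarrow> exec Q v w t \<Longrightarrow> exec (Seq P Q) u w (Suc (s + t))"
| exec_Cond_True:
    "exec C v c s \<Longrightarrow> c \<noteq> Num 0 \<Longrightarrow> exec P v w t \<Longrightarrow> exec (Cond C P Q) v w (s + t + dsize v)"
| exec_Cond_False:
    "exec C v (Num 0) s \<Longrightarrow> exec Q v w t \<Longrightarrow> exec (Cond C P Q) v w (s + t + dsize v)"
| exec_While_False:
    "exec C v (Num 0) s \<Longrightarrow> exec (While C P) v v (s + dsize v)"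
| exec_While_True:
    "exec C u c r \<Longrightarrow> c \<noteq> Num 0 \<Longrightarrow> exec P u v s \<Longrightarrow> exec (While C P) v w t
      \<Longrightarrow> exec (While C P) u w (r + s + t + dsize u)"

inductive_cases exec_elims:
  "exec Ident v w t" "exec (Const c) v w t" "exec First v w t" "exec Second v w t"
  "exec IsNum v w t" "exec (Arith f) v w t" "exec (Fork P Q) v w t" "exec (Seq P Q) v w t"
  "exec (Cond C P Q) v w t"
inductive_cases exec_WhileE: "exec (While C P) v w t"

lemma exec_deterministic:
  "exec P v w t \<Longrightarrow> exec P v w' t' \<Longrightarrow> w' = w \<and> t' = t"
proof (induction arbitrary: w' t' rule: exec.induct)
  case (exec_Fork P v a s Q b t)
  from exec_Fork.prems show ?case
    by (rule exec_elims) (auto dest!: exec_Fork.IH)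
next
  case (exec_Seq P u v s Q w t)
  from exec_Seq.prems show ?case
    by (rule exec_elims) (auto dest!: exec_Seq.IH)
next
  case (exec_Cond_True C v c s P w t Q)
  from exec_Cond_True.prems exec_Cond_True.hyps show ?case
    by (elim exec_elims) (auto dest!: exec_Cond_True.IH)
next
  case (exec_Cond_False C v s Q w t P)
  from exec_Cond_False.prems show ?case
    by (elim exec_elims) (auto dest!: exec_Cond_False.IH)
next
  case (exec_While_False C v s P)
  from exec_While_False.prems show ?case
    by (rule exec_WhileE) (auto dest!: exec_While_False.IH(1))
next
  case (exec_While_True C u c r P v s w t)
  from exec_While_True.prems show ?case
  proof (rule exec_WhileE)
    fix s' assume "exec C u (Num 0) s'"
    then show ?case using exec_While_True.IH(1) exec_While_True.hyps by blast
  next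
    fix c' r' v' s' t''
    assume *: "t' = r' + s' + t'' + dsize u" "exec C u c' r'" "exec P u v' s'"
      "exec (While C P) v' w' t''"
    have "v' = v" "s' = s" "r' = r"
      using exec_While_True.IH(1)[OF *(2)] exec_While_True.IH(2)[OF *(3)] by auto
    with * exec_While_True.IH(3)[of w' t''] show ?case by auto
  qed
qed (erule exec_elims; simp)+

lemma floorlog2_le_iff: "floorlog 2 n \<le> k \<longleftrightarrow> n < 2 ^ k"
  by (simp add: floorlog_le_iff)

lemma dsize_arith: "dsize (Num (arith f a b)) \<le> dsize (Cell (Num a) (Num b))"
proof -
  define k l where "k = floorlog 2 (nat \<bar>a\<bar>)" and "l = floorlog 2 (nat \<bar>b\<bar>)"
  have "nat \<bar>a\<bar> < 2 ^ k" "nat \<bar>b\<bar> < 2 ^ l"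
    unfolding k_def l_def using floorlog2_le_iff by blast+
  then have a: "\<bar>a\<bar> < 2 ^ k" and b: "\<bar>b\<bar> < 2 ^ l"
    by (simp_all add: nat_less_iff)
  have pk: "(2::int) ^ k \<le> 2 ^ (k + l)" and pl: "(2::int) ^ l \<le> 2 ^ (k + l)"
    and p1: "(1::int) \<le> 2 ^ (k + l)"
    by (auto intro: power_increasing)
  have p2: "(2::int) ^ (k + l + 1) = 2 * 2 ^ (k + l)" by simp
  have "\<bar>arith f a b\<bar> < 2 ^ (k + l + 1)"
  proof (cases f)
    case Times
    have "\<bar>a\<bar> * \<bar>b\<bar> \<le> 2 ^ k * 2 ^ l"
      using a b by (intro mult_mono) auto
    then show ?thesis using Times p1 by (simp add: abs_mult power_add)
  next
    case Quot
    have "\<bar>a div b\<bar> \<le> \<bar>a\<bar>"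
    proof (cases "b = 0")
      case False
      have le: "\<bar>x div c\<bar> \<le> \<bar>x\<bar>" if "c > 0" for x c :: int
      proof -
        have "\<bar>x\<bar> * 1 \<le> \<bar>x\<bar> * c"
          using that by (intro mult_left_mono) auto
        then have "- \<bar>x\<bar> * c \<le> x" "x \<le> \<bar>x\<bar> * c"
          unfolding minus_mult_left[symmetric] by linarith+
        then have "(- \<bar>x\<bar> * c) div c \<le> x div c" "x div c \<le> (\<bar>x\<bar> * c) div c"
          using that by (blast intro: zdiv_mono1)+
        then have "- \<bar>x\<bar> \<le> x div c" "x div c \<le> \<bar>x\<bar>"
          using that nonzero_mult_div_cancel_right[of c "\<bar>x\<bar>"]
            nonzero_mult_div_cancel_right[of c "- \<bar>x\<bar>"] by linarith+
        then show ?thesis by linarith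
      qed
      show ?thesis
      proof (cases "b > 0")
        case True then show ?thesis by (rule le)
      next
        case neg: False
        have "\<bar>(- a) div (- b)\<bar> \<le> \<bar>- a\<bar>" using neg False by (intro le) simp
        then show ?thesis by simp
      qed
    qed simp
    moreover have "arith f a b = a div b" using Quot by simp
    ultimately show ?thesis using a pk p1 p2 by linarith
  next
    case Plus
    then have "arith f a b = a + b" by simp
    with a b pk pl p2 show ?thesis by linarith
  next
    case Minus
    then have "arith f a b = a - b" by simp
    with a b pk pl p2 show ?thesis by linarith
  next
    case Less
    then have "\<bar>arith f a b\<bar> \<le> 1" by simp
    with p1 p2 show ?thesis by linarith
  qed
  then have "nat \<bar>arith f a b\<bar> < 2 ^ (k + l + 1)"
    by (simp add: nat_less_iff)
  then have "floorlog 2 (nat \<bar>arith f a b\<bar>) \<le> k + l + 1"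
    using floorlog2_le_iff by blast
  then show ?thesis by (simp add: k_def l_def)
qed

lemma exec_size: "exec P v w t \<Longrightarrow> dsize w \<le> dsize v + t"
proof (induction rule: exec.induct)
  case (exec_Arith f a b)
  show ?case using dsize_arith[of f a b] by (rule trans_le_add1)
qed (auto simp: floorlog_def)

text \<open>
  \<open>poly_time_solves P I enc R\<close>: on every input \<open>q \<in> I\<close>, presented as \<open>enc q\<close>, program \<open>P\<close> halts
  within a number of steps polynomial in the size of \<open>enc q\<close>, with an output related to \<open>q\<close> by \<open>R\<close>.
\<close>

definition poly_time_solves ::
  "prog \<Rightarrow> 'q set \<Rightarrow> ('q \<Rightarrow> data) \<Rightarrow> ('q \<Rightarrow> data \<Rightarrow> bool) \<Rightarrow> bool" where
  "poly_time_solves P I enc R \<longleftrightarrow>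
    (\<exists>p :: nat poly. \<forall>q\<in>I. \<exists>out t.
      exec P (enc q) out t \<and> t \<le> poly p (dsize (enc q)) \<and> R q out)"


section \<open>Encodings\<close>

primrec enc_list :: "data list \<Rightarrow> data" where
  "enc_list [] = Num 0"
| "enc_list (x # xs) = Cell x (enc_list xs)"

definition enc_rat :: "rat \<Rightarrow> data" where
  "enc_rat r = Cell (Num (fst (quotient_of r))) (Num (snd (quotient_of r)))"

text \<open>A subset of \<open>{..<n}\<close> is written as its characteristic vector of length \<open>n\<close>.\<close>

definition enc_subset :: "nat \<Rightarrow> nat set \<Rightarrow> data" where
  "enc_subset n S = enc_list (map (\<lambda>b. Num (if b \<in> S then 1 else 0)) [0..<n])"

primrec enc_option :: "data option \<Rightarrow> data" where
  "enc_option None = Num 0"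
| "enc_option (Some v) = Cell (Num 1) v"


section \<open>Combinatorial problems and multidimensional approximation schemes\<close>

text \<open>
  A combinatorial problem is a class of instances (e.g. all graphs with two marked vertices), given
  by their descriptions.  An instance \<open>x\<close> has ground set \<open>b\<^sub>1, \<dots>, b\<^sub>n\<close>, represented by its
  indices \<open>{..<n}\<close> with \<open>n = ground_size A x\<close>, and the feasible family \<open>feasible A x\<close>, which is only
  implicit in the description \<open>x\<close>.
\<close>

record comb_problem =
  instances :: "data set"
  ground_size :: "data \<Rightarrow> nat"
  feasible :: "data \<Rightarrow> nat set set"

definition combinatorial_problem :: "comb_problem \<Rightarrow> bool" where
  "combinatorial_problem A \<longleftrightarrow>
    (\<forall>x\<in>instances A. feasible A x \<subseteq> Pow {..<ground_size A x})"

text \<open>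
  An input of the \<open>d\<close>-dimensional version is a triple \<open>(x, w, B)\<close>, where \<open>w b i\<close> is the weight of
  element \<open>b\<close> in dimension \<open>i < d\<close> and \<open>B i\<close> is the corresponding budget.
\<close>

definition multi_inputs ::
  "comb_problem \<Rightarrow> nat \<Rightarrow> (data \<times> (nat \<Rightarrow> nat \<Rightarrow> rat) \<times> (nat \<Rightarrow> rat)) set" where
  "multi_inputs A d = {(x, w, B). x \<in> instances A \<and>
      (\<forall>b<ground_size A x. \<forall>i<d. 0 \<le> w b i) \<and> (\<forall>i<d. 0 \<le> B i)}"

definition enc_multi ::
  "comb_problem \<Rightarrow> nat \<Rightarrow> data \<times> (nat \<Rightarrow> nat \<Rightarrow> rat) \<times> (nat \<Rightarrow> rat) \<Rightarrow> data" where
  "enc_multi A d = (\<lambda>(x, w, B).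
      Cell x (Cell
        (enc_list (map (\<lambda>b. enc_list (map (\<lambda>i. enc_rat (w b i)) [0..<d])) [0..<ground_size A x]))
        (enc_list (map (\<lambda>i. enc_rat (B i)) [0..<d]))))"

definition multi_correct ::
  "comb_problem \<Rightarrow> nat \<Rightarrow> real \<Rightarrow> data \<times> (nat \<Rightarrow> nat \<Rightarrow> rat) \<times> (nat \<Rightarrow> rat) \<Rightarrow> data \<Rightarrow> bool" where
  "multi_correct A d \<epsilon> = (\<lambda>(x, w, B) out.
      (\<exists>S\<in>feasible A x. out = enc_option (Some (enc_subset (ground_size A x) S)) \<and>
        (\<forall>i<d. real_of_rat (\<Sum>b\<in>S. w b i) \<le> (1 + \<epsilon>) * real_of_rat (B i)))
    \<or> (out = enc_option None \<and>
        \<not> (\<exists>S'\<in>feasible A x. \<forall>i<d. (\<Sum>b\<in>S'. w b i) \<le> B i)))"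

text \<open>
  As usual for multi-budget problems the number \<open>d\<close> of dimensions is, like \<open>\<epsilon>\<close>, a constant:
  both the algorithm and its polynomial time bound may depend on \<open>d\<close> and \<open>\<epsilon>\<close>.
\<close>

definition multidim_PTAS :: "comb_problem \<Rightarrow> bool" where
  "multidim_PTAS A \<longleftrightarrow>
    (\<forall>d\<ge>1. \<forall>\<epsilon>>0. \<exists>P. poly_time_solves P (multi_inputs A d) (enc_multi A d) (multi_correct A d \<epsilon>))"


section \<open>Expected utility maximization\<close>

text \<open>
  An input is a pair \<open>(x, D)\<close>, where \<open>D b\<close> lists the (value, probability) pairs of the
  distribution of \<open>X\<^sub>b\<close>.  As in \<^term>\<open>pmf_of_list\<close>, the probabilities of repeated values add up.
  The utility function \<open>\<mu>\<close> is a real function without a finite description; like its Lipschitz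
  constant and its rate of decay, it is a parameter of the problem, not part of the encoded input.
\<close>

definition weight_list :: "(rat \<times> rat) list \<Rightarrow> (real \<times> real) list" where
  "weight_list xs = map (\<lambda>(v, p). (real_of_rat v, real_of_rat p)) xs"

definition eum_inputs :: "comb_problem \<Rightarrow> (data \<times> (nat \<Rightarrow> (rat \<times> rat) list)) set" where
  "eum_inputs A = {(x, D). x \<in> instances A \<and>
      (\<forall>b<ground_size A x. pmf_of_list_wf (weight_list (D b)) \<and> (\<forall>(v, p)\<in>set (D b). 0 \<le> v))}"

definition enc_eum :: "comb_problem \<Rightarrow> data \<times> (nat \<Rightarrow> (rat \<times> rat) list) \<Rightarrow> data" where
  "enc_eum A = (\<lambda>(x, D).
      Cell x (enc_list (map (\<lambda>b. enc_list (map (\<lambda>(v, p). Cell (enc_rat v) (enc_rat p)) (D b)))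
        [0..<ground_size A x])))"

text \<open>The joint law of the independent weights \<open>X\<^sub>b\<close>, \<open>b < n\<close>, is the product distribution.\<close>

definition expected_utility ::
  "(real \<Rightarrow> real) \<Rightarrow> nat \<Rightarrow> (nat \<Rightarrow> (rat \<times> rat) list) \<Rightarrow> nat set \<Rightarrow> real" where
  "expected_utility \<mu> n D S =
    measure_pmf.expectation (Pi_pmf {..<n} 0 (\<lambda>b. pmf_of_list (weight_list (D b))))
      (\<lambda>X. \<mu> (\<Sum>b\<in>S. X b))"

definition eum_opt ::
  "comb_problem \<Rightarrow> (real \<Rightarrow> real) \<Rightarrow> data \<Rightarrow> (nat \<Rightarrow> (rat \<times> rat) list) \<Rightarrow> real" where
  "eum_opt A \<mu> x D = Max (expected_utility \<mu> (ground_size A x) D ` feasible A x)"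

text \<open>If there is no feasible set then OPT is undefined, and the output is left unspecified.\<close>

definition eum_correct ::
  "comb_problem \<Rightarrow> (real \<Rightarrow> real) \<Rightarrow> real \<Rightarrow> data \<times> (nat \<Rightarrow> (rat \<times> rat) list) \<Rightarrow> data \<Rightarrow> bool" where
  "eum_correct A \<mu> \<epsilon> = (\<lambda>(x, D) out. feasible A x \<noteq> {} \<longrightarrow>
      (\<exists>S\<in>feasible A x. out = enc_subset (ground_size A x) S \<and>
        expected_utility \<mu> (ground_size A x) D S \<ge> eum_opt A \<mu> x D - \<epsilon>))"

end

theory Submission
  imports Defs
begin

text \<open>
  By the Weierstrass theorem in the variable \<open>exp (- x)\<close>, the utility \<open>\<mu>\<close> is uniformly close on
  \<open>[0, \<infinity>)\<close> to a finite sum \<open>\<Sum>k. c k * exp (- k x)\<close>.  Hence the expected utility of \<open>S\<close> is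
  determined up to a small error by the Laplace transforms
  \<open>\<Prod>b\<in>S. E (exp (- k X_b)) = \<Prod>b\<in>S. (1 - loss k b)\<close> at finitely many \<open>k\<close>, and such products are
  stable under relative perturbations of the losses, no matter how many factors there are.  So each
  \<open>X_b\<close> may be rounded to a fixed finite grid.  If \<open>X_b\<close> then still has substantial mass outside
  \<open>0\<close> (\<open>b\<close> is heavy), its probabilities are rounded as well and \<open>b\<close> has one of finitely many types;
  the light elements enter the product only through their total mass at each grid point, as in
  Poisson approximation.

  The numbers of heavy elements of each type and the total light masses are additive, so they can be
  bounded in a \<open>Multi\<close> problem of constant dimension.  A vector of such bounds defines a surrogate
  utility, the expected utility of a sum of that many independent grid-valued variables, which
  is nonincreasing in the bounds.  If some bound is large, the surrogate is negligible; the
  remaining vectors form a finite list that does not depend on the input.  Querying the PTAS in the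
  order of decreasing surrogate utility, the first success is a near-optimal set.
\<close>

section \<open>Polynomial-time computable functions\<close>

text \<open>A set has unboundedly many elements, so a fixed absolute error per element is useless:
  every rounding must be relative to the loss of its element, or shrink with the number of entries.
  Near \<open>0\<close> a loss is linear in the value, so values cannot just move to the next grid
  point; splitting them between that point and \<open>0\<close> keeps the mean and with it the
  first-order term. The PTAS gives only upper bounds and overshoots them, so it cannot be asked for
  a prescribed signature. The overshoot is harmless because the candidate budgets are bounded
  multiples \<open>l ! i * M\<close> of one unit: for small \<open>\<eta>\<close> it stays below the
  next multiple and vanishes when counts are rounded down. The order of choice matters:
  \<open>\<mu>\<close> and \<open>\<epsilon>\<close> determine \<open>K\<close> and the
  coefficients, then \<open>\<delta>\<close>, the grid and with it \<open>d\<close>, then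
  \<open>N\<close>, and only then \<open>\<eta>\<close>. The scale \<open>M\<close> alone depends on
  the input.\<close>

text \<open>
  Inputs and outputs are both given as functions of an abstract index \<open>q\<close>, so that composition is
  transitivity and programs need not be named.
\<close>

lemma poly_nat_mono: "x \<le> y \<Longrightarrow> poly p x \<le> poly p y" for p :: "nat poly"
  by (induction p) (auto intro!: add_mono mult_mono)

definition ptime :: "'q set \<Rightarrow> ('q \<Rightarrow> data) \<Rightarrow> ('q \<Rightarrow> data) \<Rightarrow> bool" where
  "ptime I f g \<longleftrightarrow> (\<exists>P. poly_time_solves P I f (\<lambda>q out. out = g q))"

lemma ptimeI:
  assumes "\<And>q. q \<in> I \<Longrightarrow> \<exists>t. exec P (f q) (g q) t \<and> t \<le> poly p (dsize (f q))"
  shows "ptime I f g"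
  using assms unfolding ptime_def poly_time_solves_def by blast

lemma ptimeE:
  assumes "ptime I f g"
  obtains P p where "\<And>q. q \<in> I \<Longrightarrow> \<exists>t. exec P (f q) (g q) t \<and> t \<le> poly p (dsize (f q))"
  using assms unfolding ptime_def poly_time_solves_def by blast

text \<open>A correct answer need not be unique; choosing the actual output for each index turns the
  relation into a function that later steps can name.\<close>

lemma poly_time_solves_imp_ptime:
  assumes "poly_time_solves P I f R"
  obtains g where "ptime I f g" "\<And>q. q \<in> I \<Longrightarrow> R q (g q)"
proof -
  from assms obtain p where "\<forall>q\<in>I. \<exists>out t. exec P (f q) out t \<and> t \<le> poly p (dsize (f q)) \<and> R q out"
    unfolding poly_time_solves_def by blast
  then obtain g where "\<forall>q\<in>I. \<exists>t. exec P (f q) (g q) t \<and> t \<le> poly p (dsize (f q)) \<and> R q (g q)"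
    by metis
  then show thesis by (intro that[of g] ptimeI[of I P f g p]) blast+
qed

lemma ptime_imp_poly_time_solves:
  assumes "ptime I f g" "\<And>q. q \<in> I \<Longrightarrow> R q (g q)"
  shows "\<exists>P. poly_time_solves P I f R"
  using assms unfolding ptime_def poly_time_solves_def by metis

lemma ptime_cong:
  assumes "ptime I f g" "\<And>q. q \<in> I \<Longrightarrow> f q = f' q" "\<And>q. q \<in> I \<Longrightarrow> g q = g' q"
  shows "ptime I f' g'"
proof -
  from assms(1) obtain P p
    where "\<And>q. q \<in> I \<Longrightarrow> \<exists>t. exec P (f q) (g q) t \<and> t \<le> poly p (dsize (f q))"
    by (rule ptimeE) blast
  then show ?thesis using assms(2,3) by (intro ptimeI[of I P f' g' p]) auto
qed

text \<open>The same program serves. This is how an algorithm for one problem is called on queries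
  built from the inputs of another.\<close>

lemma ptime_reindex:
  assumes "ptime I f g" "\<And>q. q \<in> J \<Longrightarrow> h q \<in> I"
  shows "ptime J (\<lambda>q. f (h q)) (\<lambda>q. g (h q))"
proof -
  from assms(1) obtain P p
    where "\<And>q. q \<in> I \<Longrightarrow> \<exists>t. exec P (f q) (g q) t \<and> t \<le> poly p (dsize (f q))"
    by (rule ptimeE) blast
  then show ?thesis using assms(2) by (intro ptimeI[of J P _ _ p]) auto
qed

lemma ptime_subset: "ptime I f g \<Longrightarrow> J \<subseteq> I \<Longrightarrow> ptime J f g"
  using ptime_reindex[of I f g J "\<lambda>q. q"] by auto

text \<open>Every instruction is charged for the data it touches, so a time bound also bounds the
  output. Composition depends on this.\<close>

lemma ptime_size:
  assumes "ptime I f g"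
  obtains r where "\<And>q. q \<in> I \<Longrightarrow> dsize (g q) \<le> poly r (dsize (f q))"
proof -
  from assms obtain P p
    where P: "\<And>q. q \<in> I \<Longrightarrow> \<exists>t. exec P (f q) (g q) t \<and> t \<le> poly p (dsize (f q))"
    by (rule ptimeE) blast
  show thesis
  proof (rule that[of "[:0, 1:] + p"])
    fix q assume "q \<in> I"
    then show "dsize (g q) \<le> poly ([:0, 1:] + p) (dsize (f q))"
      using P[of q] exec_size by fastforce
  qed
qed

section \<open>Instructions, composition and branching\<close>

lemma ptime_id: "ptime I f f"
  by (rule ptimeI[of _ Ident _ _ "[:0, 1:]"]) (auto intro: exec.intros)

lemma ptime_const: "ptime I f (\<lambda>_. c)"
  by (rule ptimeI[of _ "Const c" _ _ "[:dsize c, 1:]"]) (auto intro: exec.intros)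

lemma ptime_fst_base: "ptime I (\<lambda>q. Cell (g q) (h q)) g"
  by (rule ptimeI[of _ First _ _ "[:0, 1:]"]) (use exec_First in force)

lemma ptime_snd_base: "ptime I (\<lambda>q. Cell (g q) (h q)) h"
  by (rule ptimeI[of _ Second _ _ "[:0, 1:]"]) (use exec_Second in force)

lemma ptime_comp:
  assumes "ptime I f g" "ptime I g h"
  shows "ptime I f h"
proof -
  from assms(1) obtain P p
    where P: "\<And>q. q \<in> I \<Longrightarrow> \<exists>t. exec P (f q) (g q) t \<and> t \<le> poly p (dsize (f q))"
    by (rule ptimeE) blast
  from assms(2) obtain Q p'
    where Q: "\<And>q. q \<in> I \<Longrightarrow> \<exists>t. exec Q (g q) (h q) t \<and> t \<le> poly p' (dsize (g q))"
    by (rule ptimeE) blast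
  from assms(1) obtain r where r: "\<And>q. q \<in> I \<Longrightarrow> dsize (g q) \<le> poly r (dsize (f q))"
    by (rule ptime_size) blast
  show ?thesis
  proof (rule ptimeI[of I "Seq P Q" _ _ "1 + p + pcompose p' r"])
    fix q assume q: "q \<in> I"
    obtain s t where s: "exec P (f q) (g q) s" "s \<le> poly p (dsize (f q))"
      and t: "exec Q (g q) (h q) t" "t \<le> poly p' (dsize (g q))"
      using P[OF q] Q[OF q] by blast
    have "t \<le> poly p' (poly r (dsize (f q)))"
      using t(2) poly_nat_mono[OF r[OF q], of p'] by linarith
    then show "\<exists>t. exec (Seq P Q) (f q) (h q) t \<and> t \<le> poly (1 + p + pcompose p' r) (dsize (f q))"
      using s t(1) by (intro exI[of _ "Suc (s + t)"]) (auto simp: poly_pcompose intro: exec.intros)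
  qed
qed

lemma ptime_fst: "ptime I f (\<lambda>q. Cell (g q) (h q)) \<Longrightarrow> ptime I f g"
  by (rule ptime_comp[OF _ ptime_fst_base])

lemma ptime_snd: "ptime I f (\<lambda>q. Cell (g q) (h q)) \<Longrightarrow> ptime I f h"
  by (rule ptime_comp[OF _ ptime_snd_base])

lemma ptime_pair:
  assumes "ptime I f g" "ptime I f h"
  shows "ptime I f (\<lambda>q. Cell (g q) (h q))"
proof -
  from assms(1) obtain P p
    where P: "\<And>q. q \<in> I \<Longrightarrow> \<exists>t. exec P (f q) (g q) t \<and> t \<le> poly p (dsize (f q))"
    by (rule ptimeE) blast
  from assms(2) obtain Q p'
    where Q: "\<And>q. q \<in> I \<Longrightarrow> \<exists>t. exec Q (f q) (h q) t \<and> t \<le> poly p' (dsize (f q))"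
    by (rule ptimeE) blast
  show ?thesis
  proof (rule ptimeI[of I "Fork P Q" _ _ "[:1, 1:] + p + p'"])
    fix q assume q: "q \<in> I"
    obtain s t where s: "exec P (f q) (g q) s" "s \<le> poly p (dsize (f q))"
      and t: "exec Q (f q) (h q) t" "t \<le> poly p' (dsize (f q))"
      using P[OF q] Q[OF q] by blast
    then show "\<exists>t. exec (Fork P Q) (f q) (Cell (g q) (h q)) t \<and>
        t \<le> poly ([:1, 1:] + p + p') (dsize (f q))"
      by (intro exI[of _ "Suc (s + t + dsize (f q))"]) (auto intro: exec.intros)
  qed
qed

lemma ptime_arith:
  assumes "ptime I f (\<lambda>q. Num (a q))" "ptime I f (\<lambda>q. Num (b q))"
  shows "ptime I f (\<lambda>q. Num (arith op (a q) (b q)))"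
proof -
  have "ptime I (\<lambda>q. Cell (Num (a q)) (Num (b q))) (\<lambda>q. Num (arith op (a q) (b q)))"
    by (rule ptimeI[of _ "Arith op" _ _ "[:0, 1:]"]) (use exec_Arith in force)
  with ptime_pair[OF assms] show ?thesis by (rule ptime_comp)
qed

lemmas ptime_plus = ptime_arith[where op = Plus, simplified]
lemmas ptime_minus = ptime_arith[where op = Minus, simplified]
lemmas ptime_times = ptime_arith[where op = Times, simplified]
lemmas ptime_div = ptime_arith[where op = Quot, simplified]
lemmas ptime_less = ptime_arith[where op = Less, simplified]

definition is_Num :: "data \<Rightarrow> bool" where "is_Num v \<longleftrightarrow> (\<exists>k. v = Num k)"

lemma is_Num_simps [simp]: "is_Num (Num k)" "\<not> is_Num (Cell a b)"
  by (auto simp: is_Num_def)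

lemma ptime_is_Num:
  assumes "ptime I f g"
  shows "ptime I f (\<lambda>q. Num (if is_Num (g q) then 1 else 0))"
proof -
  have *: "exec IsNum v (Num (if is_Num v then 1 else 0)) (Suc (dsize v))" for v
    by (cases v) (use exec_IsNum_Num exec_IsNum_Node in force)+
  have "ptime I g (\<lambda>q. Num (if is_Num (g q) then 1 else 0))"
    by (rule ptimeI[of _ IsNum _ _ "[:1, 1:]"]) (intro exI conjI, rule *, simp)
  with assms show ?thesis by (rule ptime_comp)
qed

text \<open>Each branch is required only on the inputs that reach it; elsewhere its program may get
  stuck, as \<open>Second\<close> does on a leaf.\<close>

lemma ptime_if_nonzero:
  assumes "ptime I f (\<lambda>q. Num (c q))"
    and "ptime {q\<in>I. c q \<noteq> 0} f g" "ptime {q\<in>I. c q = 0} f h"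
  shows "ptime I f (\<lambda>q. if c q \<noteq> 0 then g q else h q)"
proof -
  from assms(1) obtain C r
    where C: "\<And>q. q \<in> I \<Longrightarrow> \<exists>t. exec C (f q) (Num (c q)) t \<and> t \<le> poly r (dsize (f q))"
    by (rule ptimeE) blast
  from assms(2) obtain P p
    where P: "\<And>q. q \<in> {q\<in>I. c q \<noteq> 0} \<Longrightarrow> \<exists>t. exec P (f q) (g q) t \<and> t \<le> poly p (dsize (f q))"
    by (rule ptimeE) blast
  from assms(3) obtain Q p'
    where Q: "\<And>q. q \<in> {q\<in>I. c q = 0} \<Longrightarrow> \<exists>t. exec Q (f q) (h q) t \<and> t \<le> poly p' (dsize (f q))"
    by (rule ptimeE) blast
  show ?thesis
  proof (rule ptimeI[of I "Cond C P Q" _ _ "[:0, 1:] + p + p' + r"])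
    fix q assume q: "q \<in> I"
    obtain s where s: "exec C (f q) (Num (c q)) s" "s \<le> poly r (dsize (f q))"
      using C[OF q] by blast
    show "\<exists>t. exec (Cond C P Q) (f q) (if c q \<noteq> 0 then g q else h q) t \<and>
        t \<le> poly ([:0, 1:] + p + p' + r) (dsize (f q))"
    proof (cases "c q = 0")
      case True
      then obtain t where t: "exec Q (f q) (h q) t" "t \<le> poly p' (dsize (f q))"
        using Q[of q] q by blast
      have "exec (Cond C P Q) (f q) (h q) (s + t + dsize (f q))"
        using s t True by (auto intro: exec_Cond_False)
      with True s t show ?thesis by (intro exI[of _ "s + t + dsize (f q)"]) auto
    next
      case False
      then obtain t where t: "exec P (f q) (g q) t" "t \<le> poly p (dsize (f q))"
        using P[of q] q by blast
      have "exec (Cond C P Q) (f q) (g q) (s + t + dsize (f q))"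
        using s t False by (auto intro: exec_Cond_True)
      with False s t show ?thesis by (intro exI[of _ "s + t + dsize (f q)"]) auto
    qed
  qed
qed

lemma ptime_if:
  assumes "ptime I f (\<lambda>q. Num (if b q then 1 else 0))"
    and "ptime {q\<in>I. b q} f g" "ptime {q\<in>I. \<not> b q} f h"
  shows "ptime I f (\<lambda>q. if b q then g q else h q)"
  by (rule ptime_cong[OF ptime_if_nonzero[OF assms(1), of g h]])
     (use assms in \<open>auto intro: ptime_subset\<close>)

text \<open>Polynomial cost per round is not enough, since a state could be squared in each round;
  \<open>r\<close> keeps all states polynomial in the first one. The set \<open>J 1\<close> contains
  the final state, where the test still runs and must fail, whereas the body is run only on
  \<open>J 0\<close>.\<close>

lemma ptime_loop:
  fixes st :: "'q \<Rightarrow> nat \<Rightarrow> data" and len :: "'q \<Rightarrow> nat" and I :: "'q set"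
  defines "J \<equiv> \<lambda>k. {(q, i). q \<in> I \<and> i < len q + k}"
  assumes test: "ptime (J 1) (\<lambda>(q, i). st q i) (\<lambda>(q, i). Num (if i < len q then 1 else 0))"
    and body: "ptime (J 0) (\<lambda>(q, i). st q i) (\<lambda>(q, i). st q (Suc i))"
    and size: "\<And>q i. q \<in> I \<Longrightarrow> i \<le> len q \<Longrightarrow> dsize (st q i) \<le> poly r (dsize (st q 0))"
    and len: "\<And>q. q \<in> I \<Longrightarrow> len q \<le> poly l (dsize (st q 0))"
  shows "ptime I (\<lambda>q. st q 0) (\<lambda>q. st q (len q))"
proof -
  from test obtain C p where C: "\<And>x. x \<in> J 1 \<Longrightarrow>
      \<exists>t. exec C (case_prod st x) (case x of (q, i) \<Rightarrow> Num (if i < len q then 1 else 0)) t \<and>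
        t \<le> poly p (dsize (case_prod st x))"
    by (rule ptimeE) blast
  from body obtain P p' where P: "\<And>x. x \<in> J 0 \<Longrightarrow>
      \<exists>t. exec P (case_prod st x) (case x of (q, i) \<Rightarrow> st q (Suc i)) t \<and>
        t \<le> poly p' (dsize (case_prod st x))"
    by (rule ptimeE) blast
  define w where "w = pcompose p r + pcompose p' r + r"
  have cost: "poly p s + poly p' s + s \<le> poly w (dsize (st q 0))"
    if "s \<le> poly r (dsize (st q 0))" for q s
    using that by (auto simp: w_def poly_pcompose intro!: add_mono poly_nat_mono)
  show ?thesis
  proof (rule ptimeI[of I "While C P" _ _ "(1 + l) * w"])
    fix q assume q: "q \<in> I"
    let ?W = "poly w (dsize (st q 0))"
    have "\<exists>t. exec (While C P) (st q i) (st q (len q)) t \<and> t \<le> (1 + (len q - i)) * ?W"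
      if "i \<le> len q" for i
      using that
    proof (induction rule: inc_induct)
      case base
      obtain t where "exec C (st q (len q)) (Num 0) t" "t \<le> poly p (dsize (st q (len q)))"
        using C[of "(q, len q)"] q by (auto simp: J_def)
      then show ?case
        using cost[OF size[OF q order.refl]]
        by (intro exI[of _ "t + dsize (st q (len q))"]) (auto intro: exec.intros)
    next
      case (step i)
      obtain c where c: "exec C (st q i) (Num 1) c" "c \<le> poly p (dsize (st q i))"
        using C[of "(q, i)"] q step by (auto simp: J_def)
      obtain s where s: "exec P (st q i) (st q (Suc i)) s" "s \<le> poly p' (dsize (st q i))"
        using P[of "(q, i)"] q step by (auto simp: J_def)
      obtain t where t: "exec (While C P) (st q (Suc i)) (st q (len q)) t"
        "t \<le> (1 + (len q - Suc i)) * ?W"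
        using step by blast
      have "exec (While C P) (st q i) (st q (len q)) (c + s + t + dsize (st q i))"
        using exec_While_True[OF c(1) _ s(1) t(1)] by simp
      moreover have "c + s + t + dsize (st q i) \<le> ?W + (1 + (len q - Suc i)) * ?W"
        using cost[OF size[OF q], of i] c s t step by linarith
      moreover have "1 + (len q - i) = 1 + (1 + (len q - Suc i))" using step by simp
      ultimately show ?case by (metis add_mult_distrib nat_mult_1)
    qed
    from this[of 0] obtain t where "exec (While C P) (st q 0) (st q (len q)) t"
      "t \<le> (1 + len q) * ?W" by auto
    moreover have "(1 + len q) * ?W \<le> poly ((1 + l) * w) (dsize (st q 0))"
      using len[OF q] by (simp add: algebra_simps)
    ultimately show "\<exists>t. exec (While C P) (st q 0) (st q (len q)) t \<and>
        t \<le> poly ((1 + l) * w) (dsize (st q 0))" by (meson order.trans)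
  qed
qed

section \<open>Folds, maps and sums over encoded lists\<close>

lemma length_le_dsize_enc_list: "length xs \<le> dsize (enc_list xs)"
  by (induction xs) auto

lemma dsize_enc_list_drop: "dsize (enc_list (drop i xs)) \<le> dsize (enc_list xs)"
proof (induction i arbitrary: xs)
  case (Suc i)
  have "dsize (enc_list (drop i ys)) \<le> dsize (enc_list (y # ys))" for y ys
    using Suc[of ys] by simp
  then show ?case by (cases xs) auto
qed simp

lemma dsize_nth_le_enc_list: "i < length xs \<Longrightarrow> dsize (xs ! i) \<le> dsize (enc_list xs)"
  by (induction xs arbitrary: i) (auto simp: nth_Cons less_Suc_eq_0_disj split: nat.split, fastforce)

text \<open>Growth is additive, by an amount that depends on the initial state only; this gives the
  size bound for \<open>ptime_loop\<close>. Programs have no variables, so whatever the body has to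
  know besides the entry travels along as \<open>ctx\<close>.\<close>

lemma ptime_fold:
  fixes xs :: "'q \<Rightarrow> data list" and acc :: "'q \<Rightarrow> nat \<Rightarrow> data" and I :: "'q set"
  defines "J \<equiv> {(q, i). q \<in> I \<and> i < length (xs q)}"
  assumes body: "ptime J (\<lambda>(q, i). Cell (xs q ! i) (Cell (acc q i) (ctx q))) (\<lambda>(q, i). acc q (Suc i))"
    and growth: "\<And>q i. q \<in> I \<Longrightarrow> i < length (xs q) \<Longrightarrow>
      dsize (acc q (Suc i)) \<le> dsize (acc q i) + poly r (dsize (Cell (enc_list (xs q)) (Cell (acc q 0) (ctx q))))"
  shows "ptime I (\<lambda>q. Cell (enc_list (xs q)) (Cell (acc q 0) (ctx q))) (\<lambda>q. acc q (length (xs q)))"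
proof -
  define st where "st q i = Cell (enc_list (drop i (xs q))) (Cell (acc q i) (ctx q))" for q i
  define K where "K = {(q, i). q \<in> I \<and> i < length (xs q) + 1}"
  have size: "dsize (st q i) \<le> poly ([:0, 1:] * (1 + r)) (dsize (st q 0))"
    if q: "q \<in> I" "i \<le> length (xs q)" for q i
  proof -
    have "dsize (acc q i) \<le> dsize (acc q 0) + i * poly r (dsize (st q 0))"
      using q(2)
    proof (induction i)
      case (Suc i)
      then show ?case using growth[OF q(1), of i] by (simp add: st_def)
    qed simp
    moreover have "i * poly r (dsize (st q 0)) \<le> dsize (st q 0) * poly r (dsize (st q 0))"
      using q(2) length_le_dsize_enc_list[of "xs q"] by (intro mult_right_mono) (auto simp: st_def)
    ultimately show ?thesis
      using dsize_enc_list_drop[of i "xs q"] by (simp add: st_def)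
  qed
  have drop: "st q i = Cell (Cell (xs q ! i) (enc_list (drop (Suc i) (xs q)))) (Cell (acc q i) (ctx q))"
    if "i < length (xs q)" for q i
    unfolding st_def Cons_nth_drop_Suc[OF that, symmetric] by simp
  have "ptime K (\<lambda>(q, i). st q i) (\<lambda>(q, i). enc_list (drop i (xs q)))"
    by (rule ptime_cong[OF ptime_fst_base[where h = "\<lambda>(q, i). Cell (acc q i) (ctx q)"]])
       (auto simp: st_def)
  note a = ptime_is_Num[OF this]
  have test: "ptime K (\<lambda>(q, i). st q i) (\<lambda>(q, i). Num (if i < length (xs q) then 1 else 0))"
  proof (rule ptime_cong[OF ptime_minus[OF ptime_const[of _ _ "Num 1"] a]])
    fix x assume "x \<in> K"
    obtain q i where [simp]: "x = (q, i)" by force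
    show "Num (1 - (if is_Num (case x of (q, i) \<Rightarrow> enc_list (drop i (xs q))) then 1 else 0)) =
        (case x of (q, i) \<Rightarrow> Num (if i < length (xs q) then 1 else 0))"
    proof (cases "i < length (xs q)")
      case True
      then show ?thesis by (simp add: Cons_nth_drop_Suc[symmetric])
    qed simp
  qed simp
  have d: "ptime J (\<lambda>(q, i). st q i)
      (\<lambda>(q, i). Cell (Cell (xs q ! i) (enc_list (drop (Suc i) (xs q)))) (Cell (acc q i) (ctx q)))"
    by (rule ptime_cong[OF ptime_id]) (auto simp: J_def drop)
  let ?s = "\<lambda>x. case_prod st x"
  have c1: "ptime J ?s (\<lambda>x. Cell (xs (fst x) ! snd x) (enc_list (drop (Suc (snd x)) (xs (fst x)))))"
    by (rule ptime_fst[where h = "\<lambda>x. Cell (acc (fst x) (snd x)) (ctx (fst x))"])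
       (use d in \<open>simp add: case_prod_beta'\<close>)
  have c2: "ptime J ?s (\<lambda>x. Cell (acc (fst x) (snd x)) (ctx (fst x)))"
    by (rule ptime_snd[where g = "\<lambda>x. Cell (xs (fst x) ! snd x) (enc_list (drop (Suc (snd x)) (xs (fst x))))"])
       (use d in \<open>simp add: case_prod_beta'\<close>)
  have b: "ptime J ?s (\<lambda>x. acc (fst x) (Suc (snd x)))"
    using ptime_comp[OF ptime_pair[OF ptime_fst[OF c1] c2]] body by (simp add: case_prod_beta')
  have body': "ptime J ?s (\<lambda>(q, i). st q (Suc i))"
    using ptime_pair[OF ptime_snd[OF c1] ptime_pair[OF b ptime_snd[OF c2]]]
    by (simp add: st_def[of _ "Suc _"] case_prod_beta')
  have "ptime I (\<lambda>q. st q 0) (\<lambda>q. st q (length (xs q)))"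
  proof (rule ptime_loop[where len = "\<lambda>q. length (xs q)" and l = "[:0, 1:]"
        and r = "[:0, 1:] * (1 + r)"])
    show "length (xs q) \<le> poly [:0, 1:] (dsize (st q 0))" for q
      using length_le_dsize_enc_list[of "xs q"] by (simp add: st_def)
  qed (use test body' size in \<open>auto simp: K_def J_def\<close>)
  then have "ptime I (\<lambda>q. st q 0)
      (\<lambda>q. Cell (enc_list (drop (length (xs q)) (xs q))) (Cell (acc q (length (xs q))) (ctx q)))"
    by (simp add: st_def)
  from ptime_fst[OF ptime_snd[OF this]] show ?thesis by (simp add: st_def)
qed

text \<open>A fold conses its results in reverse order; \<open>ptime_map\<close> undoes this at the
  end.\<close>

lemma ptime_rev: "ptime I (\<lambda>q. enc_list (xs q)) (\<lambda>q. enc_list (rev (xs q)))"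
proof -
  let ?acc = "\<lambda>q i. enc_list (rev (take i (xs q)))"
  have "ptime I (\<lambda>q. Cell (enc_list (xs q)) (Cell (?acc q 0) (Num 0))) (\<lambda>q. ?acc q (length (xs q)))"
  proof (rule ptime_fold[where r = "[:0, 1:]"])
    let ?J = "{(q, i). q \<in> I \<and> i < length (xs q)}"
    let ?s = "\<lambda>x. Cell (xs (fst x) ! snd x) (Cell (?acc (fst x) (snd x)) (Num 0))"
    have "ptime ?J ?s (\<lambda>x. Cell (xs (fst x) ! snd x) (?acc (fst x) (snd x)))"
      by (intro ptime_pair ptime_fst_base ptime_fst[OF ptime_snd_base])
    then show "ptime ?J (\<lambda>(q, i). Cell (xs q ! i) (Cell (?acc q i) (Num 0))) (\<lambda>(q, i). ?acc q (Suc i))"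
      by (rule ptime_cong) (auto simp: take_Suc_conv_app_nth)
    fix q i assume "q \<in> I" "i < length (xs q)"
    then show "dsize (?acc q (Suc i)) \<le> dsize (?acc q i) +
        poly [:0, 1:] (dsize (Cell (enc_list (xs q)) (Cell (?acc q 0) (Num 0))))"
      using dsize_nth_le_enc_list[of i "xs q"] by (simp add: take_Suc_conv_app_nth)
  qed
  moreover have "ptime I (\<lambda>q. enc_list (xs q)) (\<lambda>q. Cell (enc_list (xs q)) (Cell (?acc q 0) (Num 0)))"
    using ptime_pair[OF ptime_id ptime_const] by simp
  ultimately show ?thesis using ptime_comp by fastforce
qed

lemma ptime_map:
  fixes xs ys :: "'q \<Rightarrow> data list"
  assumes xs: "ptime I f (\<lambda>q. enc_list (xs q))" and ctx: "ptime I f ctx"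
    and len: "\<And>q. q \<in> I \<Longrightarrow> length (ys q) = length (xs q)"
    and step: "ptime {(q, i). q \<in> I \<and> i < length (xs q)}
      (\<lambda>(q, i). Cell (xs q ! i) (ctx q)) (\<lambda>(q, i). ys q ! i)"
  shows "ptime I f (\<lambda>q. enc_list (ys q))"
proof -
  let ?acc = "\<lambda>q i. enc_list (rev (take i (ys q)))"
  let ?J = "{(q, i). q \<in> I \<and> i < length (xs q)}"
  obtain r where r: "\<And>x. x \<in> ?J \<Longrightarrow>
      dsize (case x of (q, i) \<Rightarrow> ys q ! i) \<le> poly r (dsize (case x of (q, i) \<Rightarrow> Cell (xs q ! i) (ctx q)))"
    using ptime_size[OF step] by blast
  have "ptime I (\<lambda>q. Cell (enc_list (xs q)) (Cell (?acc q 0) (ctx q))) (\<lambda>q. ?acc q (length (xs q)))"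
  proof (rule ptime_fold[where r = "1 + r"])
    let ?s = "\<lambda>x. Cell (xs (fst x) ! snd x) (Cell (?acc (fst x) (snd x)) (ctx (fst x)))"
    have "ptime ?J ?s (\<lambda>x. Cell (xs (fst x) ! snd x) (ctx (fst x)))"
      by (intro ptime_pair ptime_fst_base ptime_snd[OF ptime_snd_base])
    with step have "ptime ?J ?s (\<lambda>x. ys (fst x) ! snd x)"
      by (auto intro: ptime_comp simp: case_prod_beta')
    then have "ptime ?J ?s (\<lambda>x. Cell (ys (fst x) ! snd x) (?acc (fst x) (snd x)))"
      by (intro ptime_pair ptime_fst[OF ptime_snd_base])
    then show "ptime ?J (\<lambda>(q, i). Cell (xs q ! i) (Cell (?acc q i) (ctx q))) (\<lambda>(q, i). ?acc q (Suc i))"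
      by (rule ptime_cong) (auto simp: take_Suc_conv_app_nth len)
    fix q i assume q: "q \<in> I" "i < length (xs q)"
    have "poly r (dsize (Cell (xs q ! i) (ctx q))) \<le>
        poly r (dsize (Cell (enc_list (xs q)) (Cell (?acc q 0) (ctx q))))"
      by (intro poly_nat_mono) (use dsize_nth_le_enc_list[OF q(2)] in simp)
    with r[of "(q, i)"] q
    show "dsize (?acc q (Suc i)) \<le> dsize (?acc q i) +
        poly (1 + r) (dsize (Cell (enc_list (xs q)) (Cell (?acc q 0) (ctx q))))"
      by (simp add: take_Suc_conv_app_nth len)
  qed
  moreover have "ptime I f (\<lambda>q. Cell (enc_list (xs q)) (Cell (?acc q 0) (ctx q)))"
    using ptime_pair[OF xs ptime_pair[OF ptime_const ctx]] by simp
  ultimately have "ptime I f (\<lambda>q. enc_list (rev (take (length (xs q)) (ys q))))"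
    by (rule ptime_comp[rotated])
  from ptime_comp[OF this ptime_rev] show ?thesis
    by (rule ptime_cong) (simp_all add: len[symmetric])
qed

lemma ptime_sum:
  fixes xs :: "'q \<Rightarrow> data list" and a :: "'q \<Rightarrow> nat \<Rightarrow> int"
  assumes xs: "ptime I f (\<lambda>q. enc_list (xs q))" and ctx: "ptime I f ctx"
    and step: "ptime {(q, i). q \<in> I \<and> i < length (xs q)}
      (\<lambda>(q, i). Cell (xs q ! i) (ctx q)) (\<lambda>(q, i). Num (a q i))"
  shows "ptime I f (\<lambda>q. Num (\<Sum>i<length (xs q). a q i))"
proof -
  let ?acc = "\<lambda>q i. Num (\<Sum>j<i. a q j)"
  let ?J = "{(q, i). q \<in> I \<and> i < length (xs q)}"
  obtain r where r: "\<And>x. x \<in> ?J \<Longrightarrow>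
      dsize (case x of (q, i) \<Rightarrow> Num (a q i)) \<le> poly r (dsize (case x of (q, i) \<Rightarrow> Cell (xs q ! i) (ctx q)))"
    using ptime_size[OF step] by blast
  have "ptime I (\<lambda>q. Cell (enc_list (xs q)) (Cell (?acc q 0) (ctx q))) (\<lambda>q. ?acc q (length (xs q)))"
  \<comment> \<open>\<open>dsize_arith\<close> bounds the size of the new sum by both sizes plus
    one; the \<open>1\<close> in \<open>1 + r\<close> pays for that one.\<close>
  proof (rule ptime_fold[where r = "1 + r"])
    let ?s = "\<lambda>x. Cell (xs (fst x) ! snd x) (Cell (?acc (fst x) (snd x)) (ctx (fst x)))"
    have "ptime ?J ?s (\<lambda>x. Cell (xs (fst x) ! snd x) (ctx (fst x)))"
      by (intro ptime_pair ptime_fst_base ptime_snd[OF ptime_snd_base])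
    with step have "ptime ?J ?s (\<lambda>x. Num (a (fst x) (snd x)))"
      by (auto intro: ptime_comp simp: case_prod_beta')
    then have "ptime ?J ?s (\<lambda>x. Num ((\<Sum>j<snd x. a (fst x) j) + a (fst x) (snd x)))"
      by (intro ptime_plus ptime_fst[OF ptime_snd_base])
    then show "ptime ?J (\<lambda>(q, i). Cell (xs q ! i) (Cell (?acc q i) (ctx q))) (\<lambda>(q, i). ?acc q (Suc i))"
      by (rule ptime_cong) auto
    fix q i assume q: "q \<in> I" "i < length (xs q)"
    have "poly r (dsize (Cell (xs q ! i) (ctx q))) \<le>
        poly r (dsize (Cell (enc_list (xs q)) (Cell (?acc q 0) (ctx q))))"
      by (intro poly_nat_mono) (use dsize_nth_le_enc_list[OF q(2)] in simp)
    with r[of "(q, i)"] q dsize_arith[of Plus "\<Sum>j<i. a q j" "a q i"]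
    show "dsize (?acc q (Suc i)) \<le> dsize (?acc q i) +
        poly (1 + r) (dsize (Cell (enc_list (xs q)) (Cell (?acc q 0) (ctx q))))"
      by simp
  qed
  moreover have "ptime I f (\<lambda>q. Cell (enc_list (xs q)) (Cell (?acc q 0) (ctx q)))"
    using ptime_pair[OF xs ptime_pair[OF ptime_const ctx]] by simp
  ultimately show ?thesis by (rule ptime_comp[rotated])
qed

text \<open>The length \<open>d\<close> is a constant, so the programs of the entries, which may all
  differ, are chained into one without a loop.\<close>

lemma ptime_list:
  assumes "\<And>i. i < d \<Longrightarrow> ptime I f (\<lambda>q. g q i)"
  shows "ptime I f (\<lambda>q. enc_list (map (g q) [0..<d]))"
proof -
  have "ptime I f (\<lambda>q. enc_list (map (g q) [d - k..<d]))" if "k \<le> d" for k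
    using that
  proof (induction k)
    case (Suc k)
    then have "[d - Suc k..<d] = (d - Suc k) # [d - k..<d]"
      using upt_conv_Cons[of "d - Suc k" d] by (simp add: Suc_diff_Suc)
    then show ?case using Suc assms[of "d - Suc k"] by (auto intro!: ptime_pair)
  qed (simp add: ptime_const)
  from this[of d] show ?thesis by simp
qed

section \<open>Laplace transforms and surrogate utilities\<close>

text \<open>The error is relative to the losses, hence no bound on their sum is needed.\<close>

lemma prod_one_minus_diff_le:
  fixes x y e :: "'a \<Rightarrow> real"
  assumes "finite S" "0 \<le> \<delta>"
    and "\<And>b. b \<in> S \<Longrightarrow> 0 \<le> x b \<and> x b \<le> 1 \<and> 0 \<le> y b \<and> y b \<le> 1 \<and> 0 \<le> e b"
    and "\<And>b. b \<in> S \<Longrightarrow> \<bar>x b - y b\<bar> \<le> \<delta> * x b + e b"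
  shows "\<bar>(\<Prod>b\<in>S. 1 - x b) - (\<Prod>b\<in>S. 1 - y b)\<bar> \<le> \<delta> * (1 - (\<Prod>b\<in>S. 1 - x b)) + (\<Sum>b\<in>S. e b)"
  using assms(1,3,4)
proof (induction S rule: finite_induct)
  case (insert b S)
  define P Q E where "P = (\<Prod>b\<in>S. 1 - x b)" and "Q = (\<Prod>b\<in>S. 1 - y b)" and "E = (\<Sum>b\<in>S. e b)"
  have IH: "\<bar>P - Q\<bar> \<le> \<delta> * (1 - P) + E"
    unfolding P_def Q_def E_def using insert by simp
  have b: "0 \<le> x b" "x b \<le> 1" "0 \<le> y b" "y b \<le> 1" "0 \<le> e b" "\<bar>x b - y b\<bar> \<le> \<delta> * x b + e b"
    using insert.prems by auto
  have Q: "0 \<le> Q" "Q \<le> 1"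
    unfolding Q_def using insert.prems by (auto intro!: prod_nonneg prod_le_1)
  have P: "0 \<le> P" "P \<le> 1"
    unfolding P_def using insert.prems by (auto intro!: prod_nonneg prod_le_1)
  have E: "0 \<le> E" unfolding E_def using insert.prems by (auto intro!: sum_nonneg)
  have "\<bar>(1 - x b) * P - (1 - y b) * Q\<bar> = \<bar>(1 - x b) * (P - Q) + (y b - x b) * Q\<bar>"
    by (simp add: algebra_simps)
  also have "\<dots> \<le> (1 - x b) * \<bar>P - Q\<bar> + \<bar>x b - y b\<bar> * Q"
    using b Q by (simp add: abs_mult abs_minus_commute order.trans[OF abs_triangle_ineq])
  also have "\<dots> \<le> (1 - x b) * (\<delta> * (1 - P) + E) + (\<delta> * x b + e b) * 1"
    using b Q IH assms(2) by (intro add_mono mult_mono) auto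
  \<comment> \<open>The term \<open>\<delta> * (1 - P)\<close> reproduces itself exactly under one
    more factor, which is why the bound is stated with it and not with
    \<open>\<delta>\<close>.\<close>
  also have "\<dots> = \<delta> * (1 - (1 - x b) * P) + (e b + E) - x b * E"
    by (simp add: algebra_simps)
  also have "\<dots> \<le> \<delta> * (1 - (1 - x b) * P) + (e b + E)"
    using b E by simp
  finally show ?case using insert(1,2) by (simp add: P_def Q_def E_def)
qed simp

lemma prod_one_minus_close:
  fixes x y e :: "'a \<Rightarrow> real"
  assumes "finite S" "0 \<le> \<delta>"
    and "\<And>b. b \<in> S \<Longrightarrow> 0 \<le> x b \<and> x b \<le> 1 \<and> 0 \<le> y b \<and> y b \<le> 1 \<and> 0 \<le> e b"
    and "\<And>b. b \<in> S \<Longrightarrow> \<bar>x b - y b\<bar> \<le> \<delta> * x b + e b"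
  shows "\<bar>(\<Prod>b\<in>S. 1 - x b) - (\<Prod>b\<in>S. 1 - y b)\<bar> \<le> \<delta> + (\<Sum>b\<in>S. e b)"
proof -
  have "0 \<le> (\<Prod>b\<in>S. 1 - x b)" using assms(3) by (intro prod_nonneg) auto
  then have "\<delta> * (1 - (\<Prod>b\<in>S. 1 - x b)) \<le> \<delta> * 1"
    using assms(2) by (intro mult_left_mono) auto
  moreover have "\<bar>(\<Prod>b\<in>S. 1 - x b) - (\<Prod>b\<in>S. 1 - y b)\<bar> \<le>
      \<delta> * (1 - (\<Prod>b\<in>S. 1 - x b)) + (\<Sum>b\<in>S. e b)"
    using assms by (intro prod_one_minus_diff_le) auto
  ultimately show ?thesis by linarith
qed

section \<open>Elementary estimates for exponential losses\<close>

lemma one_minus_exp_le: "1 - exp (- x) \<le> x" for x :: real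
  using exp_ge_add_one_self[of "- x"] by simp

text \<open>With the upper bound \<open>x\<close>, linearising costs a relative error of at most
  \<open>x / 2\<close>. Small values, light elements and the mass units \<open>1 / C\<close> are all
  handled this way.\<close>

lemma one_minus_exp_ge:
  fixes x :: real
  assumes "0 \<le> x"
  shows "x - x\<^sup>2 / 2 \<le> 1 - exp (- x)"
proof -
  let ?g = "\<lambda>x::real. 1 - exp (- x) - x + x\<^sup>2 / 2"
  have "?g 0 \<le> ?g x"
  proof (rule DERIV_nonneg_imp_nondecreasing[OF assms])
    fix y :: real assume "0 \<le> y"
    have "(?g has_real_derivative exp (- y) - 1 + y) (at y)"
      by (auto intro!: derivative_eq_intros)
    moreover have "0 \<le> exp (- y) - 1 + y" using one_minus_exp_le[of y] by simp
    ultimately show "\<exists>z. (?g has_real_derivative z) (at y) \<and> 0 \<le> z" by blast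
  qed
  then show ?thesis by simp
qed

lemma exp_neg_diff_le:
  fixes a b :: real
  assumes "0 \<le> a" "0 \<le> b"
  shows "\<bar>exp (- a) - exp (- b)\<bar> \<le> \<bar>a - b\<bar>"
proof -
  have *: "exp (- a) - exp (- b) \<le> b - a" if "0 \<le> a" "a \<le> b" for a b :: real
  proof -
    have "exp (- a) - exp (- b) = exp (- a) * (1 - exp (- (b - a)))"
      by (simp add: algebra_simps flip: exp_add)
    also have "\<dots> \<le> 1 * (b - a)"
      using that one_minus_exp_le[of "b - a"] by (intro mult_mono) auto
    finally show ?thesis by simp
  qed
  show ?thesis
    using *[of a b] *[of b a] assms by (cases "a \<le> b") auto
qed

text \<open>The chord of a concave function lies below it: a mean-preserving split of
  \<open>x\<close> between \<open>0\<close> and \<open>g\<close> can only lower the loss, so the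
  error below the last cell has one sign.\<close>

lemma one_minus_exp_concave:
  fixes k x g :: real
  assumes "0 \<le> x" "x \<le> g" "0 < g"
  shows "x / g * (1 - exp (- (k * g))) \<le> 1 - exp (- (k * x))"
proof -
  have "convex_on UNIV (exp :: real \<Rightarrow> real)" by (rule exp_convex)
  from convex_onD[OF this, of "x / g" 0 "- (k * g)"] assms
  show ?thesis by (simp add: algebra_simps)
qed

section \<open>Rounding values to a grid\<close>

definition cell :: "nat \<Rightarrow> nat \<Rightarrow> real \<Rightarrow> nat" where
  "cell H Y x = min (nat \<lfloor>real H * x\<rfloor>) Y"

text \<open>The upper end is taken so that even the first cell has a positive value, hence a loss
  bounded away from \<open>0\<close>.\<close>

definition cell_val :: "nat \<Rightarrow> nat \<Rightarrow> real" where
  "cell_val H j = real (Suc j) / real H"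

text \<open>
  A value \<open>x\<close> is replaced by the upper end of its cell with probability \<open>cell_frac H Y x\<close> and by
  \<open>0\<close> otherwise; below the last cell \<open>Y\<close>, which is unbounded, this preserves the mean.
\<close>

definition cell_frac :: "nat \<Rightarrow> nat \<Rightarrow> real \<Rightarrow> real" where
  "cell_frac H Y x = (if cell H Y x < Y then x / cell_val H (cell H Y x) else 1)"

lemma cell_frac_bounds:
  assumes "0 < H" "0 \<le> x"
  shows "0 \<le> cell_frac H Y x" "cell_frac H Y x \<le> 1"
proof -
  show "0 \<le> cell_frac H Y x" using assms by (auto simp: cell_frac_def cell_val_def)
  have "x \<le> cell_val H (cell H Y x)" if "cell H Y x < Y"
  proof -
    have "cell H Y x = nat \<lfloor>real H * x\<rfloor>" using that by (auto simp: cell_def)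
    then have "real (cell H Y x) = of_int \<lfloor>real H * x\<rfloor>" using assms by simp
    moreover have "real H * x < of_int \<lfloor>real H * x\<rfloor> + 1" by linarith
    ultimately have "real H * x < real (Suc (cell H Y x))" by (simp only: of_nat_Suc)
    then show ?thesis using assms by (simp add: cell_val_def field_simps)
  qed
  then show "cell_frac H Y x \<le> 1" using assms by (auto simp: cell_frac_def cell_val_def divide_simps)
qed

text \<open>There are three regimes. If \<open>k * g \<le> \<delta>\<close>, the loss is nearly
  linear and the preserved mean gives the right first-order term. For larger \<open>g\<close> the
  cell is narrow compared with \<open>g\<close>, so \<open>x / g\<close> is at least
  \<open>1 - \<delta>\<close>. In the last cell both losses are close to \<open>1\<close>. One grid
  serves all exponents up to \<open>K\<close>.\<close>

lemma cell_error:
  fixes \<delta> :: real and K :: nat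
  assumes "0 < \<delta>" "\<delta> \<le> 1"
  obtains H Y where "0 < H"
    "\<And>k x. 1 \<le> k \<Longrightarrow> k \<le> real K \<Longrightarrow> 0 \<le> x \<Longrightarrow>
      \<bar>(1 - exp (- (k * x))) - cell_frac H Y x * (1 - exp (- (k * cell_val H (cell H Y x))))\<bar>
        \<le> \<delta> * (1 - exp (- (k * x)))"
proof -
  \<comment> \<open>If \<open>k * g > \<delta>\<close> with \<open>k \<le> K\<close>, then
    \<open>\<delta> * g > \<delta>\<^sup>2 / K\<close>, and the choice of \<open>H\<close> makes
    this exceed the cell width \<open>1 / H\<close>.\<close>
  obtain H :: nat where H: "real K / \<delta>\<^sup>2 + 1 < real H" using reals_Archimedean2 by blast
  moreover have "0 \<le> real K / \<delta>\<^sup>2" by simp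
  ultimately have "0 < real H" by linarith
  then have H0: "0 < H" by simp
  \<comment> \<open>From \<open>Z\<close> on, which is where the last cell begins,
    \<open>exp (- (k * x))\<close> is at most \<open>1 / (1 + Z)\<close>; this is below
    \<open>\<delta>\<close> times the loss as soon as \<open>\<delta> * Z \<ge> 1\<close>.\<close>
  obtain Z :: nat where Z: "2 / \<delta> < real Z" using reals_Archimedean2 by blast
  define Y where "Y = H * Z"
  show thesis
  proof (rule that[OF H0])
    fix k x :: real assume k: "1 \<le> k" "k \<le> real K" and x: "0 \<le> x"
    define f where "f x = 1 - exp (- (k * x))" for x
    define g where "g = cell_val H (cell H Y x)"
    have g0: "0 < g" using H0 by (simp add: g_def cell_val_def)
    have fmono: "f a \<le> f b" if "a \<le> b" for a b using that k by (simp add: f_def)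
    have f0: "0 \<le> f a" if "0 \<le> a" for a using that k by (simp add: f_def)
    show "\<bar>(1 - exp (- (k * x))) - cell_frac H Y x * (1 - exp (- (k * cell_val H (cell H Y x))))\<bar>
        \<le> \<delta> * (1 - exp (- (k * x)))"
    proof (cases "cell H Y x < Y")
      case True
      then have c: "cell H Y x = nat \<lfloor>real H * x\<rfloor>" by (auto simp: cell_def)
      have "real (cell H Y x) = of_int \<lfloor>real H * x\<rfloor>"
        unfolding c using x by (simp add: of_nat_nat)
      then have "real (cell H Y x) \<le> real H * x" "real H * x < real (cell H Y x) + 1"
        by linarith+
      then have xg: "x \<le> g" "g - x \<le> 1 / real H"
        using H0 by (auto simp: g_def cell_val_def field_simps)
      have conc: "x / g * f g \<le> f x"
        unfolding f_def using one_minus_exp_concave x xg(1) g0 by blast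
      have "f x - x / g * f g \<le> \<delta> * f x"
      proof (cases "k * g \<le> \<delta>")
        case True
        have kg: "0 \<le> k * g" using k g0 by simp
        have fg: "k * g - (k * g)\<^sup>2 / 2 \<le> f g"
          unfolding f_def by (rule one_minus_exp_ge[OF kg])
        have "x / g * (k * g - (k * g)\<^sup>2 / 2) \<le> x / g * f g"
          using fg x g0 by (intro mult_left_mono) auto
        moreover have "x / g * (k * g - (k * g)\<^sup>2 / 2) = k * x - k * x * (k * g) / 2"
          using g0 by (simp add: field_simps power2_eq_square)
        ultimately have l: "k * x - k * x * (k * g) / 2 \<le> x / g * f g" by simp
        have u: "f x \<le> k * x" unfolding f_def by (rule one_minus_exp_le)
        have kx: "k * x * (k * g) \<le> k * x * \<delta>" "k * x * \<delta> \<le> k * x * 1"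
          using True assms k x by (intro mult_left_mono; simp)+
        \<comment> \<open>Here \<open>\<delta> \<le> 1\<close> enters: the loss is at least half its
          linear term, so an error of \<open>\<delta> * (k * x / 2)\<close> is relative to the
          loss.\<close>
        from l kx conc have "k * x / 2 \<le> f x" by linarith
        then have "\<delta> * (k * x / 2) \<le> \<delta> * f x" using assms by (intro mult_left_mono) auto
        then show ?thesis using l u kx by (simp add: algebra_simps)
      next
        case False
        have "1 / real H \<le> \<delta> * g"
        proof -
          have "real K / \<delta>\<^sup>2 < real H" using H by simp
          then have "real K < \<delta>\<^sup>2 * real H" using assms by (simp add: field_simps)
          moreover have "\<delta> * \<delta> \<le> \<delta> * (real K * g)"
          proof (rule mult_left_mono)
            have "k * g \<le> real K * g" using k g0 by (intro mult_right_mono) auto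
            with False show "\<delta> \<le> real K * g" by linarith
          qed (use assms in simp)
          ultimately have "real K < \<delta> * (real K * g) * real H"
            by (smt (verit) mult_right_mono of_nat_0_le_iff power2_eq_square)
          then have "real K * 1 < real K * (\<delta> * g * real H)" by (simp add: algebra_simps)
          then have "1 < \<delta> * g * real H" using k by (simp add: mult_less_cancel_left_pos)
          then show ?thesis using H0 by (simp add: field_simps)
        qed
        then have "1 - x / g \<le> \<delta>" using xg g0 by (simp add: field_simps)
        have "f x - x / g * f g \<le> f x - x / g * f x"
          using fmono[OF xg(1)] x g0 by (simp add: divide_right_mono mult_left_mono)
        also have "\<dots> = (1 - x / g) * f x" by (simp add: algebra_simps)
        also have "\<dots> \<le> \<delta> * f x" using \<open>1 - x / g \<le> \<delta>\<close> f0[OF x] by (rule mult_right_mono)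
        finally show ?thesis .
      qed
      with conc True show ?thesis by (simp add: cell_frac_def f_def g_def)
    next
      case False
      then have c: "cell H Y x = Y" by (auto simp: cell_def)
      then have "Y \<le> nat \<lfloor>real H * x\<rfloor>" by (auto simp: cell_def)
      then have "real Y \<le> real H * x"
        using x H0 by (cases "Y = 0") (auto simp: le_nat_iff le_floor_iff)
      then have xZ: "real Z \<le> x" using H0 by (simp add: Y_def)
      have "g = (real Y + 1) / real H" by (simp add: g_def c cell_val_def)
      then have gZ: "real Z \<le> g" using H0 by (simp add: Y_def add_divide_distrib)
      have e: "exp (- (k * a)) \<le> 1 / (1 + real Z)" if "real Z \<le> a" for a
      proof -
        have "1 * real Z \<le> k * a" using that k by (intro mult_mono) auto
        then have "exp (- (k * a)) \<le> exp (- real Z)" by simp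
        also have "\<dots> \<le> inverse (1 + real Z)"
          unfolding exp_minus by (intro le_imp_inverse_le) auto
        finally show ?thesis by (simp add: divide_inverse)
      qed
      have "\<bar>f x - f g\<bar> \<le> 1 / (1 + real Z)"
        using e[OF xZ] e[OF gZ] exp_gt_zero[of "- (k * x)"] exp_gt_zero[of "- (k * g)"]
        unfolding f_def by linarith
      also have "\<dots> \<le> \<delta> * (1 - 1 / (1 + real Z))"
        using Z assms by (simp add: field_simps)
      also have "\<dots> \<le> \<delta> * f x" using e[OF xZ] assms by (intro mult_left_mono) (auto simp: f_def)
      finally show ?thesis using False by (simp add: cell_frac_def f_def g_def)
    qed
  qed
qed

lemma exp_sum_approximation:
  fixes \<mu> :: "real \<Rightarrow> real"
  assumes cont: "continuous_on {0..} \<mu>" and lim: "(\<mu> \<longlongrightarrow> 0) at_top" and e: "0 < e"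
  obtains K :: nat and c :: "nat \<Rightarrow> real"
    where "\<And>x. 0 \<le> x \<Longrightarrow> \<bar>\<mu> x - (\<Sum>k=1..K. c k * exp (- (real k * x)))\<bar> \<le> e"
proof -
  define g where "g u = (if u = 0 then 0 else \<mu> (- ln u))" for u :: real
  have "continuous_on {0..1} g"
    unfolding continuous_on_def
  proof
    fix u :: real assume u: "u \<in> {0..1}"
    show "(g \<longlongrightarrow> g u) (at u within {0..1})"
    proof (cases "u = 0")
      case True
      have "filterlim (\<lambda>u::real. - ln u) at_top (at_right 0)"
        using ln_at_0 by (simp add: filterlim_uminus_at_top)
      then have "((\<lambda>u. \<mu> (- ln u)) \<longlongrightarrow> 0) (at_right 0)"
        by (rule filterlim_compose[OF lim])
      then have "(g \<longlongrightarrow> 0) (at_right 0)"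
        by (rule Lim_transform_eventually)
           (auto simp: g_def eventually_at_filter)
      moreover have "at 0 within {0..1::real} = at_right 0"
        by (rule at_within_Icc_at_right) simp
      ultimately show ?thesis using True by (simp add: g_def)
    next
      case False
      have "continuous_on {0<..1} (\<lambda>u. \<mu> (- ln u))"
        by (rule continuous_on_compose2[OF cont]) (auto intro!: continuous_intros)
      then have "((\<lambda>u. \<mu> (- ln u)) \<longlongrightarrow> \<mu> (- ln u)) (at u within {0<..1})"
        using u False by (auto simp: continuous_on_def)
      moreover have "at u within {0<..1} = at u within {0..1}"
        by (rule at_within_nhd[of _ "{0<..}"]) (use u False in auto)
      ultimately have "((\<lambda>u. \<mu> (- ln u)) \<longlongrightarrow> \<mu> (- ln u)) (at u within {0..1})" by simp
      then show ?thesis unfolding g_def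
        using False
        by (auto elim!: Lim_transform_within[where d = u] simp: dist_real_def)
           (use u False in \<open>auto elim!: Lim_transform_within[where d = u] simp: dist_real_def\<close>)
    qed
  qed
  from Stone_Weierstrass_real_polynomial_function[OF compact_Icc this, of "e / 2"] e
  obtain p where p: "real_polynomial_function p" "\<And>u. u \<in> {0..1} \<Longrightarrow> \<bar>g u - p u\<bar> < e / 2"
    by auto
  from p(1) obtain a n where an: "p = (\<lambda>x. \<Sum>i\<le>n. a i * x ^ i)"
    by (auto simp: real_polynomial_function_iff_sum)
  show thesis
  proof (rule that[of a n])
    fix x :: real assume x: "0 \<le> x"
    define u where "u = exp (- x)"
    have u: "u \<in> {0..1}" "u \<noteq> 0" using x by (auto simp: u_def)
    have "p u = a 0 + (\<Sum>i=1..n. a i * u ^ i)"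
      unfolding an by (simp add: atMost_atLeast0 sum.atLeast_Suc_atMost)
    moreover have "u ^ i = exp (- (real i * x))" for i
      by (simp add: u_def exp_of_nat_mult flip: exp_of_nat_mult)
    ultimately have "p u = a 0 + (\<Sum>k=1..n. a k * exp (- (real k * x)))" by simp
    moreover have "g u = \<mu> x" using u by (simp add: g_def u_def)
    moreover have "\<bar>a 0\<bar> < e / 2"
      using p(2)[of 0] by (simp add: g_def an power_0_left if_distrib[of "\<lambda>x. _ * x"] sum.delta cong: if_cong)
    ultimately show "\<bar>\<mu> x - (\<Sum>k=1..n. a k * exp (- (real k * x)))\<bar> \<le> e"
      using p(2)[OF u(1)] by linarith
  qed
qed

section \<open>Averaging operators behind the surrogate\<close>

text \<open>
  \<open>mix m g a f x\<close> is the expectation of \<open>f (x + Z)\<close>, where \<open>Z\<close> takes the value \<open>g j\<close> with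
  probability \<open>a j\<close> and is \<open>0\<close> otherwise.  In \<open>walk\<close>, \<open>c i\<close> independent copies of the \<open>i\<close>-th such
  variable are added for each \<open>i < d\<close>.
\<close>

definition mix :: "nat \<Rightarrow> (nat \<Rightarrow> real) \<Rightarrow> (nat \<Rightarrow> real) \<Rightarrow> (real \<Rightarrow> real) \<Rightarrow> real \<Rightarrow> real" where
  "mix m g a f x = (1 - (\<Sum>j<m. a j)) * f x + (\<Sum>j<m. a j * f (x + g j))"

definition subprob :: "nat \<Rightarrow> (nat \<Rightarrow> real) \<Rightarrow> bool" where
  "subprob m a \<longleftrightarrow> (\<forall>j<m. 0 \<le> a j) \<and> (\<Sum>j<m. a j) \<le> 1"

primrec walk :: "nat \<Rightarrow> (nat \<Rightarrow> real) \<Rightarrow> (nat \<Rightarrow> nat \<Rightarrow> real) \<Rightarrow> nat \<Rightarrow> (nat \<Rightarrow> nat) \<Rightarrow>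
    (real \<Rightarrow> real) \<Rightarrow> real \<Rightarrow> real" where
  "walk m g a 0 c f = f"
| "walk m g a (Suc i) c f = (mix m g (a i) ^^ c i) (walk m g a i c f)"

lemma mix_mono:
  assumes "subprob m a" "\<And>x. f x \<le> h x"
  shows "mix m g a f x \<le> mix m g a h x"
  unfolding mix_def using assms
  by (intro add_mono mult_left_mono sum_mono) (auto simp: subprob_def)

lemma mix_antimono:
  assumes "subprob m a" "antimono f"
  shows "antimono (mix m g a f)"
  unfolding mix_def using assms
  by (auto intro!: antimonoI add_mono mult_left_mono sum_mono simp: subprob_def antimonoD)

lemma mix_le:
  assumes "subprob m a" "antimono f" "\<And>j. j < m \<Longrightarrow> 0 \<le> g j"
  shows "mix m g a f x \<le> f x"
proof -
  have "mix m g a f x \<le> (1 - (\<Sum>j<m. a j)) * f x + (\<Sum>j<m. a j * f x)"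
    unfolding mix_def using assms
    by (intro add_mono mult_left_mono sum_mono) (auto simp: subprob_def intro: antimonoD)
  also have "\<dots> = f x" by (simp add: left_diff_distrib sum_distrib_right)
  finally show ?thesis .
qed

lemma mix_pow_antimono:
  "subprob m a \<Longrightarrow> antimono f \<Longrightarrow> antimono ((mix m g a ^^ n) f)"
  by (induction n) (auto intro: mix_antimono)

lemma mix_pow_mono:
  assumes "subprob m a" "\<And>x. f x \<le> h x"
  shows "(mix m g a ^^ n) f x \<le> (mix m g a ^^ n) h x"
proof (induction n arbitrary: x)
  case (Suc n)
  then show ?case using mix_mono[OF assms(1)] by auto
qed (use assms in auto)

lemma mix_pow_decreasing:
  assumes "subprob m a" "antimono f" "\<And>j. j < m \<Longrightarrow> 0 \<le> g j" "n \<le> n'"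
  shows "(mix m g a ^^ n') f x \<le> (mix m g a ^^ n) f x"
  using assms(4)
proof (induction n' rule: dec_induct)
  case (step n')
  have "mix m g a ((mix m g a ^^ n') f) x \<le> (mix m g a ^^ n') f x"
    by (intro mix_le mix_pow_antimono assms)
  with step show ?case by simp
qed simp

lemma walk_antimono:
  "(\<And>i. i < d \<Longrightarrow> subprob m (a i)) \<Longrightarrow> antimono f \<Longrightarrow> antimono (walk m g a d c f)"
  by (induction d) (auto intro: mix_pow_antimono)

text \<open>More copies push the sum to the right. Hence a set that stays below its budgets has at
  least the surrogate utility of these budgets; this makes upper bounds on weights useful at
  all.\<close>

lemma walk_decreasing:
  assumes "\<And>i. i < d \<Longrightarrow> subprob m (a i)" "antimono f" "\<And>j. j < m \<Longrightarrow> 0 \<le> g j"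
    and "\<And>i. i < d \<Longrightarrow> c i \<le> c' i"
  shows "walk m g a d c' f x \<le> walk m g a d c f x"
  using assms
proof (induction d arbitrary: x)
  case (Suc d)
  have "(mix m g (a d) ^^ c' d) (walk m g a d c' f) x \<le> (mix m g (a d) ^^ c' d) (walk m g a d c f) x"
    using Suc by (intro mix_pow_mono) auto
  also have "\<dots> \<le> (mix m g (a d) ^^ c d) (walk m g a d c f) x"
    using Suc.prems by (intro mix_pow_decreasing walk_antimono) auto
  finally show ?case by simp
qed simp

lemma mix_close:
  assumes a: "subprob m a" and g: "\<And>j. j < m \<Longrightarrow> 0 \<le> g j"
    and f: "\<And>x. 0 \<le> x \<Longrightarrow> \<bar>f x - h x\<bar> \<le> e" and x: "0 \<le> x"
  shows "\<bar>mix m g a f x - mix m g a h x\<bar> \<le> e"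
proof -
  have "mix m g a f x - mix m g a h x =
      (1 - (\<Sum>j<m. a j)) * (f x - h x) + (\<Sum>j<m. a j * (f (x + g j) - h (x + g j)))"
    by (simp add: mix_def algebra_simps sum_subtractf)
  also have "\<bar>\<dots>\<bar> \<le> (1 - (\<Sum>j<m. a j)) * \<bar>f x - h x\<bar> + (\<Sum>j<m. a j * \<bar>f (x + g j) - h (x + g j)\<bar>)"
    using a by (intro order.trans[OF abs_triangle_ineq] add_mono order.trans[OF sum_abs])
       (auto simp: abs_mult subprob_def intro!: sum_mono)
  also have "\<dots> \<le> (1 - (\<Sum>j<m. a j)) * e + (\<Sum>j<m. a j * e)"
    using a x g by (intro add_mono mult_left_mono sum_mono f) (auto simp: subprob_def)
  also have "\<dots> = e" by (simp add: left_diff_distrib sum_distrib_right)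
  finally show ?thesis .
qed

text \<open>Every step is an average, so a uniform error is not amplified, however large the counts;
  nonnegative jumps never leave the half-line where the error bound holds.\<close>

lemma walk_close:
  assumes "\<And>i. i < d \<Longrightarrow> subprob m (a i)" "\<And>j. j < m \<Longrightarrow> 0 \<le> g j"
    and "\<And>x. 0 \<le> x \<Longrightarrow> \<bar>f x - h x\<bar> \<le> e" and "0 \<le> x"
  shows "\<bar>walk m g a d c f x - walk m g a d c h x\<bar> \<le> e"
  using assms
proof (induction d arbitrary: x)
  case (Suc d)
  have "\<bar>(mix m g (a d) ^^ n) (walk m g a d c f) x - (mix m g (a d) ^^ n) (walk m g a d c h) x\<bar> \<le> e"
    if "0 \<le> x" for n x
    using that
  proof (induction n arbitrary: x)
    case (Suc n)
    then show ?case using Suc.prems \<open>\<And>i. i < Suc d \<Longrightarrow> _\<close> assms(2) by (auto intro!: mix_close)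
  qed (use Suc in auto)
  with Suc.prems show ?case by simp
qed simp

text \<open>Each exponential is an eigenfunction of \<open>mix\<close>, with one minus the loss of
  the added variable as its eigenvalue.\<close>

lemma mix_exp:
  "mix m g a (\<lambda>x. \<Sum>k\<in>A. c k * exp (- (r k * x))) =
   (\<lambda>x. \<Sum>k\<in>A. c k * (1 - (\<Sum>j<m. a j * (1 - exp (- (r k * g j))))) * exp (- (r k * x)))"
proof
  fix x
  have "(\<Sum>j<m. a j * (\<Sum>k\<in>A. c k * exp (- (r k * (x + g j))))) =
      (\<Sum>k\<in>A. \<Sum>j<m. a j * (c k * exp (- (r k * (x + g j)))))"
    unfolding sum_distrib_left by (rule sum.swap)
  then show "mix m g a (\<lambda>x. \<Sum>k\<in>A. c k * exp (- (r k * x))) x =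
      (\<Sum>k\<in>A. c k * (1 - (\<Sum>j<m. a j * (1 - exp (- (r k * g j))))) * exp (- (r k * x)))"
    by (simp add: mix_def sum_distrib_left sum_distrib_right algebra_simps exp_add sum_subtractf
        sum.distrib flip: exp_add sum.distrib)
qed

lemma walk_exp:
  "walk m g a d n (\<lambda>x. \<Sum>k\<in>A. c k * exp (- (r k * x))) =
   (\<lambda>x. \<Sum>k\<in>A. c k * (\<Prod>i<d. (1 - (\<Sum>j<m. a i j * (1 - exp (- (r k * g j))))) ^ n i) * exp (- (r k * x)))"
proof (induction d)
  case (Suc d)
  have pow: "(mix m g b ^^ l) (\<lambda>x. \<Sum>k\<in>A. c k * exp (- (r k * x))) =
   (\<lambda>x. \<Sum>k\<in>A. c k * (1 - (\<Sum>j<m. b j * (1 - exp (- (r k * g j))))) ^ l * exp (- (r k * x)))" for b c l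
  proof (induction l)
    case (Suc l)
    show ?case by (simp only: funpow.simps o_apply Suc.IH mix_exp power_Suc) (simp add: ac_simps)
  qed simp
  show ?case by (simp only: walk.simps Suc.IH pow prod.lessThan_Suc) (simp add: ac_simps)
qed simp

section \<open>Signatures of elements\<close>

text \<open>Sums run over positions, the form in which \<open>ptime_sum\<close> computes them;
  entries with equal values are never merged.\<close>

definition dist_list :: "(rat \<times> rat) list \<Rightarrow> bool" where
  "dist_list es \<longleftrightarrow> (\<forall>e\<in>set es. 0 \<le> fst e \<and> 0 \<le> snd e) \<and>
    (\<Sum>i<length es. real_of_rat (snd (es ! i))) = 1"

definition loss :: "real \<Rightarrow> (rat \<times> rat) list \<Rightarrow> real" where
  "loss k es = (\<Sum>i<length es. real_of_rat (snd (es ! i)) *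
    (1 - exp (- (k * real_of_rat (fst (es ! i))))))"

lemma dist_list_nth:
  assumes "dist_list es" "i < length es"
  shows "0 \<le> real_of_rat (fst (es ! i))" "0 \<le> real_of_rat (snd (es ! i))"
  using assms by (auto simp: dist_list_def)

lemma loss_bounds:
  assumes "dist_list es" "0 \<le> k"
  shows "0 \<le> loss k es" "loss k es \<le> 1"
proof -
  show "0 \<le> loss k es"
    unfolding loss_def using assms dist_list_nth
    by (intro sum_nonneg mult_nonneg_nonneg) auto
  have "loss k es \<le> (\<Sum>i<length es. real_of_rat (snd (es ! i)) * 1)"
    unfolding loss_def using assms dist_list_nth by (intro sum_mono mult_left_mono) auto
  with assms show "loss k es \<le> 1" by (simp add: dist_list_def)
qed

text \<open>The grid has width \<open>1 / H\<close> and last cell \<open>Y\<close>. An element is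
  heavy if some grid point carries mass at least \<open>1 / R\<close>; masses of heavy elements are
  rounded to multiples of \<open>1 / (R * T)\<close>, and total light masses to multiples of
  \<open>1 / C\<close>. \<open>R_large\<close> makes the total mass of a light element at most
  \<open>\<delta>\<close>, \<open>T_large\<close> makes the rounding of a heavy one small against
  its loss, and \<open>C_large\<close> covers all errors of size \<open>1 / C\<close>.\<close>

locale rounding =
  fixes H Y C R T :: nat and K :: nat and \<delta> :: real
  assumes H_pos: "0 < H" and C_pos: "0 < C" and R_pos: "0 < R" and T_pos: "0 < T"
    and \<delta>_pos: "0 < \<delta>"
    and cell_err: "\<And>k x. 1 \<le> k \<Longrightarrow> k \<le> real K \<Longrightarrow> 0 \<le> x \<Longrightarrow>
      \<bar>(1 - exp (- (k * x))) - cell_frac H Y x * (1 - exp (- (k * cell_val H (cell H Y x))))\<bar>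
        \<le> \<delta> * (1 - exp (- (k * x)))"
    and R_large: "real (Suc Y) \<le> \<delta> * real R"
    and T_large: "real (Suc Y) \<le> \<delta> * real T * (1 - exp (- cell_val H 0))"
    and C_large: "real (Suc Y) + 2 \<le> \<delta> * real C"
begin

definition m :: nat where "m = Suc Y"

definition s :: "real \<Rightarrow> nat \<Rightarrow> real" where "s k j = 1 - exp (- (k * cell_val H j))"

text \<open>
  Probabilities are measured in units of \<open>1 / (C * M)\<close>.  For \<open>M\<close> at least the number of entries of
  all distributions, the rounding errors add up to at most \<open>1 / C\<close>.  The resulting weights are
  integers, so the algorithm can encode them without cancelling fractions.
\<close>

definition share :: "nat \<Rightarrow> nat \<Rightarrow> rat \<times> rat \<Rightarrow> int" where
  "share M j e = (if cell H Y (real_of_rat (fst e)) = j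
    then \<lfloor>real (C * M) * (real_of_rat (snd e) * cell_frac H Y (real_of_rat (fst e)))\<rfloor> else 0)"

definition mass :: "nat \<Rightarrow> (rat \<times> rat) list \<Rightarrow> nat \<Rightarrow> int" where
  "mass M es j = (\<Sum>i<length es. share M j (es ! i))"

definition code :: "nat \<Rightarrow> (rat \<times> rat) list \<Rightarrow> nat list" where
  "code M es = map (\<lambda>j. nat ((int (R * T) * mass M es j) div int (C * M))) [0..<m]"

definition light :: "nat \<Rightarrow> (rat \<times> rat) list \<Rightarrow> bool" where
  "light M es \<longleftrightarrow> (\<forall>j<m. code M es ! j < T)"

text \<open>The list is determined by the constants alone, hence so is \<open>d\<close>. The
  condition on the sum keeps \<open>coef\<close> a subprobability even for types that no element
  has.\<close>

definition tys :: "nat list list" where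
  "tys = filter (\<lambda>\<tau>. (\<exists>j<m. T \<le> \<tau> ! j) \<and> (\<Sum>j<m. \<tau> ! j) \<le> R * T) (List.n_lists m [0..<Suc (R * T)])"

definition d :: nat where "d = m + length tys"

text \<open>
  The first \<open>m\<close> dimensions carry the masses of light elements, the others count the heavy elements
  of each type, in units of \<open>M\<close>.
\<close>

definition weight :: "nat \<Rightarrow> (rat \<times> rat) list \<Rightarrow> nat \<Rightarrow> int" where
  "weight M es i = (if i < m then (if light M es then mass M es i else 0)
    else (if code M es = tys ! (i - m) then int M else 0))"

text \<open>
  The grid-valued variable that stands for \<open>M\<close> units of weight in dimension \<open>i\<close>.
\<close>

definition coef :: "nat \<Rightarrow> nat \<Rightarrow> real" where
  "coef i j = (if i < m then (if j = i then 1 / real C else 0)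
    else real (tys ! (i - m) ! j) / real (R * T))"

section \<open>Masses on the grid\<close>

lemma s_bounds: "0 \<le> k \<Longrightarrow> 0 \<le> s k j" "s k j \<le> 1"
  by (auto simp: s_def cell_val_def)

lemma s_ge: "1 \<le> k \<Longrightarrow> 1 - exp (- cell_val H 0) \<le> s k j"
proof -
  assume "1 \<le> k"
  then have "1 * cell_val H 0 \<le> k * cell_val H j"
    using H_pos by (intro mult_mono) (auto simp: cell_val_def divide_right_mono)
  then show ?thesis by (simp add: s_def)
qed

lemma cell_less_m: "cell H Y x < m"
  by (simp add: cell_def m_def)

lemma sum_share:
  "(\<Sum>j<m. real_of_int (share M j e) * h j) =
    real_of_int \<lfloor>real (C * M) * (real_of_rat (snd e) * cell_frac H Y (real_of_rat (fst e)))\<rfloor> *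
      h (cell H Y (real_of_rat (fst e)))"
proof -
  have "(\<Sum>j<m. real_of_int (share M j e) * h j) =
    (\<Sum>j<m. if j = cell H Y (real_of_rat (fst e)) then
      real_of_int \<lfloor>real (C * M) * (real_of_rat (snd e) * cell_frac H Y (real_of_rat (fst e)))\<rfloor> *
      h (cell H Y (real_of_rat (fst e))) else 0)"
    by (intro sum.cong) (auto simp: share_def)
  then show ?thesis using cell_less_m by simp
qed

lemma share_nonneg: "0 \<le> fst e \<Longrightarrow> 0 \<le> snd e \<Longrightarrow> 0 \<le> share M j e"
  using cell_frac_bounds(1)[OF H_pos, of "real_of_rat (fst e)" Y] by (simp add: share_def)

lemma mass_nonneg: "dist_list es \<Longrightarrow> 0 \<le> mass M es j"
  unfolding mass_def by (intro sum_nonneg share_nonneg) (auto simp: dist_list_def)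

lemma sum_mass:
  "(\<Sum>j<m. real_of_int (mass M es j) * h j) =
    (\<Sum>i<length es. real_of_int \<lfloor>real (C * M) * (real_of_rat (snd (es ! i)) *
      cell_frac H Y (real_of_rat (fst (es ! i))))\<rfloor> * h (cell H Y (real_of_rat (fst (es ! i)))))"
  unfolding sum_share[symmetric] mass_def of_int_sum sum_distrib_right by (rule sum.swap)

lemma sum_mass_le:
  assumes "dist_list es"
  shows "(\<Sum>j<m. real_of_int (mass M es j)) \<le> real (C * M)"
proof -
  have "(\<Sum>j<m. real_of_int (mass M es j) * 1) \<le>
      (\<Sum>i<length es. real (C * M) * real_of_rat (snd (es ! i)))"
    unfolding sum_mass
  proof (intro sum_mono)
    fix i assume i: "i \<in> {..<length es}"
    let ?p = "real_of_rat (snd (es ! i))" and ?\<phi> = "cell_frac H Y (real_of_rat (fst (es ! i)))"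
    have "real_of_int \<lfloor>real (C * M) * (?p * ?\<phi>)\<rfloor> \<le> real (C * M) * (?p * ?\<phi>)" by simp
    also have "\<dots> \<le> real (C * M) * (?p * 1)"
      using i dist_list_nth[OF assms] cell_frac_bounds[OF H_pos]
      by (intro mult_left_mono) auto
    finally show "real_of_int \<lfloor>real (C * M) * (?p * ?\<phi>)\<rfloor> * 1 \<le> real (C * M) * ?p" by simp
  qed
  also have "\<dots> = real (C * M)"
    using assms by (simp add: dist_list_def flip: sum_distrib_left)
  finally show ?thesis by simp
qed

lemma mass_le:
  assumes "dist_list es" "j < m"
  shows "mass M es j \<le> int (C * M)"
proof -
  have "real_of_int (mass M es j) \<le> (\<Sum>j<m. real_of_int (mass M es j))"
    using assms by (intro member_le_sum) (auto intro: mass_nonneg)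
  also have "\<dots> \<le> real (C * M)" by (rule sum_mass_le[OF assms(1)])
  finally show ?thesis by linarith
qed

definition rloss :: "real \<Rightarrow> nat \<Rightarrow> (rat \<times> rat) list \<Rightarrow> real" where
  "rloss k M es = (\<Sum>j<m. real_of_int (mass M es j) / real (C * M) * s k j)"

text \<open>Rounding the values gives the relative term, by averaging \<open>cell_err\<close>; the
  floor in \<open>share\<close> gives the absolute one, at most one unit per entry.\<close>

lemma loss_rloss:
  assumes es: "dist_list es" and M: "0 < M" and k: "1 \<le> k" "k \<le> real K"
  shows "\<bar>loss k es - rloss k M es\<bar> \<le> \<delta> * loss k es + real (length es) / real (C * M)"
proof -
  have CM: "0 < real (C * M)" using C_pos M by simp
  define v p where "v i = real_of_rat (fst (es ! i))" and "p i = real_of_rat (snd (es ! i))" for i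
  define u where "u i = real_of_int \<lfloor>real (C * M) * (p i * cell_frac H Y (v i))\<rfloor>" for i
  have "rloss k M es = (\<Sum>j<m. real_of_int (mass M es j) * s k j) / real (C * M)"
    by (simp add: rloss_def sum_divide_distrib)
  also have "\<dots> = (\<Sum>i<length es. u i / real (C * M) * s k (cell H Y (v i)))"
    by (simp add: sum_mass u_def v_def p_def sum_divide_distrib)
  finally have r: "rloss k M es = \<dots>" .
  have "\<bar>loss k es - rloss k M es\<bar> \<le> (\<Sum>i<length es. \<bar>p i * (1 - exp (- (k * v i))) -
      u i / real (C * M) * s k (cell H Y (v i))\<bar>)"
    unfolding r loss_def v_def[symmetric] p_def[symmetric] sum_subtractf[symmetric] by (rule sum_abs)
  also have "\<dots> \<le> (\<Sum>i<length es. \<delta> * (p i * (1 - exp (- (k * v i)))) + 1 / real (C * M))"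
  proof (intro sum_mono)
    fix i assume "i \<in> {..<length es}"
    then have vp: "0 \<le> v i" "0 \<le> p i" using dist_list_nth[OF es] by (auto simp: v_def p_def)
    let ?\<phi> = "cell_frac H Y (v i)" and ?s = "s k (cell H Y (v i))"
    have "p i * \<bar>(1 - exp (- (k * v i))) - ?\<phi> * ?s\<bar> \<le> p i * (\<delta> * (1 - exp (- (k * v i))))"
      unfolding s_def using vp k by (intro mult_left_mono cell_err)
    moreover have "\<bar>p i * (1 - exp (- (k * v i))) - p i * ?\<phi> * ?s\<bar> =
        p i * \<bar>(1 - exp (- (k * v i))) - ?\<phi> * ?s\<bar>"
      using vp by (simp add: abs_mult mult.assoc flip: right_diff_distrib)
    moreover have "\<bar>p i * ?\<phi> * ?s - u i / real (C * M) * ?s\<bar> \<le> 1 / real (C * M) * 1"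
    proof -
      have "\<bar>real (C * M) * (p i * ?\<phi>) - u i\<bar> \<le> 1" unfolding u_def by linarith
      then have "\<bar>real (C * M) * (p i * ?\<phi>) - u i\<bar> / real (C * M) \<le> 1 / real (C * M)"
        using CM by (intro divide_right_mono) auto
      also have "\<bar>real (C * M) * (p i * ?\<phi>) - u i\<bar> / real (C * M) =
          \<bar>(real (C * M) * (p i * ?\<phi>) - u i) / real (C * M)\<bar>"
        using CM by (simp only: abs_divide abs_of_pos)
      also have "(real (C * M) * (p i * ?\<phi>) - u i) / real (C * M) = p i * ?\<phi> - u i / real (C * M)"
        using CM by (simp only: diff_divide_distrib nonzero_mult_div_cancel_left)
      finally have "\<bar>p i * ?\<phi> - u i / real (C * M)\<bar> * \<bar>?s\<bar> \<le> 1 / real (C * M) * 1"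
        using s_bounds[of k "cell H Y (v i)"] k CM by (intro mult_mono) auto
      then show ?thesis by (simp only: left_diff_distrib flip: abs_mult)
    qed
    ultimately show "\<bar>p i * (1 - exp (- (k * v i))) - u i / real (C * M) * ?s\<bar> \<le>
        \<delta> * (p i * (1 - exp (- (k * v i)))) + 1 / real (C * M)"
      by (simp add: algebra_simps)
  qed
  also have "\<dots> = \<delta> * loss k es + real (length es) / real (C * M)"
    by (simp add: sum.distrib loss_def v_def p_def sum_distrib_left)
  finally show ?thesis .
qed

lemma rloss_bounds:
  assumes "dist_list es" "0 < M" "0 \<le> k"
  shows "0 \<le> rloss k M es" "rloss k M es \<le> 1"
proof -
  show "0 \<le> rloss k M es"
    unfolding rloss_def using assms s_bounds mass_nonneg by (intro sum_nonneg) auto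
  have "rloss k M es \<le> (\<Sum>j<m. real_of_int (mass M es j) / real (C * M) * 1)"
    unfolding rloss_def using assms s_bounds mass_nonneg by (intro sum_mono mult_left_mono) auto
  also have "\<dots> = (\<Sum>j<m. real_of_int (mass M es j)) / real (C * M)"
    by (simp add: sum_divide_distrib)
  also have "\<dots> \<le> 1" using sum_mass_le[OF assms(1), of M] C_pos assms(2)
    by (subst divide_le_eq_1_pos) simp_all
  finally show "rloss k M es \<le> 1" .
qed

section \<open>Types of heavy elements and the Poisson form of light ones\<close>

lemma length_code: "length (code M es) = m"
  by (simp add: code_def)

lemma code_nth: "j < m \<Longrightarrow> code M es ! j = nat ((int (R * T) * mass M es j) div int (C * M))"
  by (simp add: code_def)

lemma code_bounds:
  assumes "dist_list es" "0 < M" "j < m"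
  shows "real (code M es ! j) \<le> real (R * T) * (real_of_int (mass M es j) / real (C * M))"
    and "real (R * T) * (real_of_int (mass M es j) / real (C * M)) \<le> real (code M es ! j) + 1"
proof -
  have CM: "0 < C * M" using C_pos assms by simp
  let ?a = "int (R * T) * mass M es j"
  have "0 \<le> ?a" using mass_nonneg[OF assms(1)] by simp
  then have "real (code M es ! j) = of_int (?a div int (C * M))"
    using assms(3) CM by (simp add: code_nth pos_imp_zdiv_nonneg_iff del: of_nat_mult)
  also have "?a div int (C * M) = \<lfloor>real_of_int ?a / real_of_int (int (C * M))\<rfloor>"
    by (rule floor_divide_of_int_eq[symmetric])
  finally have *: "real (code M es ! j) = of_int \<lfloor>real_of_int ?a / real_of_int (int (C * M))\<rfloor>" .
  have **: "real_of_int ?a / real_of_int (int (C * M)) =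
      real (R * T) * (real_of_int (mass M es j) / real (C * M))" by simp
  show "real (code M es ! j) \<le> real (R * T) * (real_of_int (mass M es j) / real (C * M))"
    "real (R * T) * (real_of_int (mass M es j) / real (C * M)) \<le> real (code M es ! j) + 1"
    unfolding * ** by linarith+
qed

lemma RT_pos: "0 < real (R * T)"
  using R_pos T_pos by simp

lemma heavy_in_tys:
  assumes "dist_list es" "0 < M" "\<not> light M es"
  shows "code M es \<in> set tys"
proof -
  have "code M es ! j < Suc (R * T)" if "j < m" for j
  proof -
    have "real_of_int (mass M es j) / real (C * M) \<le> 1"
    proof (subst divide_le_eq_1_pos)
      show "0 < real (C * M)" using C_pos assms(2) by simp
      have "real_of_int (mass M es j) \<le> real_of_int (int (C * M))"
        using mass_le[OF assms(1) that, of M] by (simp only: of_int_le_iff)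
      then show "real_of_int (mass M es j) \<le> real (C * M)" by (simp only: of_int_of_nat_eq)
    qed
    then have "real (R * T) * (real_of_int (mass M es j) / real (C * M)) \<le> real (R * T) * 1"
      by (intro mult_left_mono) auto
    with code_bounds(1)[OF assms(1,2) that] have "real (code M es ! j) \<le> real (R * T)" by linarith
    then show ?thesis by (simp only: of_nat_le_iff less_Suc_eq_le)
  qed
  then have "set (code M es) \<subseteq> set [0..<Suc (R * T)]"
    using length_code[of M es] by (auto simp: in_set_conv_nth simp del: upt_Suc)
  moreover have "\<exists>j<m. T \<le> code M es ! j" using assms(3) by (auto simp: light_def not_less)
  moreover have "(\<Sum>j<m. code M es ! j) \<le> R * T"
  proof -
    have "real (\<Sum>j<m. code M es ! j) \<le> (\<Sum>j<m. real (R * T) * (real_of_int (mass M es j) / real (C * M)))"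
      unfolding of_nat_sum using code_bounds(1)[OF assms(1,2)] by (intro sum_mono) auto
    also have "\<dots> = real (R * T) * ((\<Sum>j<m. real_of_int (mass M es j)) / real (C * M))"
      by (simp only: sum_distrib_left sum_divide_distrib)
    also have "\<dots> \<le> real (R * T) * 1"
      using sum_mass_le[OF assms(1), of M] by (intro mult_left_mono) (auto simp: divide_le_eq_1)
    finally show ?thesis by (simp only: of_nat_le_iff mult_1_right)
  qed
  ultimately show ?thesis by (simp add: tys_def set_n_lists length_code del: upt_Suc)
qed

lemma tys_heavy: "code M es \<in> set tys \<Longrightarrow> \<not> light M es"
  by (auto simp: tys_def light_def not_less)

lemma distinct_tys: "distinct tys"
  unfolding tys_def by (intro distinct_filter distinct_n_lists distinct_upt)

definition tloss :: "real \<Rightarrow> nat list \<Rightarrow> real" where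
  "tloss k \<tau> = (\<Sum>j<m. real (\<tau> ! j) / real (R * T) * s k j)"

text \<open>For a light element, \<open>exp (- rloss)\<close> is the transform of a compound Poisson
  variable with the same masses; a product of such factors depends only on the summed
  masses.\<close>

definition sloss :: "real \<Rightarrow> nat \<Rightarrow> (rat \<times> rat) list \<Rightarrow> real" where
  "sloss k M es = (if light M es then 1 - exp (- rloss k M es) else tloss k (code M es))"

lemma tloss_bounds:
  assumes "dist_list es" "0 < M" "0 \<le> k"
  shows "0 \<le> tloss k (code M es)" "tloss k (code M es) \<le> rloss k M es"
proof -
  show "0 \<le> tloss k (code M es)" unfolding tloss_def using assms s_bounds by (intro sum_nonneg) auto
  show "tloss k (code M es) \<le> rloss k M es"
    unfolding tloss_def rloss_def
  proof (intro sum_mono mult_right_mono)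
    fix j assume "j \<in> {..<m}"
    then show "real (code M es ! j) / real (R * T) \<le> real_of_int (mass M es j) / real (C * M)"
      using code_bounds(1)[OF assms(1,2), of j] RT_pos
      by (simp only: divide_le_eq lessThan_iff mult.commute if_True)
  qed (use assms s_bounds in auto)
qed

lemma sloss_bounds:
  assumes "dist_list es" "0 < M" "0 \<le> k"
  shows "0 \<le> sloss k M es" "sloss k M es \<le> 1"
  using rloss_bounds[OF assms] tloss_bounds[OF assms] by (auto simp: sloss_def)

text \<open>A light element has \<open>rloss\<close> at most \<open>m / R \<le> \<delta>\<close>,
  and the Poisson form costs half its square. For a heavy one the rounding costs at most
  \<open>m / (R * T)\<close>, while one grid point alone gives a loss of at least
  \<open>1 / R\<close> times that of the first cell; so the absolute error is also a relative
  one.\<close>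

lemma rloss_sloss:
  assumes es: "dist_list es" and M: "0 < M" and k: "1 \<le> k"
  shows "\<bar>rloss k M es - sloss k M es\<bar> \<le> \<delta> * rloss k M es"
proof (cases "light M es")
  case True
  let ?z = "rloss k M es"
  have z: "0 \<le> ?z" using rloss_bounds[OF es M] k by simp
  have "?z \<le> (\<Sum>j<m. 1 / real R)"
    unfolding rloss_def
  proof (intro sum_mono)
    fix j assume j: "j \<in> {..<m}"
    let ?u = "real_of_int (mass M es j) / real (C * M)"
    have "real (code M es ! j) + 1 \<le> real T"
      using True j by (auto simp: light_def Suc_le_eq simp flip: of_nat_Suc)
    with code_bounds(2)[OF es M, of j] j have "real R * real T * ?u \<le> real T" by simp
    then have "real T * (real R * ?u) \<le> real T * 1" by (simp only: mult.commute mult.left_commute mult_1_right)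
    then have "real R * ?u \<le> 1" using T_pos by (simp only: mult_le_cancel_left_pos of_nat_0_less_iff)
    then have u: "?u \<le> 1 / real R" using R_pos by (simp only: le_divide_eq of_nat_0_less_iff if_True mult.commute)
    have "0 \<le> ?u" using mass_nonneg[OF es] by simp
    then have "?u * s k j \<le> ?u * 1" using s_bounds by (intro mult_left_mono) auto
    with u show "?u * s k j \<le> 1 / real R" by linarith
  qed
  also have "\<dots> \<le> \<delta>" using R_large R_pos by (simp add: m_def field_simps)
  finally have "?z * ?z \<le> \<delta> * ?z" using z by (intro mult_right_mono) auto
  moreover have "0 \<le> \<delta> * ?z" using z \<delta>_pos by simp
  ultimately have "?z\<^sup>2 / 2 \<le> \<delta> * ?z" by (simp add: power2_eq_square)
  then show ?thesis
    using True one_minus_exp_le[of ?z] one_minus_exp_ge[OF z] by (simp add: sloss_def)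
next
  case False
  then obtain j where j: "j < m" "T \<le> code M es ! j" by (auto simp: light_def not_less)
  let ?u = "\<lambda>j. real_of_int (mass M es j) / real (C * M)"
  let ?s0 = "1 - exp (- cell_val H 0)"
  have k0: "0 \<le> k" using k by simp
  have s0: "0 \<le> ?s0" by (simp add: cell_val_def)
  have "rloss k M es - tloss k (code M es) = (\<Sum>j<m. (?u j - real (code M es ! j) / real (R * T)) * s k j)"
    by (simp add: rloss_def tloss_def left_diff_distrib sum_subtractf)
  also have "\<dots> \<le> (\<Sum>j<m. 1 / real (R * T))"
  proof (intro sum_mono)
    fix j assume "j \<in> {..<m}"
    then have "real (R * T) * ?u j \<le> real (code M es ! j) + 1" using code_bounds(2)[OF es M] by blast
    then have "?u j \<le> (real (code M es ! j) + 1) / real (R * T)"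
      using RT_pos by (simp only: le_divide_eq if_True mult.commute)
    then have "?u j - real (code M es ! j) / real (R * T) \<le> 1 / real (R * T)"
      by (simp only: add_divide_distrib)
    then have "(?u j - real (code M es ! j) / real (R * T)) * s k j \<le> 1 / real (R * T) * s k j"
      using s_bounds k0 by (intro mult_right_mono) auto
    also have "\<dots> \<le> 1 / real (R * T) * 1" using s_bounds RT_pos by (intro mult_left_mono) auto
    finally show "(?u j - real (code M es ! j) / real (R * T)) * s k j \<le> 1 / real (R * T)" by simp
  qed
  also have "\<dots> = real m / real (R * T)" by simp
  also have "\<dots> \<le> (\<delta> * real T * ?s0) / real (R * T)"
    using T_large RT_pos by (intro divide_right_mono) (auto simp: m_def)
  also have "\<dots> = \<delta> * (real T / real (R * T) * ?s0)" by simp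
  also have "\<dots> \<le> \<delta> * rloss k M es"
  proof (intro mult_left_mono)
    have "real T / real (R * T) \<le> real (code M es ! j) / real (R * T)"
      using j by (intro divide_right_mono) auto
    also have "\<dots> \<le> ?u j"
      using code_bounds(1)[OF es M j(1)] RT_pos by (simp only: divide_le_eq if_True mult.commute)
    finally have "real T / real (R * T) * ?s0 \<le> ?u j * s k j"
      using s0 s_ge[OF k] mass_nonneg[OF es] by (intro mult_mono) auto
    also have "\<dots> \<le> rloss k M es"
      unfolding rloss_def using j s_bounds k0 mass_nonneg[OF es]
      by (intro member_le_sum) auto
    finally show "real T / real (R * T) * ?s0 \<le> rloss k M es" .
  qed (use \<delta>_pos in simp)
  finally show ?thesis using False tloss_bounds[OF es M k0] by (simp add: sloss_def)
qed

section \<open>Product over a set against product over dimensions\<close>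

lemma sum_coef: "(\<Sum>j<m. coef i j * s k j) =
    (if i < m then s k i / real C else tloss k (tys ! (i - m)))"
proof (cases "i < m")
  case True
  then have "(\<Sum>j<m. coef i j * s k j) = (\<Sum>j<m. if j = i then s k i / real C else 0)"
    by (intro sum.cong) (auto simp: coef_def)
  then show ?thesis using True by simp
qed (auto simp: coef_def tloss_def)

text \<open>This is exact: weights in these dimensions are \<open>0\<close> or \<open>M\<close>, so
  \<open>c\<close> counts the elements of each type, and a heavy element has exactly one type, a
  light one none.\<close>

lemma heavy_prod:
  assumes S: "finite S" and D: "\<And>b. b \<in> S \<Longrightarrow> dist_list (D b)" and M: "0 < M"
    and c: "\<And>i. m \<le> i \<Longrightarrow> i < d \<Longrightarrow> (\<Sum>b\<in>S. weight M (D b) i) = int (c i * M)"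
  shows "(\<Prod>b\<in>{b\<in>S. \<not> light M (D b)}. 1 - tloss k (code M (D b))) =
    (\<Prod>i=m..<d. (1 - tloss k (tys ! (i - m))) ^ c i)"
proof -
  have "(\<Prod>i=m..<d. (1 - tloss k (tys ! (i - m))) ^ c i) =
      (\<Prod>r<length tys. (1 - tloss k (tys ! r)) ^ c (r + m))"
    by (rule prod.reindex_bij_witness[of _ "\<lambda>r. r + m" "\<lambda>i. i - m"]) (auto simp: d_def)
  also have "\<dots> = (\<Prod>r<length tys. \<Prod>b\<in>S. if code M (D b) = tys ! r then 1 - tloss k (tys ! r) else 1)"
  proof (intro prod.cong refl)
    fix r assume r: "r \<in> {..<length tys}"
    have "int (c (r + m) * M) = (\<Sum>b\<in>S. weight M (D b) (r + m))"
      using r by (intro c[symmetric]) (auto simp: d_def)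
    also have "\<dots> = (\<Sum>b\<in>S. if code M (D b) = tys ! r then int M else 0)"
      by (simp add: weight_def)
    also have "\<dots> = int (card {b\<in>S. code M (D b) = tys ! r} * M)"
      using S by (simp add: sum.If_cases Int_def)
    finally have "c (r + m) * M = card {b\<in>S. code M (D b) = tys ! r} * M"
      by (simp only: of_nat_eq_iff)
    then have "c (r + m) = card {b\<in>S. code M (D b) = tys ! r}" using M by simp
    then show "(1 - tloss k (tys ! r)) ^ c (r + m) =
        (\<Prod>b\<in>S. if code M (D b) = tys ! r then 1 - tloss k (tys ! r) else 1)"
      using S by (simp add: prod.If_cases Int_def)
  qed
  also have "\<dots> = (\<Prod>b\<in>S. \<Prod>r<length tys. if code M (D b) = tys ! r then 1 - tloss k (tys ! r) else 1)"
    by (rule prod.swap)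
  also have "\<dots> = (\<Prod>b\<in>S. if \<not> light M (D b) then 1 - tloss k (code M (D b)) else 1)"
  proof (intro prod.cong refl)
    fix b assume b: "b \<in> S"
    show "(\<Prod>r<length tys. if code M (D b) = tys ! r then 1 - tloss k (tys ! r) else 1) =
        (if \<not> light M (D b) then 1 - tloss k (code M (D b)) else 1)"
    proof (cases "light M (D b)")
      case True
      then have "code M (D b) \<noteq> tys ! r" if "r < length tys" for r
        using that tys_heavy[of M "D b"] by auto
      with True show ?thesis by (auto intro: prod.neutral)
    next
      case False
      then obtain r where r: "r < length tys" "tys ! r = code M (D b)"
        using heavy_in_tys[OF D[OF b] M] by (auto simp: in_set_conv_nth)
      have "(\<Prod>r'<length tys. if code M (D b) = tys ! r' then 1 - tloss k (tys ! r') else 1) =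
          (\<Prod>r'<length tys. if r' = r then 1 - tloss k (tys ! r) else 1)"
        using distinct_tys r by (intro prod.cong) (auto simp: nth_eq_iff_index_eq simp flip: r(2))
      with False r show ?thesis by simp
    qed
  qed
  also have "\<dots> = (\<Prod>b\<in>{b\<in>S. \<not> light M (D b)}. 1 - tloss k (code M (D b)))"
    using S by (simp add: prod.If_cases Int_def)
  finally show ?thesis by simp
qed

text \<open>Rounding the total mass at each of the \<open>m\<close> grid points to units of
  \<open>1 / C\<close> changes the exponent by at most \<open>m / C\<close>. Replacing
  \<open>exp (- (s k i / C))\<close> by \<open>1 - s k i / C\<close> in every copy is a relative
  error of \<open>1 / C\<close> per loss, hence costs \<open>1 / C\<close> in all, whatever the
  counts.\<close>

lemma light_prod:
  assumes S: "finite S" and D: "\<And>b. b \<in> S \<Longrightarrow> dist_list (D b)" and M: "0 < M" and k: "0 \<le> k"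
    and c: "\<And>i. i < m \<Longrightarrow> \<bar>(\<Sum>b\<in>S. weight M (D b) i) - int (c i * M)\<bar> \<le> int M"
  shows "\<bar>(\<Prod>b\<in>{b\<in>S. light M (D b)}. exp (- rloss k M (D b))) - (\<Prod>i<m. (1 - s k i / real C) ^ c i)\<bar>
    \<le> (real m + 1) / real C"
proof -
  define W where "W i = (\<Sum>b\<in>S. weight M (D b) i)" for i
  have CM: "0 < real (C * M)" using C_pos M by simp
  have W: "W i = (\<Sum>b\<in>{b\<in>S. light M (D b)}. mass M (D b) i)" if "i < m" for i
    using that S by (simp add: W_def weight_def sum.If_cases Int_def)
  have W0: "0 \<le> W i" if "i < m" for i
    unfolding W[OF that] using D mass_nonneg by (intro sum_nonneg) auto
  define a b where "a = (\<Sum>i<m. real_of_int (W i) / real (C * M) * s k i)"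
    and "b = (\<Sum>i<m. real (c i) / real C * s k i)"
  have "(\<Sum>b\<in>{b\<in>S. light M (D b)}. rloss k M (D b)) = a"
    unfolding rloss_def a_def
    by (subst sum.swap) (simp add: W of_int_sum sum_divide_distrib sum_distrib_right)
  then have A: "(\<Prod>b\<in>{b\<in>S. light M (D b)}. exp (- rloss k M (D b))) = exp (- a)"
    using S by (simp add: exp_sum sum_negf flip: exp_sum)
  have "\<bar>exp (- a) - exp (- b)\<bar> \<le> \<bar>a - b\<bar>"
    unfolding a_def b_def using W0 s_bounds k by (intro exp_neg_diff_le sum_nonneg) auto
  also have "\<dots> \<le> (\<Sum>i<m. \<bar>(real_of_int (W i) / real (C * M) - real (c i) / real C) * s k i\<bar>)"
    unfolding a_def b_def sum_subtractf[symmetric] left_diff_distrib[symmetric] by (rule sum_abs)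
  also have "\<dots> \<le> (\<Sum>i<m. 1 / real C)"
  proof (intro sum_mono)
    fix i assume "i \<in> {..<m}"
    then have "\<bar>W i - int (c i * M)\<bar> \<le> int M" using c by (auto simp: W_def)
    then have "real_of_int \<bar>W i - int (c i * M)\<bar> \<le> real_of_int (int M)" by (simp only: of_int_le_iff)
    then have "\<bar>real_of_int (W i) - real (c i) * real M\<bar> \<le> real M" by simp
    then have "\<bar>real_of_int (W i) - real (c i) * real M\<bar> / real (C * M) \<le> real M / real (C * M)"
      by (intro divide_right_mono) auto
    also have "\<dots> = 1 / real C" using M by simp
    also have "\<bar>real_of_int (W i) - real (c i) * real M\<bar> / real (C * M) =
        \<bar>(real_of_int (W i) - real (c i) * real M) / real (C * M)\<bar>"
      by (simp only: abs_divide abs_of_nat)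
    also have "(real_of_int (W i) - real (c i) * real M) / real (C * M) =
        real_of_int (W i) / real (C * M) - real (c i) / real C"
      using M by (simp add: diff_divide_distrib)
    finally have "\<bar>real_of_int (W i) / real (C * M) - real (c i) / real C\<bar> \<le> 1 / real C" .
    then have "\<bar>real_of_int (W i) / real (C * M) - real (c i) / real C\<bar> * \<bar>s k i\<bar> \<le> 1 / real C * 1"
      using s_bounds[of k i] k by (intro mult_mono) auto
    then show "\<bar>(real_of_int (W i) / real (C * M) - real (c i) / real C) * s k i\<bar> \<le> 1 / real C"
      by (simp only: abs_mult mult_1_right)
  qed
  also have "\<dots> = real m / real C" by simp
  finally have AB: "\<bar>exp (- a) - exp (- b)\<bar> \<le> real m / real C" .
  \<comment> \<open>One index per copy, because \<open>prod_one_minus_close\<close> compares single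
    factors and not powers.\<close>
  let ?I = "Sigma {..<m} (\<lambda>i. {..<c i})"
  have C1: "1 / real C \<le> 1" using C_pos by simp
  have x: "0 \<le> s k i / real C" "s k i / real C \<le> 1 / real C" for i
    using s_bounds[of k i] k C_pos by (auto simp: divide_right_mono)
  have "\<bar>(\<Prod>q\<in>?I. 1 - s k (fst q) / real C) - (\<Prod>q\<in>?I. 1 - (1 - exp (- (s k (fst q) / real C))))\<bar>
      \<le> 1 / real C + (\<Sum>q\<in>?I. 0)"
  proof (rule prod_one_minus_close)
    fix q assume "q \<in> ?I"
    let ?x = "s k (fst q) / real C"
    note xq = x[of "fst q"]
    show "0 \<le> ?x \<and> ?x \<le> 1 \<and> 0 \<le> 1 - exp (- ?x) \<and> 1 - exp (- ?x) \<le> 1 \<and> 0 \<le> (0::real)"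
      using order.trans[OF xq(2) C1] xq(1) by (auto simp del: divide_le_eq_1)
    have "?x * ?x \<le> 1 / real C * ?x" using xq by (intro mult_right_mono) auto
    moreover have "0 \<le> 1 / real C * ?x" by (intro mult_nonneg_nonneg xq(1)) simp
    moreover have "a / 2 \<le> b" if "a \<le> b" "0 \<le> b" for a b :: real
      using that by linarith
    ultimately have "?x\<^sup>2 / 2 \<le> 1 / real C * ?x" unfolding power2_eq_square by blast
    then show "\<bar>?x - (1 - exp (- ?x))\<bar> \<le> 1 / real C * ?x + 0"
      using one_minus_exp_le[of ?x] one_minus_exp_ge[OF xq(1)] by linarith
  qed auto
  moreover have "(\<Prod>q\<in>?I. 1 - s k (fst q) / real C) = (\<Prod>i<m. (1 - s k i / real C) ^ c i)"
    by (subst prod.Sigma[symmetric, where g = "\<lambda>i _. 1 - s k i / real C", simplified case_prod_beta']) auto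
  moreover have "(\<Prod>q\<in>?I. 1 - (1 - exp (- (s k (fst q) / real C)))) = exp (- b)"
  proof -
    have "(\<Prod>q\<in>?I. 1 - (1 - exp (- (s k (fst q) / real C)))) = exp (\<Sum>q\<in>?I. - (s k (fst q) / real C))"
      by (subst exp_sum) auto
    also have "(\<Sum>q\<in>?I. - (s k (fst q) / real C)) = - b"
      by (subst sum.Sigma[symmetric, where g = "\<lambda>i _. - (s k i / real C)", simplified case_prod_beta'])
         (auto simp: b_def sum_negf)
    finally show ?thesis .
  qed
  ultimately have "\<bar>(\<Prod>i<m. (1 - s k i / real C) ^ c i) - exp (- b)\<bar> \<le> 1 / real C" by simp
  with AB show ?thesis unfolding A add_divide_distrib by linarith
qed

text \<open>One \<open>\<delta>\<close> pays for rounding the values and one for types and Poisson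
  form. The third, by \<open>C_large\<close>, pays for the floors, which cost \<open>1 / C\<close>,
  and for \<open>light_prod\<close>, which costs \<open>(m + 1) / C\<close>.\<close>

lemma laplace_approx:
  assumes S: "finite S" and D: "\<And>b. b \<in> S \<Longrightarrow> dist_list (D b)" and M: "0 < M"
    and len: "(\<Sum>b\<in>S. length (D b)) \<le> M" and k: "1 \<le> k" "k \<le> real K"
    and light: "\<And>i. i < m \<Longrightarrow> \<bar>(\<Sum>b\<in>S. weight M (D b) i) - int (c i * M)\<bar> \<le> int M"
    and heavy: "\<And>i. m \<le> i \<Longrightarrow> i < d \<Longrightarrow> (\<Sum>b\<in>S. weight M (D b) i) = int (c i * M)"
  shows "\<bar>(\<Prod>b\<in>S. 1 - loss k (D b)) - (\<Prod>i<d. (1 - (\<Sum>j<m. coef i j * s k j)) ^ c i)\<bar> \<le> 3 * \<delta>"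
proof -
  have k0: "0 \<le> k" using k by simp
  have 1: "\<bar>(\<Prod>b\<in>S. 1 - loss k (D b)) - (\<Prod>b\<in>S. 1 - rloss k M (D b))\<bar> \<le>
      \<delta> + (\<Sum>b\<in>S. real (length (D b)) / real (C * M))"
    using S \<delta>_pos D loss_bounds rloss_bounds M k0 k
    by (intro prod_one_minus_close loss_rloss) auto
  have "(\<Sum>b\<in>S. real (length (D b)) / real (C * M)) = real (\<Sum>b\<in>S. length (D b)) / real (C * M)"
    by (simp add: sum_divide_distrib)
  also have "\<dots> \<le> real M / real (C * M)" using len by (intro divide_right_mono) (simp_all only: of_nat_le_iff of_nat_0_le_iff)
  also have "\<dots> = 1 / real C" using M by simp
  finally have 1: "\<bar>(\<Prod>b\<in>S. 1 - loss k (D b)) - (\<Prod>b\<in>S. 1 - rloss k M (D b))\<bar> \<le> \<delta> + 1 / real C"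
    using 1 by linarith
  have 2: "\<bar>(\<Prod>b\<in>S. 1 - rloss k M (D b)) - (\<Prod>b\<in>S. 1 - sloss k M (D b))\<bar> \<le> \<delta> + (\<Sum>b\<in>S. 0)"
    using S \<delta>_pos D sloss_bounds rloss_bounds rloss_sloss M k0 k
    by (intro prod_one_minus_close) auto
  have "(\<Prod>b\<in>S. 1 - sloss k M (D b)) =
      (\<Prod>b\<in>S. if light M (D b) then exp (- rloss k M (D b)) else 1 - tloss k (code M (D b)))"
    by (intro prod.cong) (auto simp: sloss_def)
  also have "\<dots> = (\<Prod>b\<in>{b\<in>S. light M (D b)}. exp (- rloss k M (D b))) *
      (\<Prod>b\<in>{b\<in>S. \<not> light M (D b)}. 1 - tloss k (code M (D b)))"
    using S by (simp add: prod.If_cases Int_def)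
  finally have S3: "(\<Prod>b\<in>S. 1 - sloss k M (D b)) = \<dots>" .
  define P Q B where "P = (\<Prod>b\<in>{b\<in>S. light M (D b)}. exp (- rloss k M (D b)))"
    and "Q = (\<Prod>b\<in>{b\<in>S. \<not> light M (D b)}. 1 - tloss k (code M (D b)))"
    and "B = (\<Prod>i<m. (1 - s k i / real C) ^ c i)"
  have Q: "0 \<le> Q" "Q \<le> 1"
  proof -
    have "0 \<le> 1 - tloss k (code M (D b))" "1 - tloss k (code M (D b)) \<le> 1" if "b \<in> S" for b
      using tloss_bounds[OF D[OF that] M k0] rloss_bounds[OF D[OF that] M k0] by auto
    then show "0 \<le> Q" "Q \<le> 1" unfolding Q_def by (auto intro!: prod_nonneg prod_le_1)
  qed
  have "{..<d} = {..<m} \<union> {m..<d}" by (auto simp: d_def)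
  then have "(\<Prod>i<d. (1 - (\<Sum>j<m. coef i j * s k j)) ^ c i) =
      (\<Prod>i<m. (1 - (\<Sum>j<m. coef i j * s k j)) ^ c i) * (\<Prod>i=m..<d. (1 - (\<Sum>j<m. coef i j * s k j)) ^ c i)"
    using prod.union_disjoint[of "{..<m}" "{m..<d}"] by (simp add: ivl_disj_int)
  also have "\<dots> = B * (\<Prod>i=m..<d. (1 - tloss k (tys ! (i - m))) ^ c i)"
    unfolding B_def by (intro arg_cong2[where f = "(*)"] prod.cong) (auto simp: sum_coef)
  also have "\<dots> = B * Q" unfolding Q_def by (simp add: heavy_prod[OF S D M heavy])
  finally have "\<bar>(\<Prod>b\<in>S. 1 - sloss k M (D b)) - (\<Prod>i<d. (1 - (\<Sum>j<m. coef i j * s k j)) ^ c i)\<bar> =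
      \<bar>(P - B) * Q\<bar>"
    unfolding S3 P_def Q_def by (simp add: algebra_simps)
  also have "\<dots> \<le> \<bar>P - B\<bar> * 1" unfolding abs_mult using Q by (intro mult_left_mono) auto
  also have "\<dots> \<le> (real m + 1) / real C"
    unfolding P_def B_def using light_prod[OF S D M k0 light] by simp
  finally have 3: "\<bar>(\<Prod>b\<in>S. 1 - sloss k M (D b)) - (\<Prod>i<d. (1 - (\<Sum>j<m. coef i j * s k j)) ^ c i)\<bar>
      \<le> (real m + 1) / real C" .
  have "(real m + 1) / real C + 1 / real C \<le> \<delta>"
    using C_large C_pos by (simp add: m_def field_simps)
  with 1 2 3 show ?thesis by simp
qed

lemma coef_subprob:
  assumes "i < d"
  shows "subprob m (coef i)"
proof (cases "i < m")
  case True
  have "(\<Sum>j<m. coef i j) = (\<Sum>j<m. if j = i then 1 / real C else 0)"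
    using True by (intro sum.cong) (auto simp: coef_def)
  then show ?thesis using True C_pos by (auto simp: subprob_def coef_def)
next
  case False
  define \<tau> where "\<tau> = tys ! (i - m)"
  have "\<tau> \<in> set tys" unfolding \<tau>_def using assms False by (intro nth_mem) (auto simp: d_def)
  then have "(\<Sum>j<m. \<tau> ! j) \<le> R * T" by (auto simp: tys_def)
  then have "real (\<Sum>j<m. \<tau> ! j) \<le> real (R * T)" by (simp only: of_nat_le_iff)
  then have "(\<Sum>j<m. real (\<tau> ! j)) / real (R * T) \<le> 1"
    using RT_pos by (simp only: divide_le_eq_1_pos of_nat_sum)
  moreover have "(\<Sum>j<m. coef i j) = (\<Sum>j<m. real (\<tau> ! j)) / real (R * T)"
    using False by (simp add: coef_def \<tau>_def sum_divide_distrib)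
  ultimately show ?thesis using False by (auto simp: subprob_def coef_def)
qed

text \<open>Every dimension has mass at a positive grid point, a type because one of its levels is
  at least \<open>T\<close>. So the surrogate decays when any single count grows.\<close>

lemma coef_loss_pos:
  assumes "i < d"
  shows "0 < (\<Sum>j<m. coef i j * s 1 j)"
proof -
  have s: "0 < s 1 j" for j using H_pos by (simp add: s_def cell_val_def)
  obtain j where "j < m" "0 < coef i j"
  proof (cases "i < m")
    case True
    then show thesis using that[of i] C_pos by (simp add: coef_def)
  next
    case False
    define \<tau> where "\<tau> = tys ! (i - m)"
    have "\<tau> \<in> set tys" unfolding \<tau>_def using assms False by (intro nth_mem) (auto simp: d_def)
    then obtain j where "j < m" "T \<le> \<tau> ! j" by (auto simp: tys_def)
    then show thesis using that[of j] False T_pos R_pos by (simp add: coef_def \<tau>_def)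
  qed
  then show ?thesis
    using coef_subprob[OF assms] s
    by (intro sum_pos2[of _ j] mult_pos_pos mult_nonneg_nonneg s_bounds) (auto simp: subprob_def)
qed

end

section \<open>The algorithm\<close>

lemma ptime_length: "ptime I (\<lambda>q. enc_list (xs q)) (\<lambda>q. Num (int (length (xs q))))"
  using ptime_sum[where a = "\<lambda>_ _. 1", OF ptime_id ptime_const[of _ _ "Num 0"]]
  by (simp add: ptime_const case_prod_unfold)

lemma ptime_eq:
  assumes "ptime I f (\<lambda>q. Num (a q))" "ptime I f (\<lambda>q. Num (b q))"
  shows "ptime I f (\<lambda>q. Num (if a q = b q then 1 else 0))"
proof (rule ptime_cong[OF ptime_if_nonzero[OF ptime_minus[OF assms]]])
  show "ptime {q \<in> I. a q - b q \<noteq> 0} f (\<lambda>_. Num 0)" "ptime {q \<in> I. a q - b q = 0} f (\<lambda>_. Num 1)"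
    by (rule ptime_const)+
qed auto

lemma ptime_all:
  fixes n :: nat
  assumes "\<And>j. j < n \<Longrightarrow> ptime I f (\<lambda>q. Num (if P q j then 1 else 0))"
  shows "ptime I f (\<lambda>q. Num (if \<forall>j<n. P q j then 1 else 0))"
  using assms
proof (induction n)
  case (Suc n)
  have "ptime I f (\<lambda>q. Num ((if \<forall>j<n. P q j then 1 else 0) * (if P q n then 1 else 0)))"
    using Suc by (intro ptime_times) auto
  then show ?case by (rule ptime_cong) (auto simp: less_Suc_eq)
qed (auto intro: ptime_const)

definition enc_dist :: "(rat \<times> rat) list \<Rightarrow> data" where
  "enc_dist es = enc_list (map (\<lambda>e. Cell (enc_rat (fst e)) (enc_rat (snd e))) es)"

lemma of_rat_quotient:
  "real_of_rat r = real_of_int (fst (quotient_of r)) / real_of_int (snd (quotient_of r))"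
proof -
  have "r = of_int (fst (quotient_of r)) / of_int (snd (quotient_of r))"
    by (rule quotient_of_div) simp
  from arg_cong[OF this, of real_of_rat] show ?thesis by (simp add: of_rat_divide)
qed

lemma ptime_length_dist: "ptime I (\<lambda>q. enc_dist (D q)) (\<lambda>q. Num (int (length (D q))))"
  using ptime_length[of I "\<lambda>q. map (\<lambda>e. Cell (enc_rat (fst e)) (enc_rat (snd e))) (D q)"]
  by (simp add: enc_dist_def)

section \<open>Computing the weights in integer arithmetic\<close>

context rounding
begin

text \<open>The machine has integers only, so the floor of a rational is the quotient of its
  numerator and denominator.\<close>

definition grid_index :: "rat \<Rightarrow> int" where
  "grid_index v = (int H * fst (quotient_of v)) div snd (quotient_of v)"

lemma grid_index:
  assumes "0 \<le> v"
  shows "\<lfloor>real H * real_of_rat v\<rfloor> = grid_index v" "0 \<le> grid_index v"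
    "cell H Y (real_of_rat v) = min (nat (grid_index v)) Y"
proof -
  have "real H * real_of_rat v =
      real_of_int (int H * fst (quotient_of v)) / real_of_int (snd (quotient_of v))"
    by (simp add: of_rat_quotient)
  then show *: "\<lfloor>real H * real_of_rat v\<rfloor> = grid_index v"
    by (simp only: floor_divide_of_int_eq grid_index_def)
  have "0 \<le> \<lfloor>real H * real_of_rat v\<rfloor>" using assms by simp
  then show "0 \<le> grid_index v" using * by simp
  show "cell H Y (real_of_rat v) = min (nat (grid_index v)) Y"
    by (simp add: cell_def *)
qed

text \<open>\<open>j\<close> is a constant of the program, so only the test on
  \<open>grid_index\<close> happens at run time. In the last cell the fraction is \<open>1\<close>
  and the value drops out of the quotient.\<close>

lemma share_eq:
  assumes e: "0 \<le> v"
  shows "share M j (v, p) =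
    (if j < Y then
      if grid_index v = int j then
        (int C * int M * fst (quotient_of p) * int H * fst (quotient_of v)) div
          (snd (quotient_of p) * snd (quotient_of v) * int (Suc j))
      else 0
    else if j = Y then
      if grid_index v < int Y then 0 else (int C * int M * fst (quotient_of p)) div snd (quotient_of p)
    else 0)"
proof -
  note g = grid_index[OF e]
  consider "j < Y" | "j = Y" | "Y < j" by linarith
  then show ?thesis
  proof cases
    case 1
    show ?thesis
    proof (cases "grid_index v = int j")
      case True
      then have c: "cell H Y (real_of_rat v) = j" using 1 by (simp add: g(3))
      have f: "cell_frac H Y (real_of_rat v) = real_of_rat v * real H / real (Suc j)"
        using 1 by (simp add: cell_frac_def c cell_val_def)
      have "real (C * M) * (real_of_rat p * cell_frac H Y (real_of_rat v)) =
          real_of_int (int C * int M * fst (quotient_of p) * int H * fst (quotient_of v)) /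
          real_of_int (snd (quotient_of p) * snd (quotient_of v) * int (Suc j))"
        unfolding f unfolding of_rat_quotient by (simp add: field_simps)
      then show ?thesis using 1 True c
        by (simp only: share_def fst_conv snd_conv floor_divide_of_int_eq if_True simp_thms)
    next
      case False
      then have "cell H Y (real_of_rat v) \<noteq> j" using 1 g by (auto simp: min_def)
      then show ?thesis using 1 False by (simp add: share_def)
    qed
  next
    case 2
    show ?thesis
    proof (cases "grid_index v < int Y")
      case True
      then have "cell H Y (real_of_rat v) \<noteq> j" using 2 g by (auto simp: min_def)
      then show ?thesis using 2 True by (simp add: share_def)
    next
      case False
      then have c: "cell H Y (real_of_rat v) = Y" using 2 g by (auto simp: min_def)
      then have f: "cell_frac H Y (real_of_rat v) = 1" by (simp add: cell_frac_def)
      have "real (C * M) * (real_of_rat p * cell_frac H Y (real_of_rat v)) =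
          real_of_int (int C * int M * fst (quotient_of p)) / real_of_int (snd (quotient_of p))"
        unfolding f unfolding of_rat_quotient by simp
      then show ?thesis using 2 False c
        by (simp only: share_def fst_conv snd_conv floor_divide_of_int_eq if_True if_False less_irrefl)
    qed
  next
    case 3
    then have "cell H Y (real_of_rat v) \<noteq> j" using cell_less_m[of "real_of_rat v"] by (simp add: m_def)
    then show ?thesis using 3 by (simp add: share_def)
  qed
qed

lemma ptime_share:
  assumes "\<And>q. q \<in> I \<Longrightarrow> 0 \<le> v q"
  shows "ptime I (\<lambda>q. Cell (Cell (enc_rat (v q)) (enc_rat (p q))) (Num (int (M q))))
    (\<lambda>q. Num (share (M q) j (v q, p q)))"
proof -
  let ?f = "\<lambda>q. Cell (Cell (enc_rat (v q)) (enc_rat (p q))) (Num (int (M q)))"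
  have e: "ptime J ?f (\<lambda>q. Cell (enc_rat (v q)) (enc_rat (p q)))" for J by (rule ptime_fst_base)
  note v = ptime_fst[OF e, unfolded enc_rat_def] and p = ptime_snd[OF e, unfolded enc_rat_def]
  note n = ptime_fst[OF v, folded enc_rat_def] ptime_snd[OF v, folded enc_rat_def]
    ptime_fst[OF p, folded enc_rat_def] ptime_snd[OF p, folded enc_rat_def] ptime_snd_base[of I]
  have M: "ptime J ?f (\<lambda>q. Num (int (M q)))" for J by (rule ptime_snd_base)
  have g: "ptime J ?f (\<lambda>q. Num (grid_index (v q)))" for J
    unfolding grid_index_def by (intro ptime_div ptime_times ptime_const n)
  have a: "ptime J ?f (\<lambda>q. Num ((int C * int (M q) * fst (quotient_of (p q)) * int H * fst (quotient_of (v q))) div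
          (snd (quotient_of (p q)) * snd (quotient_of (v q)) * int (Suc j))))" for J
    by (intro ptime_div ptime_times ptime_const n M)
  have b: "ptime J ?f (\<lambda>q. Num ((int C * int (M q) * fst (quotient_of (p q))) div snd (quotient_of (p q))))" for J
    by (intro ptime_div ptime_times ptime_const n M)
  consider "j < Y" | "j = Y" | "Y < j" by linarith
  then show ?thesis
  proof cases
    case 1
    have "ptime I ?f (\<lambda>q. if grid_index (v q) = int j then Num ((int C * int (M q) * fst (quotient_of (p q)) * int H * fst (quotient_of (v q))) div
          (snd (quotient_of (p q)) * snd (quotient_of (v q)) * int (Suc j))) else Num 0)"
      by (intro ptime_if ptime_eq g a ptime_const)
    then show ?thesis by (rule ptime_cong) (use 1 assms in \<open>auto simp: share_eq\<close>)
  next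
    case 2
    have "ptime I ?f (\<lambda>q. if grid_index (v q) < int Y then Num 0 else Num ((int C * int (M q) * fst (quotient_of (p q))) div snd (quotient_of (p q))))"
      by (intro ptime_if ptime_less g b ptime_const)
    then show ?thesis by (rule ptime_cong) (use 2 assms in \<open>auto simp: share_eq\<close>)
  next
    case 3
    then show ?thesis using ptime_const[of I ?f "Num 0"] assms by (auto simp: share_eq elim!: ptime_cong)
  qed
qed

lemma ptime_mass:
  assumes "\<And>q. q \<in> I \<Longrightarrow> dist_list (D q)"
  shows "ptime I (\<lambda>q. Cell (enc_dist (D q)) (Num (int (M q)))) (\<lambda>q. Num (mass (M q) (D q) j))"
proof -
  let ?xs = "\<lambda>q. map (\<lambda>e. Cell (enc_rat (fst e)) (enc_rat (snd e))) (D q)"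
  have "ptime I (\<lambda>q. Cell (enc_dist (D q)) (Num (int (M q))))
      (\<lambda>q. Num (\<Sum>i<length (?xs q). share (M q) j (D q ! i)))"
  proof (rule ptime_sum[where ctx = "\<lambda>q. Num (int (M q))"])
    show "ptime I (\<lambda>q. Cell (enc_dist (D q)) (Num (int (M q)))) (\<lambda>q. enc_list (?xs q))"
      unfolding enc_dist_def by (rule ptime_fst_base)
    show "ptime I (\<lambda>q. Cell (enc_dist (D q)) (Num (int (M q)))) (\<lambda>q. Num (int (M q)))"
      by (rule ptime_snd_base)
    let ?J = "{(q, i). q \<in> I \<and> i < length (?xs q)}"
    have "ptime ?J (\<lambda>x. Cell (Cell (enc_rat (fst (D (fst x) ! snd x))) (enc_rat (snd (D (fst x) ! snd x)))) (Num (int (M (fst x)))))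
        (\<lambda>x. Num (share (M (fst x)) j (fst (D (fst x) ! snd x), snd (D (fst x) ! snd x))))"
      by (rule ptime_share) (use assms in \<open>auto simp: dist_list_def\<close>)
    then show "ptime ?J (\<lambda>(q, i). Cell (?xs q ! i) (Num (int (M q)))) (\<lambda>(q, i). Num (share (M q) j (D q ! i)))"
      by (rule ptime_cong) auto
  qed
  then show ?thesis by (simp add: mass_def)
qed

lemma ptime_weight:
  assumes D: "\<And>q. q \<in> I \<Longrightarrow> dist_list (D q)" and M: "\<And>q. q \<in> I \<Longrightarrow> 0 < M q" and i: "i < d"
  shows "ptime I (\<lambda>q. Cell (enc_dist (D q)) (Num (int (M q)))) (\<lambda>q. Num (weight (M q) (D q) i))"
proof -
  let ?f = "\<lambda>q. Cell (enc_dist (D q)) (Num (int (M q)))"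
  let ?c = "\<lambda>q j. (int (R * T) * mass (M q) (D q) j) div (int C * int (M q))"
  have mass: "ptime J ?f (\<lambda>q. Num (mass (M q) (D q) j))" if "J \<subseteq> I" for J j
    by (rule ptime_mass) (use that D in auto)
  have c: "ptime I ?f (\<lambda>q. Num (?c q j))" for j
    by (intro ptime_div ptime_times ptime_const mass order.refl ptime_snd_base)
  have code: "int (code (M q) (D q) ! j) = ?c q j" if "q \<in> I" "j < m" for q j
  proof -
    have "0 \<le> int (R * T) * mass (M q) (D q) j" using mass_nonneg[OF D[OF that(1)]] by simp
    moreover have "0 < int C * int (M q)" using C_pos M[OF that(1)] by simp
    ultimately have "0 \<le> ?c q j" by (simp only: pos_imp_zdiv_nonneg_iff)
    then show ?thesis using that by (simp add: code_nth)
  qed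
  show ?thesis
  proof (cases "i < m")
    case True
    have "ptime I ?f (\<lambda>q. Num (if \<forall>j<m. ?c q j < int T then 1 else 0))"
      by (intro ptime_all ptime_less c ptime_const)
    then have "ptime I ?f (\<lambda>q. Num (if light (M q) (D q) then 1 else 0))"
    proof (rule ptime_cong)
      fix q assume q: "q \<in> I"
      have "(\<forall>j<m. ?c q j < int T) \<longleftrightarrow> light (M q) (D q)"
        unfolding light_def using code[OF q] by (metis of_nat_less_iff)
      then show "Num (if \<forall>j<m. ?c q j < int T then 1 else 0) = Num (if light (M q) (D q) then 1 else 0)"
        by simp
    qed simp
    then have "ptime I ?f (\<lambda>q. if light (M q) (D q) then Num (mass (M q) (D q) i) else Num 0)"
      by (intro ptime_if ptime_const mass) auto
    then show ?thesis by (rule ptime_cong) (use True in \<open>auto simp: weight_def\<close>)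
  next
    case False
    let ?\<tau> = "tys ! (i - m)"
    have "?\<tau> \<in> set tys" using i False by (intro nth_mem) (auto simp: d_def)
    then have len: "length ?\<tau> = m" by (auto simp: tys_def set_n_lists)
    have "ptime I ?f (\<lambda>q. Num (if \<forall>j<m. ?c q j = int (?\<tau> ! j) then 1 else 0))"
      by (intro ptime_all ptime_eq c ptime_const)
    then have "ptime I ?f (\<lambda>q. Num (if code (M q) (D q) = ?\<tau> then 1 else 0))"
    proof (rule ptime_cong)
      fix q assume q: "q \<in> I"
      have "(\<forall>j<m. ?c q j = int (?\<tau> ! j)) \<longleftrightarrow> code (M q) (D q) = ?\<tau>"
        unfolding list_eq_iff_nth_eq length_code len using code[OF q] by (metis of_nat_eq_iff)
      then show "Num (if \<forall>j<m. ?c q j = int (?\<tau> ! j) then 1 else 0) =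
          Num (if code (M q) (D q) = ?\<tau> then 1 else 0)" by simp
    qed simp
    then have "ptime I ?f (\<lambda>q. if code (M q) (D q) = ?\<tau> then Num (int (M q)) else Num 0)"
      by (intro ptime_if ptime_const ptime_snd_base)
    then show ?thesis by (rule ptime_cong) (use False in \<open>auto simp: weight_def\<close>)
  qed
qed

end

text \<open>\<open>Suc\<close> keeps the scale \<open>M\<close> positive for an empty ground
  set.\<close>

definition entry_bound :: "comb_problem \<Rightarrow> data \<times> (nat \<Rightarrow> (rat \<times> rat) list) \<Rightarrow> nat" where
  "entry_bound A q = Suc (\<Sum>b<ground_size A (fst q). length (snd q b))"

lemma enc_eum_eq:
  "enc_eum A q = Cell (fst q) (enc_list (map (\<lambda>b. enc_dist (snd q b)) [0..<ground_size A (fst q)]))"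
  by (simp add: enc_eum_def enc_dist_def case_prod_beta')

lemma dist_list_eum_inputs:
  assumes "q \<in> eum_inputs A" "b < ground_size A (fst q)"
  shows "dist_list (snd q b)"
proof -
  let ?es = "snd q b"
  have wf: "pmf_of_list_wf (weight_list ?es)" "\<forall>e\<in>set ?es. 0 \<le> fst e"
    using assms by (auto simp: eum_inputs_def case_prod_beta')
  have "map snd (weight_list ?es) = map (\<lambda>e. real_of_rat (snd e)) ?es"
    by (simp add: weight_list_def case_prod_beta')
  with wf have "\<forall>e\<in>set ?es. 0 \<le> real_of_rat (snd e)" "sum_list (map (\<lambda>e. real_of_rat (snd e)) ?es) = 1"
    unfolding pmf_of_list_wf_def by auto
  then show ?thesis
    using wf(2) by (simp add: dist_list_def sum_list_sum_nth atLeast0LessThan)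
qed

lemma ptime_entry_bound:
  "ptime (eum_inputs A) (enc_eum A) (\<lambda>q. Num (int (entry_bound A q)))"
proof -
  let ?I = "eum_inputs A"
  let ?xs = "\<lambda>q. map (\<lambda>b. enc_dist (snd q b)) [0..<ground_size A (fst q)]"
  have 1: "ptime ?I (enc_eum A) (\<lambda>q. enc_list (?xs q))"
    unfolding enc_eum_eq by (rule ptime_snd_base)
  have "ptime ?I (enc_eum A) (\<lambda>q. Num (\<Sum>b<length (?xs q). int (length (snd q b))))"
  proof (rule ptime_sum[OF 1 ptime_const[of _ _ "Num 0"]])
    let ?J = "{(q, i). q \<in> ?I \<and> i < length (?xs q)}"
    have "ptime ?J (\<lambda>x. Cell (enc_dist (snd (fst x) (snd x))) (Num 0)) (\<lambda>x. enc_dist (snd (fst x) (snd x)))"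
      by (rule ptime_fst_base)
    from ptime_comp[OF this ptime_length_dist]
    show "ptime ?J (\<lambda>(q, i). Cell (?xs q ! i) (Num 0)) (\<lambda>(q, i). Num (int (length (snd q i))))"
      by (rule ptime_cong) auto
  qed
  from ptime_plus[OF ptime_const[of _ _ "Num 1"] this] show ?thesis
    by (rule ptime_cong) (auto simp: entry_bound_def)
qed

section \<open>Queries to the PTAS and the search\<close>

context rounding
begin

definition weights :: "comb_problem \<Rightarrow> data \<times> (nat \<Rightarrow> (rat \<times> rat) list) \<Rightarrow> nat \<Rightarrow> nat \<Rightarrow> rat" where
  "weights A q b i = of_int (weight (entry_bound A q) (snd q b) i)"

text \<open>Budgets depend on the input only through \<open>M\<close>, so one list of them serves
  all inputs.\<close>

definition query :: "comb_problem \<Rightarrow> (nat \<Rightarrow> nat \<Rightarrow> nat) \<Rightarrow> data \<times> (nat \<Rightarrow> (rat \<times> rat) list) \<Rightarrow>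
    data \<times> (nat \<Rightarrow> nat \<Rightarrow> rat) \<times> (nat \<Rightarrow> rat)" where
  "query A h q = (fst q, weights A q, \<lambda>i. of_nat (h (entry_bound A q) i))"

lemma weight_nonneg: "dist_list es \<Longrightarrow> 0 \<le> weight M es i"
  using mass_nonneg by (simp add: weight_def)

lemma query_in_inputs: "q \<in> eum_inputs A \<Longrightarrow> query A h q \<in> multi_inputs A d"
  using dist_list_eum_inputs[of q A]
  by (auto simp: query_def multi_inputs_def weights_def eum_inputs_def intro!: weight_nonneg)

lemma ptime_query:
  assumes h: "\<And>i. i < d \<Longrightarrow> ptime (eum_inputs A) (enc_eum A) (\<lambda>q. Num (int (h (entry_bound A q) i)))"
  shows "ptime (eum_inputs A) (enc_eum A) (\<lambda>q. enc_multi A d (query A h q))"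
proof -
  let ?I = "eum_inputs A"
  let ?xs = "\<lambda>q. map (\<lambda>b. enc_dist (snd q b)) [0..<ground_size A (fst q)]"
  let ?w = "\<lambda>q b. enc_list (map (\<lambda>i. enc_rat (weights A q b i)) [0..<d])"
  let ?ys = "\<lambda>q. map (?w q) [0..<ground_size A (fst q)]"
  have xs: "ptime ?I (enc_eum A) (\<lambda>q. enc_list (?xs q))" and x: "ptime ?I (enc_eum A) fst"
    unfolding enc_eum_eq by (rule ptime_snd_base ptime_fst_base)+
  have W: "ptime ?I (enc_eum A) (\<lambda>q. enc_list (?ys q))"
  proof (rule ptime_map[OF xs ptime_entry_bound])
    let ?J = "{(q, i). q \<in> ?I \<and> i < length (?xs q)}"
    let ?f = "\<lambda>x. Cell (enc_dist (snd (fst x) (snd x))) (Num (int (entry_bound A (fst x))))"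
    have "ptime ?J ?f (\<lambda>x. Num (weight (entry_bound A (fst x)) (snd (fst x) (snd x)) i))" if "i < d" for i
    proof (rule ptime_weight[OF _ _ that])
      fix x assume "x \<in> ?J"
      then show "dist_list (snd (fst x) (snd x))"
        by (intro dist_list_eum_inputs[of _ A]) auto
    qed (simp add: entry_bound_def)
    then have "ptime ?J ?f (\<lambda>x. enc_list (map (\<lambda>i. enc_rat (weights A (fst x) (snd x) i)) [0..<d]))"
      by (intro ptime_list) (auto simp: enc_rat_def weights_def intro!: ptime_pair ptime_const)
    then show "ptime ?J (\<lambda>(q, i). Cell (?xs q ! i) (Num (int (entry_bound A q)))) (\<lambda>(q, i). ?ys q ! i)"
      by (rule ptime_cong) auto
  qed simp
  have B: "ptime ?I (enc_eum A) (\<lambda>q. enc_list (map (\<lambda>i. enc_rat (of_nat (h (entry_bound A q) i))) [0..<d]))"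
    using h by (intro ptime_list) (auto simp: enc_rat_def intro!: ptime_pair ptime_const)
  from ptime_pair[OF x ptime_pair[OF W B]] show ?thesis
    by (simp add: enc_multi_def query_def case_prod_beta')
qed

text \<open>The list is a constant, so the recursion unfolds into a fixed program. A leaf is a
  refusal, as in \<open>enc_option None\<close>. The value for the empty list is arbitrary: the
  final list ends with a budget that every feasible set meets.\<close>

primrec search :: "comb_problem \<Rightarrow> (data \<times> (nat \<Rightarrow> nat \<Rightarrow> rat) \<times> (nat \<Rightarrow> rat) \<Rightarrow> data) \<Rightarrow>
    (nat \<Rightarrow> nat \<Rightarrow> nat) list \<Rightarrow> data \<times> (nat \<Rightarrow> (rat \<times> rat) list) \<Rightarrow> data" where
  "search A g [] q = Num 0"
| "search A g (h # hs) q = (case g (query A h q) of Num _ \<Rightarrow> search A g hs q | Cell _ v \<Rightarrow> v)"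

lemma ptime_search:
  assumes g: "ptime (multi_inputs A d) (enc_multi A d) g"
    and h: "\<And>h i. h \<in> set hs \<Longrightarrow> i < d \<Longrightarrow>
      ptime (eum_inputs A) (enc_eum A) (\<lambda>q. Num (int (h (entry_bound A q) i)))"
  shows "ptime (eum_inputs A) (enc_eum A) (search A g hs)"
  using h
proof (induction hs)
  case Nil
  then show ?case by (simp add: ptime_const)
next
  case (Cons h hs)
  let ?I = "eum_inputs A"
  have "ptime ?I (\<lambda>q. enc_multi A d (query A h q)) (\<lambda>q. g (query A h q))"
    by (rule ptime_reindex[OF g query_in_inputs])
  with ptime_query[of A h] Cons have out: "ptime ?I (enc_eum A) (\<lambda>q. g (query A h q))"
    by (auto intro: ptime_comp)
  have snd: "ptime {q\<in>?I. \<not> is_Num (g (query A h q))} (enc_eum A)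
      (\<lambda>q. case g (query A h q) of Num _ \<Rightarrow> Num 0 | Cell _ v \<Rightarrow> v)"
  proof (rule ptime_snd[where g = "\<lambda>q. case g (query A h q) of Num _ \<Rightarrow> Num 0 | Cell u _ \<Rightarrow> u"])
    show "ptime {q\<in>?I. \<not> is_Num (g (query A h q))} (enc_eum A)
      (\<lambda>q. Cell (case g (query A h q) of Num _ \<Rightarrow> Num 0 | Cell u _ \<Rightarrow> u)
        (case g (query A h q) of Num _ \<Rightarrow> Num 0 | Cell _ v \<Rightarrow> v))"
      by (rule ptime_cong[OF ptime_subset[OF out]]) (auto split: data.split)
  qed
  have "ptime ?I (enc_eum A) (\<lambda>q. if is_Num (g (query A h q)) then search A g hs q
      else case g (query A h q) of Num _ \<Rightarrow> Num 0 | Cell _ v \<Rightarrow> v)"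
    using Cons by (intro ptime_if ptime_is_Num out snd) (auto intro: ptime_subset)
  then show ?case by (rule ptime_cong) (auto split: data.split)
qed

text \<open>\<open>S\<close> meets \<open>h\<close>, so that query cannot be refused and the search
  stops there or earlier. An earlier stop yields another budget \<open>h'\<close>, which is as good
  once the list is ordered by decreasing surrogate utility.\<close>

lemma search_correct:
  assumes g: "\<And>x. x \<in> multi_inputs A d \<Longrightarrow> multi_correct A d \<eta> x (g x)"
    and q: "q \<in> eum_inputs A"
    and S: "S \<in> feasible A (fst q)"
      "\<And>i. i < d \<Longrightarrow> (\<Sum>b\<in>S. weight (entry_bound A q) (snd q b) i) \<le> int (h (entry_bound A q) i)"
  obtains h' S' where "h' \<in> set (hs @ [h])" "S' \<in> feasible A (fst q)"
    "search A g (hs @ h # hs') q = enc_subset (ground_size A (fst q)) S'"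
    "\<And>i. i < d \<Longrightarrow> real_of_int (\<Sum>b\<in>S'. weight (entry_bound A q) (snd q b) i)
      \<le> (1 + \<eta>) * real (h' (entry_bound A q) i)"
proof -
  let ?M = "entry_bound A q"
  let ?good = "\<lambda>h' S'. S' \<in> feasible A (fst q) \<and>
    (\<forall>i<d. real_of_int (\<Sum>b\<in>S'. weight ?M (snd q b) i) \<le> (1 + \<eta>) * real (h' ?M i))"
  have step: "(\<exists>S'. ?good h' S' \<and> g (query A h' q) = Cell (Num 1) (enc_subset (ground_size A (fst q)) S'))
    \<or> (g (query A h' q) = Num 0 \<and>
        \<not> (\<exists>S'\<in>feasible A (fst q). \<forall>i<d. (\<Sum>b\<in>S'. weight ?M (snd q b) i) \<le> int (h' ?M i)))" for h'
  proof -
    have w: "(\<Sum>b\<in>S'. weights A q b i) = of_int (\<Sum>b\<in>S'. weight ?M (snd q b) i)" for S' i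
      by (simp add: weights_def)
    have le: "(of_int a \<le> (of_nat b :: rat)) \<longleftrightarrow> a \<le> int b" for a b
      by (metis of_int_le_iff of_int_of_nat_eq)
    from g[OF query_in_inputs[OF q, of h']] show ?thesis
      unfolding multi_correct_def query_def by (auto simp: w le simp del: of_int_sum)
  qed
  have "\<exists>h' S'. h' \<in> set (hs @ [h]) \<and> ?good h' S' \<and>
      search A g (hs @ h # hs') q = enc_subset (ground_size A (fst q)) S'"
  proof (induction hs)
    case Nil
    from step[of h] S show ?case by auto
  next
    case (Cons a hs)
    from step[of a] show ?case
    proof (elim disjE exE conjE)
      fix S' assume "S' \<in> feasible A (fst q)"
        "\<forall>i<d. real_of_int (\<Sum>b\<in>S'. weight ?M (snd q b) i) \<le> (1 + \<eta>) * real (a ?M i)"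
        "g (query A a q) = Cell (Num 1) (enc_subset (ground_size A (fst q)) S')"
      then show ?thesis by (intro exI[of _ a] exI[of _ S']) auto
    next
      assume "g (query A a q) = Num 0"
      with Cons show ?thesis by auto
    qed
  qed
  then show thesis using that by blast
qed

end

section \<open>Approximation guarantee\<close>

lemma expectation_pmf_of_list:
  fixes f :: "real \<Rightarrow> real"
  assumes "pmf_of_list_wf xs"
  shows "measure_pmf.expectation (pmf_of_list xs) f = (\<Sum>i<length xs. snd (xs ! i) * f (fst (xs ! i)))"
proof -
  have *: "(\<Sum>a\<in>A. sum_list (map snd (filter (\<lambda>z. fst z = a) ys)) * f a) = (\<Sum>z\<leftarrow>ys. snd z * f (fst z))"
    if "finite A" "fst ` set ys \<subseteq> A" for A and ys :: "(real \<times> real) list"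
    using that(2)
  proof (induction ys)
    case (Cons y ys)
    have "(\<Sum>a\<in>A. sum_list (map snd (filter (\<lambda>z. fst z = a) (y # ys))) * f a) =
        (\<Sum>a\<in>A. (if a = fst y then snd y * f a else 0) + sum_list (map snd (filter (\<lambda>z. fst z = a) ys)) * f a)"
      by (intro sum.cong) (auto simp: algebra_simps)
    then show ?case using Cons that(1) by (simp add: sum.distrib)
  qed simp
  have "measure_pmf.expectation (pmf_of_list xs) f =
      (\<Sum>a\<in>fst ` set xs. pmf (pmf_of_list xs) a *\<^sub>R f a)"
    using set_pmf_of_list[OF assms] by (intro integral_measure_pmf) auto
  also have "\<dots> = (\<Sum>z\<leftarrow>xs. snd z * f (fst z))"
    using *[of "fst ` set xs" xs] by (simp add: pmf_pmf_of_list[OF assms])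
  finally show ?thesis by (simp add: sum_list_sum_nth atLeast0LessThan)
qed

section \<open>The law of the random weights and its transforms\<close>

context
  fixes A :: comb_problem and q :: "data \<times> (nat \<Rightarrow> (rat \<times> rat) list)"
  assumes q: "q \<in> eum_inputs A"
begin

abbreviation law :: "(nat \<Rightarrow> real) pmf" where
  "law \<equiv> Pi_pmf {..<ground_size A (fst q)} 0 (\<lambda>b. pmf_of_list (weight_list (snd q b)))"

lemma weight_list_wf: "b < ground_size A (fst q) \<Longrightarrow> pmf_of_list_wf (weight_list (snd q b))"
  using q by (auto simp: eum_inputs_def case_prod_beta')

lemma finite_law: "finite (set_pmf law)"
  by (rule finite_subset[OF set_Pi_pmf_subset' finite_PiE_dflt])
     (auto intro: finite_set_pmf_of_list weight_list_wf)

lemma law_nonneg: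
  assumes "X \<in> set_pmf law" "b < ground_size A (fst q)"
  shows "0 \<le> X b"
proof -
  have "X b \<in> set_pmf (pmf_of_list (weight_list (snd q b)))"
    using assms set_Pi_pmf_subset'[of "{..<ground_size A (fst q)}" 0] by (auto simp: PiE_dflt_def)
  with set_pmf_of_list[OF weight_list_wf[OF assms(2)]] have "X b \<in> fst ` set (weight_list (snd q b))"
    by auto
  then show ?thesis
    using dist_list_eum_inputs[OF q assms(2)] by (auto simp: weight_list_def dist_list_def case_prod_beta')
qed

lemma expectation_exp:
  assumes S: "S \<subseteq> {..<ground_size A (fst q)}"
  shows "measure_pmf.expectation law (\<lambda>X. exp (- (k * (\<Sum>b\<in>S. X b)))) = (\<Prod>b\<in>S. 1 - loss k (snd q b))"
proof -
  let ?n = "ground_size A (fst q)"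
  \<comment> \<open>Independence is available for products over the whole ground set, so elements
    outside \<open>S\<close> get the factor \<open>1\<close>.\<close>
  let ?f = "\<lambda>b x. if b \<in> S then exp (- (k * x)) else 1 :: real"
  have "exp (- (k * (\<Sum>b\<in>S. X b))) = (\<Prod>b<?n. ?f b (X b))" for X :: "nat \<Rightarrow> real"
  proof -
    have "exp (- (k * (\<Sum>b\<in>S. X b))) = (\<Prod>b\<in>S. exp (- (k * X b)))"
      using finite_subset[OF S] by (simp add: sum_distrib_left sum_negf exp_sum flip: sum_negf exp_sum)
    also have "\<dots> = (\<Prod>b<?n. ?f b (X b))"
      using S by (simp add: prod.If_cases Int_absorb1)
    finally show ?thesis .
  qed
  then have "measure_pmf.expectation law (\<lambda>X. exp (- (k * (\<Sum>b\<in>S. X b)))) =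
      measure_pmf.expectation law (\<lambda>X. \<Prod>b<?n. ?f b (X b))" by simp
  also have "\<dots> = (\<Prod>b<?n. measure_pmf.expectation (pmf_of_list (weight_list (snd q b))) (?f b))"
    by (intro expectation_prod_Pi_pmf integrable_measure_pmf_finite)
       (auto intro: finite_set_pmf_of_list weight_list_wf)
  also have "\<dots> = (\<Prod>b<?n. if b \<in> S then 1 - loss k (snd q b) else 1)"
  proof (intro prod.cong refl)
    fix b assume b: "b \<in> {..<?n}"
    have D: "dist_list (snd q b)" using dist_list_eum_inputs[OF q] b by simp
    have "measure_pmf.expectation (pmf_of_list (weight_list (snd q b))) (\<lambda>x. exp (- (k * x))) =
        (\<Sum>i<length (snd q b). real_of_rat (snd (snd q b ! i)) * exp (- (k * real_of_rat (fst (snd q b ! i)))))"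
      using b by (subst expectation_pmf_of_list[OF weight_list_wf]) (auto simp: weight_list_def case_prod_beta')
    also have "\<dots> = 1 - loss k (snd q b)"
      using D by (simp add: loss_def dist_list_def right_diff_distrib sum_subtractf)
    finally show "measure_pmf.expectation (pmf_of_list (weight_list (snd q b))) (?f b) =
        (if b \<in> S then 1 - loss k (snd q b) else 1)" by simp
  qed
  also have "\<dots> = (\<Prod>b\<in>S. 1 - loss k (snd q b))"
    using S by (simp add: prod.If_cases Int_absorb1)
  finally show ?thesis .
qed

lemma expected_utility_approx:
  assumes S: "S \<subseteq> {..<ground_size A (fst q)}"
    and \<mu>: "\<And>x. 0 \<le> x \<Longrightarrow> \<bar>\<mu> x - (\<Sum>k=1..K. c k * exp (- (real k * x)))\<bar> \<le> e"
  shows "\<bar>expected_utility \<mu> (ground_size A (fst q)) (snd q) S -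
    (\<Sum>k=1..K. c k * (\<Prod>b\<in>S. 1 - loss (real k) (snd q b)))\<bar> \<le> e"
proof -
  let ?g = "\<lambda>x. \<Sum>k=1..K. c k * exp (- (real k * x))"
  have int: "integrable law f" for f :: "_ \<Rightarrow> real"
    by (rule integrable_measure_pmf_finite[OF finite_law])
  have "(\<Sum>k=1..K. c k * (\<Prod>b\<in>S. 1 - loss (real k) (snd q b))) =
      measure_pmf.expectation law (\<lambda>X. ?g (\<Sum>b\<in>S. X b))"
    by (simp add: expectation_exp[OF S, symmetric] int)
  then have "\<bar>expected_utility \<mu> (ground_size A (fst q)) (snd q) S -
      (\<Sum>k=1..K. c k * (\<Prod>b\<in>S. 1 - loss (real k) (snd q b)))\<bar> =
      \<bar>measure_pmf.expectation law (\<lambda>X. \<mu> (\<Sum>b\<in>S. X b) - ?g (\<Sum>b\<in>S. X b))\<bar>"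
    by (simp add: expected_utility_def int)
  also have "\<dots> \<le> measure_pmf.expectation law (\<lambda>X. \<bar>\<mu> (\<Sum>b\<in>S. X b) - ?g (\<Sum>b\<in>S. X b)\<bar>)"
    by (rule integral_abs_bound)
  also have "\<dots> \<le> e"
  proof (rule measure_pmf.integral_le_const[OF int])
    show "AE X in law. \<bar>\<mu> (\<Sum>b\<in>S. X b) - ?g (\<Sum>b\<in>S. X b)\<bar> \<le> e"
    proof (rule AE_pmfI)
      fix X assume "X \<in> set_pmf law"
      then have "0 \<le> (\<Sum>b\<in>S. X b)" using S law_nonneg by (intro sum_nonneg) auto
      then show "\<bar>\<mu> (\<Sum>b\<in>S. X b) - ?g (\<Sum>b\<in>S. X b)\<bar> \<le> e" by (rule \<mu>)
    qed
  qed
  finally show ?thesis .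
qed

lemma expected_utility_nonneg:
  "(\<And>x. 0 \<le> \<mu> x) \<Longrightarrow> 0 \<le> expected_utility \<mu> (ground_size A (fst q)) (snd q) S"
  by (simp add: expected_utility_def)

text \<open>Probabilities sum to \<open>1\<close>, so every distribution has an entry. Thus a sum of
  weights over any set is at most a multiple of \<open>M * M\<close>.\<close>

lemma ground_size_le: "ground_size A (fst q) \<le> entry_bound A q"
proof -
  have "length (snd q b) \<noteq> 0" if "b < ground_size A (fst q)" for b
    using dist_list_eum_inputs[OF q that] by (auto simp: dist_list_def)
  then have "(\<Sum>b<ground_size A (fst q). 1) \<le> (\<Sum>b<ground_size A (fst q). length (snd q b))"
    by (intro sum_mono) (simp add: Suc_le_eq)
  then show ?thesis by (simp add: entry_bound_def)
qed

end

text \<open>\<open>H\<close> and \<open>Y\<close> come first: the other constants must dominate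
  \<open>Suc Y\<close>, and \<open>T\<close> also has to make up for a small loss of the first
  cell.\<close>

lemma rounding_exists:
  fixes \<delta> :: real
  assumes "0 < \<delta>" "\<delta> \<le> 1"
  obtains H Y C R T where "rounding H Y C R T K \<delta>"
proof -
  obtain H Y where H: "0 < H"
    "\<And>k x. 1 \<le> k \<Longrightarrow> k \<le> real K \<Longrightarrow> 0 \<le> x \<Longrightarrow>
      \<bar>(1 - exp (- (k * x))) - cell_frac H Y x * (1 - exp (- (k * cell_val H (cell H Y x))))\<bar>
        \<le> \<delta> * (1 - exp (- (k * x)))"
    using cell_error[OF assms] by blast
  have large: "\<exists>n>0. a \<le> b * real n" if "0 < b" for a b :: real
  proof -
    obtain n where "max 0 (a / b) < real n" using reals_Archimedean2 by blast
    then show ?thesis using that by (intro exI[of _ n]) (auto simp: field_simps)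
  qed
  have s: "0 < 1 - exp (- cell_val H 0)" using H(1) by (simp add: cell_val_def)
  obtain R where R: "0 < R" "real (Suc Y) \<le> \<delta> * real R" using large[OF assms(1)] by blast
  obtain C where C: "0 < C" "real (Suc Y) + 2 \<le> \<delta> * real C" using large[OF assms(1)] by blast
  obtain T where T: "0 < T" "real (Suc Y) \<le> \<delta> * (1 - exp (- cell_val H 0)) * real T"
    using large[OF mult_pos_pos[OF assms(1) s]] by blast
  have "rounding H Y C R T K \<delta>"
    using assms H R C T by unfold_locales (auto simp: mult_ac)
  then show thesis by (rule that)
qed

section \<open>Comparing the utility of a set with the surrogate\<close>

context rounding
begin

text \<open>One large count suffices: all factors lie between \<open>0\<close> and \<open>1\<close>,
  and that one is at most \<open>\<rho> ^ N\<close>. Losses increase with \<open>k\<close>, so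
  \<open>\<rho>\<close> from \<open>k = 1\<close> serves every term.\<close>

lemma walk_small:
  assumes \<mu>: "\<And>x. 0 \<le> x \<Longrightarrow> \<bar>\<mu> x - (\<Sum>k=1..K. c k * exp (- (real k * x)))\<bar> \<le> e" and e: "0 < e'"
  obtains N where "\<And>n i. i < d \<Longrightarrow> N \<le> n i \<Longrightarrow> walk m (cell_val H) coef d n \<mu> 0 \<le> e + e'"
proof -
  define \<theta> where "\<theta> k i = (\<Sum>j<m. coef i j * s k j)" for k i
  have coef0: "0 \<le> coef i j" if "i < d" "j < m" for i j
    using coef_subprob[OF that(1)] that(2) by (simp add: subprob_def)
  have \<theta>_le: "\<theta> k i \<le> 1" "0 \<le> \<theta> k i" if "i < d" "0 \<le> k" for k i
  proof -
    have "\<theta> k i \<le> (\<Sum>j<m. coef i j * 1)"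
      unfolding \<theta>_def using coef0[OF that(1)] s_bounds that by (intro sum_mono mult_left_mono) auto
    also have "\<dots> \<le> 1" using coef_subprob[OF that(1)] by (simp add: subprob_def)
    finally show "\<theta> k i \<le> 1" .
    show "0 \<le> \<theta> k i" unfolding \<theta>_def using coef0[OF that(1)] s_bounds(1)[OF that(2)]
      by (intro sum_nonneg mult_nonneg_nonneg) auto
  qed
  have \<theta>_mono: "\<theta> 1 i \<le> \<theta> k i" if "i < d" "1 \<le> k" for k i
    unfolding \<theta>_def
  proof (intro sum_mono mult_left_mono)
    fix j
    have "1 * cell_val H j \<le> k * cell_val H j"
      using that(2) by (intro mult_right_mono) (auto simp: cell_val_def)
    then show "s 1 j \<le> s k j" by (simp add: s_def)
  qed (use coef0 that in auto)
  define \<rho> where "\<rho> = Max (insert 0 ((\<lambda>i. 1 - \<theta> 1 i) ` {..<d}))"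
  have \<rho>: "0 \<le> \<rho>" "\<rho> < 1" "\<And>i. i < d \<Longrightarrow> 1 - \<theta> 1 i \<le> \<rho>"
    using coef_loss_pos by (auto simp: \<rho>_def \<theta>_def)
  define L where "L = (\<Sum>k=1..K. \<bar>c k\<bar>)"
  have L: "0 \<le> L" by (auto simp: L_def)
  \<comment> \<open>\<open>L + 1\<close> instead of \<open>L\<close>, which may be
    \<open>0\<close>.\<close>
  obtain N where N: "\<rho> ^ N < e' / (L + 1)"
    using real_arch_pow_inv[of "e' / (L + 1)" \<rho>] \<rho> e L by auto
  show thesis
  proof (rule that[of N])
    fix n :: "nat \<Rightarrow> nat" and i assume i: "i < d" "N \<le> n i"
    have "\<bar>walk m (cell_val H) coef d n \<mu> 0 -
        walk m (cell_val H) coef d n (\<lambda>x. \<Sum>k=1..K. c k * exp (- (real k * x))) 0\<bar> \<le> e"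
      using coef_subprob \<mu> by (intro walk_close) (auto simp: cell_val_def)
    moreover have "walk m (cell_val H) coef d n (\<lambda>x. \<Sum>k=1..K. c k * exp (- (real k * x))) 0 =
        (\<Sum>k=1..K. c k * (\<Prod>i<d. (1 - \<theta> (real k) i) ^ n i))"
      unfolding walk_exp by (simp add: \<theta>_def s_def)
    moreover have "(\<Sum>k=1..K. c k * (\<Prod>i<d. (1 - \<theta> (real k) i) ^ n i)) \<le> (\<Sum>k=1..K. \<bar>c k\<bar> * \<rho> ^ N)"
    proof (intro sum_mono)
      fix k assume k: "k \<in> {1..K}"
      have b: "0 \<le> (1 - \<theta> (real k) i) ^ n i" "(1 - \<theta> (real k) i) ^ n i \<le> 1" if "i < d" for i
        using \<theta>_le[OF that, of "real k"] by (auto intro: power_le_one)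
      have "(\<Prod>i<d. (1 - \<theta> (real k) i) ^ n i) =
          (1 - \<theta> (real k) i) ^ n i * (\<Prod>i\<in>{..<d} - {i}. (1 - \<theta> (real k) i) ^ n i)"
        using i by (intro prod.remove) auto
      also have "\<dots> \<le> (1 - \<theta> (real k) i) ^ n i * 1"
        using b i by (intro mult_left_mono prod_le_1) auto
      also have "\<dots> \<le> \<rho> ^ n i * 1"
        using \<rho>(3)[OF i(1)] \<theta>_mono[OF i(1), of "real k"] \<theta>_le[OF i(1), of "real k"] k
        by (intro mult_right_mono power_mono) auto
      also have "\<dots> \<le> \<rho> ^ N * 1"
        using \<rho> i by (intro mult_right_mono power_decreasing) auto
      finally have le: "(\<Prod>i<d. (1 - \<theta> (real k) i) ^ n i) \<le> \<rho> ^ N" by simp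
      have "0 \<le> (\<Prod>i<d. (1 - \<theta> (real k) i) ^ n i)" using b by (intro prod_nonneg) auto
      then have "c k * (\<Prod>i<d. (1 - \<theta> (real k) i) ^ n i) \<le> \<bar>c k\<bar> * (\<Prod>i<d. (1 - \<theta> (real k) i) ^ n i)"
        by (intro mult_right_mono) auto
      also have "\<dots> \<le> \<bar>c k\<bar> * \<rho> ^ N" using le by (intro mult_left_mono) auto
      finally show "c k * (\<Prod>i<d. (1 - \<theta> (real k) i) ^ n i) \<le> \<bar>c k\<bar> * \<rho> ^ N" .
    qed
    moreover have "(\<Sum>k=1..K. \<bar>c k\<bar> * \<rho> ^ N) \<le> e'"
    proof -
      have "(\<Sum>k=1..K. \<bar>c k\<bar> * \<rho> ^ N) = L * \<rho> ^ N" by (simp add: L_def sum_distrib_right)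
      also have "\<dots> \<le> (L + 1) * \<rho> ^ N" using \<rho> by (intro mult_right_mono) auto
      also have "\<dots> \<le> e'" using N L by (simp add: field_simps)
      finally show ?thesis .
    qed
    ultimately show "walk m (cell_val H) coef d n \<mu> 0 \<le> e + e'" by linarith
  qed
qed

text \<open>The exponential sum is the bridge: \<open>e\<close> is paid on either side to reach it,
  and \<open>laplace_approx\<close> compares the transforms term by term. Light counts may be off by
  one unit in both directions, so they can be rounded up as well as down.\<close>

lemma expected_utility_walk:
  assumes q: "q \<in> eum_inputs A" and S: "S \<subseteq> {..<ground_size A (fst q)}"
    and \<mu>: "\<And>x. 0 \<le> x \<Longrightarrow> \<bar>\<mu> x - (\<Sum>k=1..K. c k * exp (- (real k * x)))\<bar> \<le> e"
    and light: "\<And>i. i < m \<Longrightarrow>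
      \<bar>(\<Sum>b\<in>S. weight (entry_bound A q) (snd q b) i) - int (n i * entry_bound A q)\<bar> \<le> int (entry_bound A q)"
    and heavy: "\<And>i. m \<le> i \<Longrightarrow> i < d \<Longrightarrow>
      (\<Sum>b\<in>S. weight (entry_bound A q) (snd q b) i) = int (n i * entry_bound A q)"
  shows "\<bar>expected_utility \<mu> (ground_size A (fst q)) (snd q) S - walk m (cell_val H) coef d n \<mu> 0\<bar>
    \<le> 2 * e + (\<Sum>k=1..K. \<bar>c k\<bar>) * (3 * \<delta>)"
proof -
  let ?x = "\<lambda>k. \<Prod>b\<in>S. 1 - loss (real k) (snd q b)"
  let ?y = "\<lambda>k. \<Prod>i<d. (1 - (\<Sum>j<m. coef i j * s (real k) j)) ^ n i"
  have 1: "\<bar>expected_utility \<mu> (ground_size A (fst q)) (snd q) S - (\<Sum>k=1..K. c k * ?x k)\<bar> \<le> e"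
    by (rule expected_utility_approx[OF q S \<mu>])
  have "\<bar>walk m (cell_val H) coef d n \<mu> 0 -
      walk m (cell_val H) coef d n (\<lambda>x. \<Sum>k=1..K. c k * exp (- (real k * x))) 0\<bar> \<le> e"
    using coef_subprob \<mu> by (intro walk_close) (auto simp: cell_val_def)
  moreover have "walk m (cell_val H) coef d n (\<lambda>x. \<Sum>k=1..K. c k * exp (- (real k * x))) 0 =
      (\<Sum>k=1..K. c k * ?y k)"
    unfolding walk_exp by (simp add: s_def)
  ultimately have 2: "\<bar>walk m (cell_val H) coef d n \<mu> 0 - (\<Sum>k=1..K. c k * ?y k)\<bar> \<le> e" by simp
  have fin: "finite S" using S finite_subset by blast
  have "\<bar>(\<Sum>k=1..K. c k * ?x k) - (\<Sum>k=1..K. c k * ?y k)\<bar> \<le> (\<Sum>k=1..K. \<bar>c k * ?x k - c k * ?y k\<bar>)"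
    unfolding sum_subtractf[symmetric] by (rule sum_abs)
  also have "\<dots> \<le> (\<Sum>k=1..K. \<bar>c k\<bar> * (3 * \<delta>))"
  proof (intro sum_mono)
    fix k assume k: "k \<in> {1..K}"
    have "(\<Sum>b\<in>S. length (snd q b)) \<le> (\<Sum>b<ground_size A (fst q). length (snd q b))"
      using S by (intro sum_mono2) auto
    then have len: "(\<Sum>b\<in>S. length (snd q b)) \<le> entry_bound A q" by (simp add: entry_bound_def)
    have "\<bar>?x k - ?y k\<bar> \<le> 3 * \<delta>"
      using S k by (intro laplace_approx[OF fin _ _ len _ _ light heavy])
        (auto intro: dist_list_eum_inputs[OF q] simp: entry_bound_def)
    then have "\<bar>c k\<bar> * \<bar>?x k - ?y k\<bar> \<le> \<bar>c k\<bar> * (3 * \<delta>)" by (intro mult_left_mono) auto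
    then show "\<bar>c k * ?x k - c k * ?y k\<bar> \<le> \<bar>c k\<bar> * (3 * \<delta>)"
      by (simp only: abs_mult flip: right_diff_distrib)
  qed
  also have "\<dots> = (\<Sum>k=1..K. \<bar>c k\<bar>) * (3 * \<delta>)" by (simp only: sum_distrib_right)
  finally show ?thesis using 1 2 by linarith
qed

lemma weight_sum_le:
  assumes q: "q \<in> eum_inputs A" and S: "S \<subseteq> {..<ground_size A (fst q)}"
  shows "(\<Sum>b\<in>S. weight (entry_bound A q) (snd q b) i) \<le> int (C * entry_bound A q * entry_bound A q)"
proof -
  let ?M = "entry_bound A q"
  have "(\<Sum>b\<in>S. weight ?M (snd q b) i) \<le> (\<Sum>b\<in>S. int (C * ?M))"
  proof (intro sum_mono)
    fix b assume "b \<in> S"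
    then have "dist_list (snd q b)" using S by (auto intro: dist_list_eum_inputs[OF q])
    moreover have "?M \<le> C * ?M" using C_pos by (cases C) auto
    then have "int ?M \<le> int (C * ?M)" by (simp only: of_nat_le_iff)
    ultimately show "weight ?M (snd q b) i \<le> int (C * ?M)"
      using mass_le[of "snd q b" i ?M] by (simp add: weight_def)
  qed
  also have "\<dots> = int (card S) * int (C * ?M)" by simp
  also have "\<dots> \<le> int ?M * int (C * ?M)"
  proof (intro mult_right_mono)
    have "card S \<le> card {..<ground_size A (fst q)}" using S by (intro card_mono) auto
    with ground_size_le[OF q] show "int (card S) \<le> int ?M" by simp
  qed simp
  finally show ?thesis by (simp add: mult_ac)
qed

lemma heavy_weight_dvd: "m \<le> i \<Longrightarrow> int M dvd (\<Sum>b\<in>S. weight M (D b) i)"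
  by (intro dvd_sum) (auto simp: weight_def)

text \<open>\<open>hi\<close> is a vector of budgets that the set meets and is used for an optimal
  set; \<open>lo\<close> stays below every budget that the set exceeds by less than one unit and is
  used for the set returned. Both approximate the set equally well, and they agree in the heavy
  dimensions, where the sums are multiples of \<open>M\<close>.\<close>

lemma signature:
  fixes W :: "nat \<Rightarrow> int" and M :: nat
  assumes "0 < M" "\<And>i. 0 \<le> W i" "\<And>i. m \<le> i \<Longrightarrow> int M dvd W i"
  defines "lo \<equiv> \<lambda>i. nat (W i div int M)"
    and "hi \<equiv> \<lambda>i. nat (W i div int M) + (if i < m then 1 else 0)"
  shows "i < m \<Longrightarrow> \<bar>W i - int (lo i * M)\<bar> \<le> int M" "m \<le> i \<Longrightarrow> W i = int (lo i * M)"
    and "i < m \<Longrightarrow> \<bar>W i - int (hi i * M)\<bar> \<le> int M" "m \<le> i \<Longrightarrow> W i = int (hi i * M)"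
    and "W i \<le> int (hi i * M)" and "W i < (int l + 1) * int M \<Longrightarrow> lo i \<le> l"
proof -
  have d: "0 \<le> W i div int M" using assms(1,2) by (simp add: pos_imp_zdiv_nonneg_iff)
  have M: "0 < int M" using assms(1) by simp
  have lo: "int (lo i * M) = W i div int M * int M" using d by (simp add: lo_def)
  have e: "W i = W i div int M * int M + W i mod int M" by simp
  have r: "0 \<le> W i mod int M" "W i mod int M < int M" using M by simp_all
  have hi: "int (hi i * M) = W i div int M * int M + (if i < m then int M else 0)"
    using d by (simp add: hi_def algebra_simps)
  show "i < m \<Longrightarrow> \<bar>W i - int (lo i * M)\<bar> \<le> int M" unfolding lo using e r by linarith
  show "i < m \<Longrightarrow> \<bar>W i - int (hi i * M)\<bar> \<le> int M" unfolding hi using e r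
    by (simp only: if_True)
  show lo': "W i = int (lo i * M)" if "m \<le> i" unfolding lo using assms(3)[OF that] by simp
  then show "m \<le> i \<Longrightarrow> W i = int (hi i * M)" unfolding lo hi by simp
  show "W i \<le> int (hi i * M)"
  proof (cases "i < m")
    case True
    then show ?thesis unfolding hi using e r by (simp only: if_True)
  next
    case False
    then show ?thesis unfolding hi using assms(3)[of i] by simp
  qed
  assume "W i < (int l + 1) * int M"
  moreover have "(int l + 1) * int M \<le> W i div int M * int M" if "int l + 1 \<le> W i div int M"
    using that M by (intro mult_right_mono) auto
  ultimately have "W i div int M < int l + 1" using e r by linarith
  then show "lo i \<le> l" unfolding lo_def by linarith
qed

end

theorem theorem2:
  fixes A :: comb_problem and \<mu> :: "real \<Rightarrow> real" and \<alpha> \<epsilon> :: real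
  assumes "combinatorial_problem A"
    and "multidim_PTAS A"
    and "\<forall>x. 0 \<le> \<mu> x"
    and "antimono \<mu>"
    and "(\<mu> \<longlongrightarrow> 0) at_top"
    and "\<alpha> > 0"
    and "\<alpha>-lipschitz_on {0..} \<mu>"
    and "\<epsilon> > 0"
  shows "\<exists>P. poly_time_solves P (eum_inputs A) (enc_eum A) (eum_correct A \<mu> \<epsilon>)"
proof -
  have cont: "continuous_on {0..} \<mu>" using assms(7) by (rule lipschitz_on_continuous_on)
  \<comment> \<open>Comparing a set with its surrogate costs
    \<open>2 * (\<epsilon> / 8) + \<epsilon> / 8\<close>, and this happens twice. If a count of the
    optimal set is too large, OPT is at most this amount plus \<open>\<epsilon> / 4\<close>.\<close>
  have "0 < \<epsilon> / 8" using assms(8) by simp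
  then obtain K c where \<mu>: "\<And>x. 0 \<le> x \<Longrightarrow> \<bar>\<mu> x - (\<Sum>k=1..K. c k * exp (- (real k * x)))\<bar> \<le> \<epsilon> / 8"
    by (rule exp_sum_approximation[OF cont assms(5)]) blast
  define L where "L = (\<Sum>k=1..K. \<bar>c k\<bar>)"
  have L: "0 \<le> L" by (auto simp: L_def)
  \<comment> \<open>The \<open>24\<close> gives
    \<open>L * (3 * \<delta>) \<le> \<epsilon> / 8\<close>, \<open>L + 1\<close> avoids a zero
    denominator, and \<open>cell_error\<close> wants \<open>\<delta> \<le> 1\<close>.\<close>
  define \<delta> where "\<delta> = min 1 (\<epsilon> / (24 * (L + 1)))"
  have \<delta>: "0 < \<delta>" "\<delta> \<le> 1" using assms(8) L by (auto simp: \<delta>_def)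
  have "L * (3 * \<delta>) \<le> (L + 1) * (3 * (\<epsilon> / (24 * (L + 1))))"
    using L \<delta> by (intro mult_mono) (auto simp: \<delta>_def)
  also have "\<dots> = \<epsilon> / 8" using L by (simp add: field_simps)
  finally have L\<delta>: "L * (3 * \<delta>) \<le> \<epsilon> / 8" .
  obtain H Y C R T where "rounding H Y C R T K \<delta>" using rounding_exists[OF \<delta>] by blast
  then interpret rounding H Y C R T K \<delta> .
  define F where "F n = walk m (cell_val H) coef d n \<mu> 0" for n
  obtain N where N: "\<And>n i. i < d \<Longrightarrow> N \<le> n i \<Longrightarrow> F n \<le> \<epsilon> / 8 + \<epsilon> / 8"
    using walk_small[OF \<mu>, of "\<epsilon> / 8"] assms(8) unfolding F_def by auto
  \<comment> \<open>Fine enough for a violated budget \<open>l ! i * M\<close> with \<open>l ! i < N\<close> to be exceeded by less than \<open>M\<close>.\<close>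
  define \<eta> where "\<eta> = 1 / (real N + 1)"
  have "1 \<le> d" by (simp add: d_def m_def)
  moreover have "0 < \<eta>" by (simp add: \<eta>_def)
  ultimately obtain P where "poly_time_solves P (multi_inputs A d) (enc_multi A d) (multi_correct A d \<eta>)"
    using assms(2) unfolding multidim_PTAS_def by blast
  then obtain g where g: "ptime (multi_inputs A d) (enc_multi A d) g"
    "\<And>x. x \<in> multi_inputs A d \<Longrightarrow> multi_correct A d \<eta> x (g x)"
    by (rule poly_time_solves_imp_ptime) blast
  \<comment> \<open>The real numbers \<open>F\<close> need not be computable: the list is sorted
    once and for all, outside the program, which contains only the resulting order.\<close>
  define cands where "cands = sort_key (\<lambda>l. - F ((!) l)) (List.n_lists d [0..<N])"
  define budget where "budget = (\<lambda>(l :: nat list) M i. l ! i * M)"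
  define hs where "hs = map budget cands"
  \<comment> \<open>A budget met by every feasible set: if no candidate succeeds, then OPT is at most \<open>\<epsilon>\<close>.\<close>
  define top where "top = (\<lambda>M (i :: nat). C * M * M)"
  have "ptime (eum_inputs A) (enc_eum A) (search A g (hs @ [top]))"
  proof (rule ptime_search[OF g(1)])
    fix h i assume "h \<in> set (hs @ [top])"
    then consider l where "h = budget l" | "h = top" by (auto simp: hs_def)
    then show "ptime (eum_inputs A) (enc_eum A) (\<lambda>q. Num (int (h (entry_bound A q) i)))"
      by cases (auto simp: budget_def top_def intro!: ptime_times ptime_const ptime_entry_bound)
  qed
  then show ?thesis
  proof (rule ptime_imp_poly_time_solves)
    fix q assume q: "q \<in> eum_inputs A"
    define M n where "M = entry_bound A q" and "n = ground_size A (fst q)"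
    define W where "W S i = (\<Sum>b\<in>S. weight M (snd q b) i)" for S i
    define EU where "EU = expected_utility \<mu> n (snd q)"
    have M: "0 < M" by (simp add: M_def entry_bound_def)
    have sub: "S \<subseteq> {..<n}" if "S \<in> feasible A (fst q)" for S
    proof -
      have "fst q \<in> instances A" using q by (auto simp: eum_inputs_def)
      then show ?thesis using that assms(1) unfolding combinatorial_problem_def n_def by blast
    qed
    have W0: "0 \<le> W S i" if "S \<in> feasible A (fst q)" for S i
      unfolding W_def using sub[OF that]
      by (intro sum_nonneg weight_nonneg dist_list_eum_inputs[OF q]) (auto simp: n_def)
    have Wdvd: "int M dvd W S i" if "m \<le> i" for S i
      unfolding W_def by (rule heavy_weight_dvd[OF that])
    have EU_walk: "\<bar>EU S - F c'\<bar> \<le> 3 * \<epsilon> / 8"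
      if "S \<in> feasible A (fst q)" "\<And>i. i < m \<Longrightarrow> \<bar>W S i - int (c' i * M)\<bar> \<le> int M"
        "\<And>i. m \<le> i \<Longrightarrow> i < d \<Longrightarrow> W S i = int (c' i * M)" for S c'
      using expected_utility_walk[OF q sub[OF that(1), unfolded n_def] \<mu>, of c'] that L\<delta>
      unfolding EU_def F_def W_def M_def n_def L_def by fastforce
    show "eum_correct A \<mu> \<epsilon> q (search A g (hs @ [top]) q)"
      unfolding eum_correct_def case_prod_beta'
    proof
      assume ne: "feasible A (fst q) \<noteq> {}"
      have "finite (feasible A (fst q))"
        by (rule finite_subset[of _ "Pow {..<n}"]) (use sub in auto)
      then have "eum_opt A \<mu> (fst q) (snd q) \<in> EU ` feasible A (fst q)"
        unfolding eum_opt_def EU_def n_def using ne by (intro Max_in) auto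
      then obtain S where S: "S \<in> feasible A (fst q)" "EU S = eum_opt A \<mu> (fst q) (snd q)" by auto
      note sig = signature[OF M W0[OF S(1)] Wdvd]
      \<comment> \<open>Rounded up, by a whole unit even if \<open>M\<close> divides the mass:
        \<open>S\<close> meets these budgets, and one unit is what \<open>EU_walk\<close>
        tolerates.\<close>
      define l where "l = map (\<lambda>i. nat (W S i div int M) + (if i < m then 1 else 0)) [0..<d]"
      have l_nth: "l ! i = nat (W S i div int M) + (if i < m then 1 else 0)" if "i < d" for i
        using that by (simp add: l_def)
      have m_d: "i < d" if "i < m" for i using that by (simp add: d_def)
      have EU_S: "\<bar>EU S - F ((!) l)\<bar> \<le> 3 * \<epsilon> / 8"
        using sig m_d by (intro EU_walk S(1)) (simp_all only: l_nth)
      obtain S' where S': "S' \<in> feasible A (fst q)"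
        "search A g (hs @ [top]) q = enc_subset n S'" "EU S' \<ge> EU S - \<epsilon>"
      proof (cases "\<forall>i<d. l ! i < N")
        case True
        then have "l \<in> set (List.n_lists d [0..<N])"
          by (auto simp: set_n_lists in_set_conv_nth l_def)
        then have "l \<in> set cands" by (simp add: cands_def)
        then obtain xs ys where cands: "cands = xs @ l # ys" by (auto dest: split_list)
        have "sorted (map (\<lambda>l. - F ((!) l)) cands)" by (simp add: cands_def)
        then have F_l: "F ((!) l) \<le> F ((!) l')" if "l' \<in> set (xs @ [l])" for l'
          using that unfolding cands by (auto simp: sorted_append)
        have "W S i \<le> int (budget l M i)" if "i < d" for i
          using sig(5) that by (simp only: budget_def l_nth)
        then obtain h' S' where h': "h' \<in> set (map budget xs @ [budget l])" "S' \<in> feasible A (fst q)"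
          "search A g (map budget xs @ budget l # (map budget ys @ [top])) q = enc_subset n S'"
          "\<And>i. i < d \<Longrightarrow> real_of_int (W S' i) \<le> (1 + \<eta>) * real (h' M i)"
          using search_correct[OF g(2) q S(1), of "budget l" "map budget xs" "map budget ys @ [top]"]
          unfolding W_def M_def n_def by metis
        then obtain l' where l': "l' \<in> set (xs @ [l])" "h' = budget l'" by auto
        then have "l' \<in> set cands" by (auto simp: cands)
        then have l'_box: "length l' = d" "set l' \<subseteq> set [0..<N]" by (simp_all add: cands_def set_n_lists)
        have l'N: "l' ! i < N" if "i < d" for i
        proof -
          have "l' ! i \<in> set l'" using that l'_box(1) by simp
          with l'_box(2) show ?thesis by auto
        qed
        define lo where "lo = (\<lambda>i. nat (W S' i div int M))"
        note sig' = signature[OF M W0[OF h'(2)] Wdvd]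
        have lo: "lo i \<le> l' ! i" if "i < d" for i
          unfolding lo_def
        proof (rule sig'(6))
          have "\<eta> * real (l' ! i) < 1"
            using l'N[OF that] by (simp add: \<eta>_def field_simps)
          then have "\<eta> * real (l' ! i) * real M < 1 * real M" using M by (intro mult_strict_right_mono) auto
          then have "(1 + \<eta>) * real (l' ! i * M) < (real (l' ! i) + 1) * real M"
            by (simp add: algebra_simps)
          with h'(4)[OF that] have "real_of_int (W S' i) < real_of_int ((int (l' ! i) + 1) * int M)"
            by (simp add: l'(2) budget_def)
          then show "W S' i < (int (l' ! i) + 1) * int M" by (simp only: of_int_less_iff)
        qed
        have "F ((!) l') \<le> F lo"
          unfolding F_def using coef_subprob lo assms(4)
          by (intro walk_decreasing) (auto simp: cell_val_def)
        moreover have "\<bar>EU S' - F lo\<bar> \<le> 3 * \<epsilon> / 8"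
          using sig' by (intro EU_walk h'(2)) (simp_all only: lo_def)
        \<comment> \<open>In short, \<open>EU S' + 3 * \<epsilon> / 8 \<ge> F lo \<ge> F ((!) l')
          \<ge> F ((!) l) \<ge> EU S - 3 * \<epsilon> / 8\<close>.\<close>
        ultimately have "EU S' \<ge> EU S - \<epsilon>" using EU_S F_l[OF l'(1)] assms(8) by linarith
        then show thesis using that h'(2,3) by (simp add: hs_def cands)
      next
        case False
        then obtain i where "i < d" "N \<le> l ! i" by (auto simp: not_less)
        then have small: "EU S \<le> \<epsilon>" using N[of i "(!) l"] EU_S assms(8) by linarith
        have pos: "0 \<le> EU S'" for S'
          unfolding EU_def n_def using assms(3) by (intro expected_utility_nonneg[OF q]) auto
        have "W S i \<le> int (top M i)" for i
          unfolding W_def top_def M_def by (rule weight_sum_le[OF q sub[OF S(1), unfolded n_def]])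
        then obtain h' S' where S': "S' \<in> feasible A (fst q)"
          "search A g (hs @ top # []) q = enc_subset n S'"
          using search_correct[OF g(2) q S(1), of top hs "[]"]
          unfolding W_def M_def n_def by metis
        \<comment> \<open>A candidate may well succeed before \<open>top\<close>; since utilities
          are nonnegative, any feasible set is good enough here.\<close>
        have "EU S' \<ge> EU S - \<epsilon>" using small pos[of S'] by linarith
        with S' show thesis by (rule that)
      qed
      then show "\<exists>S\<in>feasible A (fst q). search A g (hs @ [top]) q = enc_subset (ground_size A (fst q)) S \<and>
          eum_opt A \<mu> (fst q) (snd q) - \<epsilon> \<le> expected_utility \<mu> (ground_size A (fst q)) (snd q) S"
        using S by (auto simp: EU_def n_def)
    qed
  qed
qed

end
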